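(* Let $1\le t<n$ and let $|\psi\rangle$ be an $n$-qubit pure state. Let $\varepsilon_A,\varepsilon_B\in[0,1]$ with $\varepsilon_B>\sqrt{(n-t)\varepsilon_A}$, let $\delta\in(0,1]$, and set $\varepsilon_{\mathrm{corr}}:=\frac{\varepsilon_B^2}{n-t}-\varepsilon_A$. Assume that either $$\min_{|\phi_t\rangle\in\mathcal{G}_t}d_{\mathrm{tr}}(|\psi\rangle,|\phi_t\rangle)\le\varepsilon_A\qquad\text{or}\qquad \min_{|\phi_t\rangle\in\mathcal{G}_t}d_{\mathrm{tr}}(|\psi\rangle,|\phi_t\rangle)>\varepsilon_B .$$ Then the testing algorithm described in the context discriminates between these two scenarios using $$N=\left\lceil \frac{16\,n^3}{\varepsilon_{\mathrm{corr}}^2}\log\left(\frac{4n^2}{\delta}\right)\right\rceil$$ single-copy measurements of the state $|\psi\rangle$, with probability of success at least $1-\delta$.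
   Context: On $n$ qubits with Pauli operators $X_k,Y_k,Z_k$, the Majorana operators are $\gamma_{2k-1}:=(\prod_{j=1}^{k-1}Z_j)X_k$ and $\gamma_{2k}:=(\prod_{j=1}^{k-1}Z_j)Y_k$, $k\in[n]:=\{1,\dots,n\}$. A Gaussian unitary is a unitary $G$ for which there is $O\in\mathrm{O}(2n)$ with $G^\dagger\gamma_\mu G=\sum_{\nu}O_{\mu,\nu}\gamma_\nu$ for all $\mu\in[2n]$. $\mathcal{G}_t$ is the set of pure $t$-compressible Gaussian states on $n$ qubits: states $G(|\phi\rangle\otimes|0^{n-t}\rangle)$ with $G$ a Gaussian unitary and $|\phi\rangle$ a pure state on the first $t$ qubits. $d_{\mathrm{tr}}(\rho,\sigma)=\frac12\|\rho-\sigma\|_1$. The correlation matrix of $\rho$ is $[C(\rho)]_{j,k}=-\frac i2\mathrm{Tr}([\gamma_j,\gamma_k]\rho)$, $j,k\in[2n]$. The normal eigenvalues $0\le\lambda_1\le\dots\le\lambda_n$ of a real antisymmetric $2n\times 2n$ matrix are the numbers such that its eigenvalues are $\pm i\lambda_j$, $j\in[n]$. Testing algorithm. Using $N$ single-copy measurements of $|\psi\rangle$, estimate the entries of its correlation matrix: partition the $n(2n-1)$ observables $-i\gamma_j\gamma_k$, $j<k$, into $2n-1$ sets of $n$ mutually commuting observables, measure each set jointly on equally many copies (a Gaussian unitary followed by a computational basis measurement), and take empirical means, obtaining a real antisymmetric matrix $\hat\Gamma$ with ordered normal eigenvalues $\hat\lambda_1\le\dots\le\hat\lambda_n$. With $\varepsilon_{\mathrm{test}}:=\frac{\varepsilon_B^2}{n-t}+\varepsilon_A$,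 output "$\varepsilon_A$-close to $\mathcal{G}_t$" if $\hat\lambda_{t+1}\ge1-\varepsilon_{\mathrm{test}}$, and "$\varepsilon_B$-far from $\mathcal{G}_t$" otherwise. *)

theory Defs
  imports
    "HOL-Probability.Probability"
    "HOL-Library.Disjoint_Sets"
    "Jordan_Normal_Form.Schur_Decomposition"
begin

unbundle no vec_syntax
no_notation inner (infix "\<bullet>" 70)

text \<open>
  Qubits and Majorana operators are numbered from \<open>0\<close>, so \<open>majorana n \<mu>\<close>, \<open>\<mu> < 2 * n\<close>, is the
  operator usually written with the index \<open>\<mu> + 1\<close>. The space of \<open>n\<close> qubits is \<open>\<complex>\<close> to the power
  \<open>2 ^ n\<close>; qubit \<open>0\<close> is the leftmost tensor factor, hence the most significant bit of an index.
\<close>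

definition kron_mat :: "complex mat \<Rightarrow> complex mat \<Rightarrow> complex mat" where
  "kron_mat A B = mat (dim_row A * dim_row B) (dim_col A * dim_col B)
     (\<lambda>(i, j). A $$ (i div dim_row B, j div dim_col B) * B $$ (i mod dim_row B, j mod dim_col B))"

definition kron_vec :: "complex vec \<Rightarrow> complex vec \<Rightarrow> complex vec" where
  "kron_vec v w = vec (dim_vec v * dim_vec w) (\<lambda>i. v $ (i div dim_vec w) * w $ (i mod dim_vec w))"

definition pauli_X :: "complex mat" where
  "pauli_X = mat_of_rows_list 2 [[0, 1], [1, 0]]"

definition pauli_Y :: "complex mat" where
  "pauli_Y = mat_of_rows_list 2 [[0, - \<i>], [\<i>, 0]]"

definition pauli_Z :: "complex mat" where
  "pauli_Z = mat_of_rows_list 2 [[1, 0], [0, - 1]]"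

definition on_qubit :: "nat \<Rightarrow> nat \<Rightarrow> complex mat \<Rightarrow> complex mat" where
  "on_qubit n k A = kron_mat (kron_mat (1\<^sub>m (2 ^ k)) A) (1\<^sub>m (2 ^ (n - k - 1)))"

definition majorana :: "nat \<Rightarrow> nat \<Rightarrow> complex mat" where
  "majorana n \<mu> =
     (let k = \<mu> div 2
      in foldr (\<lambda>j A. on_qubit n j pauli_Z * A) [0..<k]
           (on_qubit n k (if even \<mu> then pauli_X else pauli_Y)))"

definition unitary_mat :: "nat \<Rightarrow> complex mat \<Rightarrow> bool" where
  "unitary_mat d U \<longleftrightarrow> U \<in> carrier_mat d d \<and> mat_adjoint U * U = 1\<^sub>m d \<and> U * mat_adjoint U = 1\<^sub>m d"

definition real_orthogonal_mat :: "nat \<Rightarrow> real mat \<Rightarrow> bool" where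
  "real_orthogonal_mat d Q \<longleftrightarrow>
     Q \<in> carrier_mat d d \<and> transpose_mat Q * Q = 1\<^sub>m d \<and> Q * transpose_mat Q = 1\<^sub>m d"

text \<open>The sum over \<open>\<nu>\<close> is taken entrywise because \<^typ>\<open>complex mat\<close> has no zero of its own.\<close>

definition gaussian_unitary :: "nat \<Rightarrow> complex mat \<Rightarrow> bool" where
  "gaussian_unitary n G \<longleftrightarrow> unitary_mat (2 ^ n) G \<and>
     (\<exists>Q. real_orthogonal_mat (2 * n) Q \<and>
       (\<forall>\<mu> < 2 * n. mat_adjoint G * majorana n \<mu> * G =
          mat (2 ^ n) (2 ^ n)
            (\<lambda>ij. \<Sum>\<nu> < 2 * n. complex_of_real (Q $$ (\<mu>, \<nu>)) * majorana n \<nu> $$ ij)))"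

definition pure_state :: "nat \<Rightarrow> complex vec \<Rightarrow> bool" where
  "pure_state n \<psi> \<longleftrightarrow> \<psi> \<in> carrier_vec (2 ^ n) \<and> \<psi> \<bullet>c \<psi> = 1"

definition compressible_gaussian :: "nat \<Rightarrow> nat \<Rightarrow> complex vec set" where
  "compressible_gaussian n t =
     {G *\<^sub>v kron_vec \<phi> (unit_vec (2 ^ (n - t)) 0) |G \<phi>. gaussian_unitary n G \<and> pure_state t \<phi>}"

definition density :: "complex vec \<Rightarrow> complex mat" where
  "density \<psi> = mat (dim_vec \<psi>) (dim_vec \<psi>) (\<lambda>(i, j). \<psi> $ i * cnj (\<psi> $ j))"

text \<open>
  The trace norm is the sum of the singular values. The roots of the characteristic polynomial of
  \<open>mat_adjoint A * A\<close> are real and nonnegative; \<^const>\<open>proots\<close> counts them with multiplicity.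
\<close>

definition trace_norm :: "complex mat \<Rightarrow> real" where
  "trace_norm A =
     (\<Sum>x \<in># proots (char_poly (mat_adjoint A * A)). sqrt (Re x))"

definition trace_distance :: "complex mat \<Rightarrow> complex mat \<Rightarrow> real" where
  "trace_distance \<rho> \<sigma> = trace_norm (\<rho> - \<sigma>) / 2"

text \<open>
  The set of compressible states is compact and nonempty (for \<open>t \<le> n\<close>), so this infimum is
  the minimum.
\<close>

definition distance_to_compressible :: "nat \<Rightarrow> nat \<Rightarrow> complex vec \<Rightarrow> real" where
  "distance_to_compressible n t \<psi> =
     (INF \<phi> \<in> compressible_gaussian n t. trace_distance (density \<psi>) (density \<phi>))"

text \<open>
  The increasing list of the normal eigenvalues of a real antisymmetric matrix of size \<open>2 * n\<close>.
  Comparing degrees shows that it has length \<open>n\<close>.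
\<close>

definition normal_eigenvalues :: "real mat \<Rightarrow> real list" where
  "normal_eigenvalues A =
     (THE ls. sorted ls \<and> (\<forall>l \<in> set ls. 0 \<le> l) \<and>
        char_poly (map_mat complex_of_real A) =
          (\<Prod>l \<leftarrow> ls. [:- (\<i> * complex_of_real l), 1:] * [:\<i> * complex_of_real l, 1:]))"

definition pair_observable :: "nat \<Rightarrow> nat \<times> nat \<Rightarrow> complex mat" where
  "pair_observable n p = (- \<i>) \<cdot>\<^sub>m (majorana n (fst p) * majorana n (snd p))"

text \<open>
  A measurement scheme: the observables are partitioned into commuting sets, the elements \<open>B\<close> of
  \<open>P\<close>; to measure \<open>B\<close>, apply the Gaussian unitary \<open>G B\<close> and measure in the computational basis.
  The last condition says that \<open>G B\<close> takes the observable \<open>p\<close> to the Pauli \<open>Z\<close> operator of qubit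
  \<open>q p\<close>, whose outcome is therefore that of \<open>p\<close>.
\<close>

definition measurement_scheme ::
  "nat \<Rightarrow> (nat \<times> nat) set set \<Rightarrow> ((nat \<times> nat) set \<Rightarrow> complex mat) \<Rightarrow> (nat \<times> nat \<Rightarrow> nat) \<Rightarrow> bool" where
  "measurement_scheme n P G q \<longleftrightarrow>
     partition_on {(j, k). j < k \<and> k < 2 * n} P \<and> card P = 2 * n - 1 \<and>
     (\<forall>B \<in> P. card B = n \<and>
        (\<forall>p \<in> B. \<forall>p' \<in> B. pair_observable n p * pair_observable n p' =
                             pair_observable n p' * pair_observable n p) \<and>
        gaussian_unitary n (G B) \<and> bij_betw q B {..<n} \<and>
        (\<forall>p \<in> B. mat_adjoint (G B) * on_qubit n (q p) pauli_Z * G B = pair_observable n p))"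

definition measure_basis :: "complex vec \<Rightarrow> nat pmf" where
  "measure_basis v = embed_pmf (\<lambda>x. if x < dim_vec v then (cmod (v $ x))\<^sup>2 else 0)"

definition Z_outcome :: "nat \<Rightarrow> nat \<Rightarrow> nat \<Rightarrow> real" where
  "Z_outcome n k x = (if even (x div 2 ^ (n - k - 1)) then 1 else - 1)"

text \<open>\<open>\<omega> (B, i)\<close> is the basis state observed on the \<open>i\<close>-th of the \<open>M\<close> copies used for the set \<open>B\<close>.\<close>

definition empirical_mean ::
  "nat \<Rightarrow> (nat \<times> nat) set set \<Rightarrow> (nat \<times> nat \<Rightarrow> nat) \<Rightarrow> nat \<Rightarrow>
   ((nat \<times> nat) set \<times> nat \<Rightarrow> nat) \<Rightarrow> nat \<times> nat \<Rightarrow> real" where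
  "empirical_mean n P q M \<omega> p =
     (\<Sum>i < M. Z_outcome n (q p) (\<omega> (THE B. B \<in> P \<and> p \<in> B, i))) / real M"

text \<open>
  This estimates the correlation matrix: for \<open>j \<noteq> k\<close> the Majorana operators anticommute, so entry
  \<open>(j, k)\<close> of the correlation matrix is the expectation of \<open>pair_observable n (j, k)\<close>.
\<close>

definition estimated_correlation ::
  "nat \<Rightarrow> (nat \<times> nat) set set \<Rightarrow> (nat \<times> nat \<Rightarrow> nat) \<Rightarrow> nat \<Rightarrow>
   ((nat \<times> nat) set \<times> nat \<Rightarrow> nat) \<Rightarrow> real mat" where
  "estimated_correlation n P q M \<omega> = mat (2 * n) (2 * n)
     (\<lambda>(j, k). if j < k then empirical_mean n P q M \<omega> (j, k)
               else if k < j then - empirical_mean n P q M \<omega> (k, j) else 0)"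

datatype verdict = Close | Far

text \<open>
  The testing algorithm on \<open>N\<close> independent copies of \<open>\<psi>\<close>, as a distribution over its outputs. Each of
  the \<open>2 * n - 1\<close> sets is measured on \<open>M\<close> copies; the fewer than \<open>2 * n - 1\<close> copies left over are
  discarded. Index \<open>t\<close> of the list is the normal eigenvalue number \<open>t + 1\<close>.
\<close>

definition compressibility_test ::
  "nat \<Rightarrow> nat \<Rightarrow> (nat \<times> nat) set set \<Rightarrow> ((nat \<times> nat) set \<Rightarrow> complex mat) \<Rightarrow> (nat \<times> nat \<Rightarrow> nat) \<Rightarrow>
   real \<Rightarrow> real \<Rightarrow> nat \<Rightarrow> complex vec \<Rightarrow> verdict pmf" where
  "compressibility_test n t P G q \<epsilon>\<^sub>A \<epsilon>\<^sub>B N \<psi> =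
     (let M = N div (2 * n - 1);
          \<epsilon>_test = \<epsilon>\<^sub>B\<^sup>2 / real (n - t) + \<epsilon>\<^sub>A
      in map_pmf
           (\<lambda>\<omega>. if normal_eigenvalues (estimated_correlation n P q M \<omega>) ! t \<ge> 1 - \<epsilon>_test
                 then Close else Far)
           (Pi_pmf (P \<times> {..<M}) 0 (\<lambda>(B, i). measure_basis (G B *\<^sub>v \<psi>))))"

end

theory Submission
  imports Defs
begin

text \<open>
  The normal eigenvalues of the correlation matrix \<open>C(\<psi>)\<close> measure how compressible \<open>\<psi>\<close> is. If \<open>\<psi>\<close> is close
  to a compressible state \<open>\<phi>\<close>, then \<open>C(\<phi>)\<close> is isometric on a space of dimension \<open>2 * (n - t)\<close> and the
  operator norm of \<open>C(\<psi>) - C(\<phi>)\<close> is at most twice the trace distance; a dimension count bounds the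
  normal eigenvalue number \<open>t + 1\<close> from below. Conversely, a Gaussian unitary brings \<open>C(\<psi>)\<close> to normal
  form, and projecting the last \<open>n - t\<close> qubits of the rotated state onto zero yields, by a union bound, a
  compressible state whose squared distance is at most the sum of \<open>(1 - \<lambda>) / 2\<close> over the largest
  \<open>n - t\<close> normal eigenvalues \<open>\<lambda>\<close>. Hoeffding's inequality makes every entry of the estimate accurate to
  \<open>\<epsilon>_corr / (2 * n)\<close>, hence its normal eigenvalues to \<open>\<epsilon>_corr\<close>.
\<close>

subsection \<open>Operators on qubits\<close>

text \<open>The error budget fixes every constant. With r =
  \<open>\<epsilon>\<^sub>B\<^sup>2 / real (n - t)\<close>, normal eigenvalues accurate to e leave a
  close state at or above 1 - 2 \<open>\<epsilon>\<^sub>A\<close> - e and a far state below 1 - 2 r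
  + e. Both bounds meet the threshold 1 - (r + \<open>\<epsilon>\<^sub>A\<close>) exactly at e = r -
  \<open>\<epsilon>\<^sub>A\<close>, which is \<open>\<epsilon>_corr\<close>. The division by
  \<open>2 * n\<close> in the entrywise accuracy pays for passing from entries to the operator norm.

  Two existence questions shape the rest. Every orthogonal matrix has to come from a unitary, which
  is built reflection by reflection from Clifford elements. And measurement schemes have to exist:
  the pairs of Majorana indices are scheduled like a round-robin tournament, and each round is a
  relabelling of indices, again an orthogonal matrix.

  Two definitions need resolving. The normal eigenvalues are a definite description, so uniqueness
  of the factorization must be shown; the distance is an infimum, for which near-minimizers
  suffice.\<close>

lemma mat_adjoint_dim [simp]: "dim_row (mat_adjoint A) = dim_col A" "dim_col (mat_adjoint A) = dim_row A"
  by (simp_all add: mat_adjoint_def)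

lemma mat_adjoint_carrier [simp]: "A \<in> carrier_mat r c \<Longrightarrow> mat_adjoint A \<in> carrier_mat c r"
  by (intro carrier_matI) auto

lemma mat_adjoint_index [simp]:
  fixes A :: "complex mat"
  shows "i < dim_col A \<Longrightarrow> j < dim_row A \<Longrightarrow> mat_adjoint A $$ (i, j) = cnj (A $$ (j, i))"
  by (simp add: mat_adjoint_def mat_of_rows_index)

lemma mat_adjoint_mult:
  fixes A B :: "complex mat"
  assumes "A \<in> carrier_mat a b" "B \<in> carrier_mat b c"
  shows "mat_adjoint (A * B) = mat_adjoint B * mat_adjoint A"
  by (rule eq_matI) (use assms in \<open>auto simp: scalar_prod_def mult.commute\<close>)

lemma cscalar_prod_mult_mat_vec:
  fixes A :: "complex mat"
  assumes "A \<in> carrier_mat r c" "v \<in> carrier_vec c" "w \<in> carrier_vec r"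
  shows "(A *\<^sub>v v) \<bullet>c w = v \<bullet>c (mat_adjoint A *\<^sub>v w)"
  using assms
  by (auto simp: scalar_prod_def sum_distrib_left sum_distrib_right mult.assoc mult.left_commute
      intro: sum.swap)

text \<open>An index of a tensor product is a pair of indices, recovered by \<open>div\<close> and
  \<open>mod\<close>. This reindexing is behind both the mixed-product rule and the sums over padded
  basis states.\<close>

lemma sum_div_mod:
  fixes f :: "nat \<Rightarrow> nat \<Rightarrow> 'a::comm_monoid_add"
  shows "(\<Sum>k<a * b. f (k div b) (k mod b)) = (\<Sum>x<a. \<Sum>y<b. f x y)"
proof -
  have "(\<Sum>k<a * b. f (k div b) (k mod b)) = (\<Sum>x<a. \<Sum>k = x * b..<x * b + b. f (k div b) (k mod b))"
    by (rule sum.nat_group[symmetric])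
  also have "\<dots> = (\<Sum>x<a. \<Sum>y<b. f x y)"
  proof (rule sum.cong[OF refl])
    fix x
    have "(\<Sum>k = x * b..<x * b + b. f (k div b) (k mod b)) = (\<Sum>y = 0..<b. f ((y + x * b) div b) ((y + x * b) mod b))"
      using sum.shift_bounds_nat_ivl[of "\<lambda>k. f (k div b) (k mod b)" 0 "x * b" b] by (simp add: add.commute)
    also have "\<dots> = (\<Sum>y<b. f x y)"
      by (rule sum.cong) auto
    finally show "(\<Sum>k = x * b..<x * b + b. f (k div b) (k mod b)) = (\<Sum>y<b. f x y)" .
  qed
  finally show ?thesis .
qed

lemma kron_mat_carrier [simp]:
  "A \<in> carrier_mat a b \<Longrightarrow> B \<in> carrier_mat c d \<Longrightarrow> kron_mat A B \<in> carrier_mat (a * c) (b * d)"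
  by (intro carrier_matI) (auto simp: kron_mat_def)

lemma kron_mat_dim [simp]:
  "dim_row (kron_mat A B) = dim_row A * dim_row B" "dim_col (kron_mat A B) = dim_col A * dim_col B"
  by (simp_all add: kron_mat_def)

lemma kron_mat_mult:
  assumes "A \<in> carrier_mat a b" "C \<in> carrier_mat b c" "B \<in> carrier_mat p q" "D \<in> carrier_mat q r"
  shows "kron_mat A B * kron_mat C D = kron_mat (A * C) (B * D)"
proof (rule eq_matI)
  fix i j assume "i < dim_row (kron_mat (A * C) (B * D))" "j < dim_col (kron_mat (A * C) (B * D))"
  with assms have i: "i < a * p" and j: "j < c * r" by auto
  then have pos: "0 < p" "0 < r" by (auto intro: gr0I)
  have ij: "i div p < a" "i mod p < p" "j div r < c" "j mod r < r"
    using i j pos by (auto simp: less_mult_imp_div_less)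
  have bq: "k div q < b" "k mod q < q" if "k < b * q" for k
    using that by (cases "q = 0", auto simp: less_mult_imp_div_less)+
  have "(kron_mat A B * kron_mat C D) $$ (i, j) =
      (\<Sum>k<b * q. (A $$ (i div p, k div q) * C $$ (k div q, j div r)) * (B $$ (i mod p, k mod q) * D $$ (k mod q, j mod r)))"
    using assms i j by (auto simp: scalar_prod_def kron_mat_def lessThan_atLeast0 intro!: sum.cong)
  also have "\<dots> = (\<Sum>x<b. \<Sum>y<q. (A $$ (i div p, x) * C $$ (x, j div r)) * (B $$ (i mod p, y) * D $$ (y, j mod r)))"
    by (rule sum_div_mod)
  also have "\<dots> = (\<Sum>x<b. A $$ (i div p, x) * C $$ (x, j div r)) * (\<Sum>y<q. B $$ (i mod p, y) * D $$ (y, j mod r))"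
    by (simp add: sum_product)
  also have "\<dots> = kron_mat (A * C) (B * D) $$ (i, j)"
    using assms i j ij by (auto simp: scalar_prod_def kron_mat_def lessThan_atLeast0)
  finally show "(kron_mat A B * kron_mat C D) $$ (i, j) = kron_mat (A * C) (B * D) $$ (i, j)" .
qed (use assms in auto)

lemma kron_mat_assoc: "kron_mat (kron_mat A B) C = kron_mat A (kron_mat B C)"
proof (rule eq_matI)
  fix i j assume ij: "i < dim_row (kron_mat A (kron_mat B C))" "j < dim_col (kron_mat A (kron_mat B C))"
  have 1: "x div c < a * b" "x div (b * c) < a" "x mod (b * c) < b * c"
    if "x < a * (b * c)" for x a b c :: nat
    using that by (auto intro!: less_mult_imp_div_less simp: mult.assoc) (metis mod_less_divisor mult_0_right neq0_conv not_less_zero)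
  have 2: "x mod (b * c) div c = x div c mod b" "x mod (b * c) mod c = x mod c" "x div c div b = x div (b * c)"
    for x b c :: nat
    by (cases "c = 0"; simp add: mod_mult2_eq div_mult2_eq[symmetric] mult.commute[of b c])+
  show "kron_mat (kron_mat A B) C $$ (i, j) = kron_mat A (kron_mat B C) $$ (i, j)"
    using ij 1[of i "dim_row A" "dim_row B" "dim_row C"] 1[of j "dim_col A" "dim_col B" "dim_col C"]
    by (simp add: kron_mat_def 2 mult.assoc)
qed (auto simp: mult.assoc)

lemma kron_mat_one: "kron_mat (1\<^sub>m a) (1\<^sub>m b) = 1\<^sub>m (a * b)"
proof (rule eq_matI)
  fix i j assume ij: "i < dim_row (1\<^sub>m (a * b) :: complex mat)" "j < dim_col (1\<^sub>m (a * b) :: complex mat)"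
  have "i div b < a" "j div b < a" "i mod b < b" "j mod b < b"
    using ij by (auto simp: less_mult_imp_div_less) (metis mod_less_divisor mult_0_right neq0_conv not_less_zero)+
  moreover have "i = j" if "i div b = j div b" "i mod b = j mod b"
    using that by (metis div_mult_mod_eq)
  ultimately show "kron_mat (1\<^sub>m a) (1\<^sub>m b) $$ (i, j) = (1\<^sub>m (a * b) :: complex mat) $$ (i, j)"
    using ij by (auto simp: kron_mat_def)
qed auto

lemma kron_mat_adjoint: "mat_adjoint (kron_mat A B) = kron_mat (mat_adjoint A) (mat_adjoint B)"
proof (rule eq_matI)
  fix i j assume "i < dim_row (kron_mat (mat_adjoint A) (mat_adjoint B))" "j < dim_col (kron_mat (mat_adjoint A) (mat_adjoint B))"
  then have ij: "i < dim_col A * dim_col B" "j < dim_row A * dim_row B" by auto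
  then have "i div dim_col B < dim_col A" "j div dim_row B < dim_row A" "i mod dim_col B < dim_col B" "j mod dim_row B < dim_row B"
    by (auto simp: less_mult_imp_div_less) (metis mod_less_divisor mult_0_right neq0_conv not_less_zero)+
  with ij show "mat_adjoint (kron_mat A B) $$ (i, j) = kron_mat (mat_adjoint A) (mat_adjoint B) $$ (i, j)"
    by (simp add: kron_mat_def)
qed auto

lemma mat_adjoint_one [simp]: "mat_adjoint (1\<^sub>m d :: complex mat) = 1\<^sub>m d"
  by (rule eq_matI) auto

text \<open>The dimensions of the three tensor factors of \<open>on_qubit\<close> multiply to
  \<open>2 ^ n\<close> only for \<open>k < n\<close>, because of the truncated subtraction in
  \<open>n - k - 1\<close>.\<close>

lemma two_power_split:
  assumes "k < (n::nat)"
  shows "(2::nat) ^ k * 2 * 2 ^ (n - k - 1) = 2 ^ n" "(2::nat) * 2 ^ (n - k - 1) = 2 ^ (n - k)"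
proof -
  have "Suc (n - k - 1) = n - k" "Suc k + (n - k - 1) = n"
    using assms by auto
  then show "(2::nat) ^ k * 2 * 2 ^ (n - k - 1) = 2 ^ n" "(2::nat) * 2 ^ (n - k - 1) = 2 ^ (n - k)"
    by (metis power_Suc2 power_add) (metis power_Suc \<open>Suc (n - k - 1) = n - k\<close>)
qed

lemma on_qubit_carrier [simp]:
  assumes "k < n" "A \<in> carrier_mat 2 2"
  shows "on_qubit n k A \<in> carrier_mat (2 ^ n) (2 ^ n)"
  unfolding on_qubit_def two_power_split(1)[OF assms(1), symmetric]
  by (intro kron_mat_carrier one_carrier_mat assms(2))

lemma on_qubit_mult:
  assumes "A \<in> carrier_mat 2 2" "B \<in> carrier_mat 2 2"
  shows "on_qubit n k A * on_qubit n k B = on_qubit n k (A * B)"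
  unfolding on_qubit_def
  by (subst kron_mat_mult[OF kron_mat_carrier kron_mat_carrier one_carrier_mat one_carrier_mat]
      , (rule one_carrier_mat assms)+, subst kron_mat_mult[OF one_carrier_mat one_carrier_mat assms], simp)

lemma on_qubit_adjoint: "mat_adjoint (on_qubit n k A) = on_qubit n k (mat_adjoint A)"
  by (simp add: on_qubit_def kron_mat_adjoint)

lemma on_qubit_one: "k < n \<Longrightarrow> on_qubit n k (1\<^sub>m 2) = 1\<^sub>m (2 ^ n)"
  by (simp only: on_qubit_def kron_mat_one two_power_split(1))

lemma on_qubit_uminus:
  assumes "k < n" "A \<in> carrier_mat 2 2"
  shows "on_qubit n k (- A) = - on_qubit n k A"
proof (rule eq_matI)
  fix i j assume "i < dim_row (- on_qubit n k A)" "j < dim_col (- on_qubit n k A)"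
  moreover have "i div 2 ^ (n - k - 1) mod 2 < 2" "j div 2 ^ (n - k - 1) mod 2 < 2" by auto
  moreover have "(x::nat) div 2 ^ (n - k - 1) < 2 ^ k * 2" if "x < 2 ^ k * 2 * 2 ^ (n - k - 1)" for x
    using that by (rule less_mult_imp_div_less)
  ultimately show "on_qubit n k (- A) $$ (i, j) = (- on_qubit n k A) $$ (i, j)"
    using assms by (simp add: on_qubit_def kron_mat_def less_mult_imp_div_less)
qed (use assms in \<open>auto simp: on_qubit_def\<close>)

text \<open>Cutting the register just before qubit \<open>k\<close> puts the two operators on
  different tensor factors, so both products collapse to the same Kronecker product.\<close>

lemma on_qubit_commute_less:
  assumes "j < k" "k < n" "A \<in> carrier_mat 2 2" "B \<in> carrier_mat 2 2"
  shows "on_qubit n j A * on_qubit n k B = on_qubit n k B * on_qubit n j A"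
proof -
  have "(2::nat) ^ (n - j - 1) = 2 ^ (k - j - 1) * 2 ^ (n - k)"
    using assms by (simp flip: power_add)
  then have "on_qubit n j A = kron_mat (on_qubit k j A) (1\<^sub>m (2 ^ (n - k)))"
    by (simp add: on_qubit_def kron_mat_assoc flip: kron_mat_one)
  moreover define B' where "B' = kron_mat B (1\<^sub>m (2 ^ (n - k - 1)))"
  have "on_qubit n k B = kron_mat (1\<^sub>m (2 ^ k)) B'"
    by (simp add: on_qubit_def kron_mat_assoc B'_def)
  moreover have B': "B' \<in> carrier_mat (2 ^ (n - k)) (2 ^ (n - k))"
    unfolding B'_def two_power_split(2)[OF assms(2), symmetric]
    by (intro kron_mat_carrier one_carrier_mat assms(4))
  moreover have A': "on_qubit k j A \<in> carrier_mat (2 ^ k) (2 ^ k)"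
    using assms by simp
  ultimately show ?thesis
    using kron_mat_mult[OF A' one_carrier_mat one_carrier_mat B']
      kron_mat_mult[OF one_carrier_mat A' B' one_carrier_mat] by (simp only: left_mult_one_mat[OF A'] right_mult_one_mat[OF A'] left_mult_one_mat[OF B'] right_mult_one_mat[OF B'])
qed

lemma on_qubit_commute:
  assumes "j \<noteq> k" "j < n" "k < n" "A \<in> carrier_mat 2 2" "B \<in> carrier_mat 2 2"
  shows "on_qubit n j A * on_qubit n k B = on_qubit n k B * on_qubit n j A"
  using assms on_qubit_commute_less by (metis linorder_neqE_nat)

lemma pauli_carrier [simp]:
  "pauli_X \<in> carrier_mat 2 2" "pauli_Y \<in> carrier_mat 2 2" "pauli_Z \<in> carrier_mat 2 2"
  by (intro carrier_matI; simp add: pauli_X_def pauli_Y_def pauli_Z_def mat_of_rows_list_def)+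

lemma mat2_eqI:
  assumes "A \<in> carrier_mat 2 2" "B \<in> carrier_mat 2 2"
    "A $$ (0, 0) = B $$ (0, 0)" "A $$ (0, 1) = B $$ (0, 1)" "A $$ (1, 0) = B $$ (1, 0)" "A $$ (1, 1) = B $$ (1, 1)"
  shows "A = B"
  by (rule eq_matI) (use assms in \<open>auto simp: less_2_cases_iff\<close>)

lemma pauli_index [simp]:
  "pauli_X $$ (0, 0) = 0" "pauli_X $$ (0, Suc 0) = 1" "pauli_X $$ (Suc 0, 0) = 1" "pauli_X $$ (Suc 0, Suc 0) = 0"
  "pauli_Y $$ (0, 0) = 0" "pauli_Y $$ (0, Suc 0) = - \<i>" "pauli_Y $$ (Suc 0, 0) = \<i>" "pauli_Y $$ (Suc 0, Suc 0) = 0"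
  "pauli_Z $$ (0, 0) = 1" "pauli_Z $$ (0, Suc 0) = 0" "pauli_Z $$ (Suc 0, 0) = 0" "pauli_Z $$ (Suc 0, Suc 0) = - 1"
  by (simp_all add: pauli_X_def pauli_Y_def pauli_Z_def mat_of_rows_list_def)

lemma pauli_dim [simp]:
  "dim_row pauli_X = 2" "dim_row pauli_Y = 2" "dim_row pauli_Z = 2"
  "dim_col pauli_X = 2" "dim_col pauli_Y = 2" "dim_col pauli_Z = 2"
  by (simp_all add: pauli_X_def pauli_Y_def pauli_Z_def mat_of_rows_list_def)

lemma pauli_adjoint [simp]:
  "mat_adjoint pauli_X = pauli_X" "mat_adjoint pauli_Y = pauli_Y" "mat_adjoint pauli_Z = pauli_Z"
  by (rule mat2_eqI; simp)+

lemma sum_upto_two: "sum f {0..<2::nat} = f 0 + f (Suc 0)"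
  by (simp add: numeral_2_eq_2)

lemma pauli_mult:
  "pauli_X * pauli_X = 1\<^sub>m 2" "pauli_Y * pauli_Y = 1\<^sub>m 2" "pauli_Z * pauli_Z = 1\<^sub>m 2"
  "pauli_X * pauli_Y = \<i> \<cdot>\<^sub>m pauli_Z" "pauli_Y * pauli_X = - (\<i> \<cdot>\<^sub>m pauli_Z)"
  "pauli_Z * pauli_X = - (pauli_X * pauli_Z)" "pauli_Z * pauli_Y = - (pauli_Y * pauli_Z)"
  by ((rule mat2_eqI; (rule carrier_matI; simp)?), simp_all add: scalar_prod_def sum_upto_two)+

text \<open>Qubit \<open>k\<close> is bit \<open>n - k - 1\<close> of a basis index. This ties the
  operator to the sign that is read off a measured basis state.\<close>

lemma on_qubit_Z_index:
  assumes "k < n" "x < 2 ^ n" "y < 2 ^ n"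
  shows "on_qubit n k pauli_Z $$ (x, y) = (if x = y then complex_of_real (Z_outcome n k x) else 0)"
proof -
  let ?m = "n - k - 1"
  have *: "(2::nat) ^ k * 2 * 2 ^ ?m = 2 ^ n"
    by (rule two_power_split(1)[OF assms(1)])
  have lt: "z div 2 ^ ?m div 2 < 2 ^ k" "z div 2 ^ ?m < 2 ^ k * 2" if "z < 2 ^ n" for z :: nat
    using that *  by (metis less_mult_imp_div_less)+
  have inj: "x = y" if "x div 2 ^ ?m div 2 = y div 2 ^ ?m div 2" "x div 2 ^ ?m mod 2 = y div 2 ^ ?m mod 2" "x mod 2 ^ ?m = y mod 2 ^ ?m"
    using that by (metis div_mult_mod_eq)
  have "z div 2 ^ ?m mod 2 < 2" for z :: nat by simp
  then have Z: "pauli_Z $$ (x div 2 ^ ?m mod 2, y div 2 ^ ?m mod 2) =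
      (if x div 2 ^ ?m mod 2 = y div 2 ^ ?m mod 2 then complex_of_real (Z_outcome n k x) else 0)"
    unfolding Z_outcome_def even_iff_mod_2_eq_zero
    by (cases "x div 2 ^ ?m mod 2 = 0"; cases "y div 2 ^ ?m mod 2 = 0") (simp_all add: not_mod_2_eq_0_eq_1)
  have "on_qubit n k pauli_Z $$ (x, y) =
     (if x div 2 ^ ?m div 2 = y div 2 ^ ?m div 2 \<and> x mod 2 ^ ?m = y mod 2 ^ ?m
      then pauli_Z $$ (x div 2 ^ ?m mod 2, y div 2 ^ ?m mod 2) else 0)"
    using assms lt[of x] lt[of y] *
    by (simp add: on_qubit_def kron_mat_def)
  with Z inj show ?thesis by auto
qed

subsection \<open>Majorana operators\<close>

text \<open>The Jordan-Wigner string. Splitting it off leaves a single-site Pauli in each Majorana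
  operator, so commutation relations reduce to counting shared sites; for \<open>k = n\<close> it is
  the total parity.\<close>

definition parity_string :: "nat \<Rightarrow> nat \<Rightarrow> complex mat" where
  "parity_string n k = foldr (\<lambda>j A. on_qubit n j pauli_Z * A) [0..<k] (1\<^sub>m (2 ^ n))"

text \<open>Associativity moves the start value of the fold out to the right. Both conjuncts go
  through one induction because reassociating needs the carrier of the partial product.\<close>

lemma foldr_on_qubit_Z:
  assumes "set js \<subseteq> {..<n}" "B \<in> carrier_mat (2 ^ n) (2 ^ n)"
  shows "foldr (\<lambda>j A. on_qubit n j pauli_Z * A) js (1\<^sub>m (2 ^ n)) \<in> carrier_mat (2 ^ n) (2 ^ n) \<and>
    foldr (\<lambda>j A. on_qubit n j pauli_Z * A) js B =
      foldr (\<lambda>j A. on_qubit n j pauli_Z * A) js (1\<^sub>m (2 ^ n)) * B"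
  using assms(1)
proof (induction js)
  case (Cons j js)
  then have "on_qubit n j pauli_Z \<in> carrier_mat (2 ^ n) (2 ^ n)" by simp
  moreover from this Cons have "foldr (\<lambda>j A. on_qubit n j pauli_Z * A) js (1\<^sub>m (2 ^ n)) \<in> carrier_mat (2 ^ n) (2 ^ n)" by simp
  ultimately show ?case
    using Cons assms(2) by (simp add: mult_carrier_mat[of _ "2 ^ n" "2 ^ n"] assoc_mult_mat[of _ "2 ^ n" "2 ^ n" _ "2 ^ n" _ "2 ^ n"])
qed (use assms(2) in simp)

lemma upt_subset: "k \<le> n \<Longrightarrow> set [0..<k] \<subseteq> {..<n::nat}"
  by auto

lemma parity_string_carrier [simp]: "k \<le> n \<Longrightarrow> parity_string n k \<in> carrier_mat (2 ^ n) (2 ^ n)"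
  using foldr_on_qubit_Z[OF upt_subset one_carrier_mat] by (simp add: parity_string_def)

lemma parity_string_0 [simp]: "parity_string n 0 = 1\<^sub>m (2 ^ n)"
  by (simp add: parity_string_def)

lemma parity_string_Suc:
  assumes "k < n"
  shows "parity_string n (Suc k) = parity_string n k * on_qubit n k pauli_Z"
  using foldr_on_qubit_Z[OF upt_subset[of k n], of "on_qubit n k pauli_Z"] assms
  by (simp add: parity_string_def right_mult_one_mat[of _ "2 ^ n" "2 ^ n"])

definition majorana_site :: "nat \<Rightarrow> complex mat" where
  "majorana_site \<mu> = (if even \<mu> then pauli_X else pauli_Y)"

lemma majorana_site_carrier [simp]: "majorana_site \<mu> \<in> carrier_mat 2 2"
  by (simp add: majorana_site_def)

lemma majorana_eq:
  assumes "\<mu> < 2 * n"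
  shows "majorana n \<mu> = parity_string n (\<mu> div 2) * on_qubit n (\<mu> div 2) (majorana_site \<mu>)"
  using foldr_on_qubit_Z[OF upt_subset[of "\<mu> div 2" n], of "on_qubit n (\<mu> div 2) (majorana_site \<mu>)"] assms
  by (simp add: majorana_def parity_string_def majorana_site_def Let_def)

lemma majorana_carrier [simp]:
  assumes "\<mu> < 2 * n"
  shows "majorana n \<mu> \<in> carrier_mat (2 ^ n) (2 ^ n)"
  unfolding majorana_eq[OF assms]
  by (rule mult_carrier_mat[of _ _ "2 ^ n"]) (use assms in auto)

text \<open>The string reaches only qubits below \<open>k\<close>, so it shares no site with qubit
  \<open>l\<close>, not even for \<open>l = k\<close>.\<close>

lemma parity_string_commute:
  assumes "k \<le> l" "l < n" "A \<in> carrier_mat 2 2"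
  shows "parity_string n k * on_qubit n l A = on_qubit n l A * parity_string n k"
  using assms(1)
proof (induction k)
  case (Suc k)
  let ?d = "2 ^ n :: nat"
  note [simp] = assoc_mult_mat[of _ ?d ?d _ ?d _ ?d]
  have c: "parity_string n k \<in> carrier_mat ?d ?d" "on_qubit n k pauli_Z \<in> carrier_mat ?d ?d" "on_qubit n l A \<in> carrier_mat ?d ?d"
    using Suc.prems assms by auto
  have "parity_string n k * on_qubit n k pauli_Z * on_qubit n l A =
      parity_string n k * (on_qubit n l A * on_qubit n k pauli_Z)"
    using on_qubit_commute[of k l n pauli_Z A] Suc.prems assms c by simp
  also have "\<dots> = (parity_string n k * on_qubit n l A) * on_qubit n k pauli_Z"
    using c by simp
  also have "\<dots> = on_qubit n l A * (parity_string n k * on_qubit n k pauli_Z)"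
    using c Suc by simp
  finally show ?case
    using Suc.prems assms by (simp add: parity_string_Suc)
qed (use assms in \<open>simp add: left_mult_one_mat[of _ "2 ^ n" "2 ^ n"] right_mult_one_mat[of _ "2 ^ n" "2 ^ n"]\<close>)

text \<open>Exactly one factor of the string sits on qubit \<open>j\<close>, and it alone
  contributes a sign; in the induction this is the case \<open>j = k\<close>.\<close>

lemma parity_string_anticommute:
  assumes "j < k" "k \<le> n" "A \<in> carrier_mat 2 2" "pauli_Z * A = - (A * pauli_Z)"
  shows "parity_string n k * on_qubit n j A = - (on_qubit n j A * parity_string n k)"
  using assms(1,2)
proof (induction k)
  case (Suc k)
  let ?d = "2 ^ n :: nat"
  note [simp] = assoc_mult_mat[of _ ?d ?d _ ?d _ ?d]
  have c: "parity_string n k \<in> carrier_mat ?d ?d" "on_qubit n k pauli_Z \<in> carrier_mat ?d ?d" "on_qubit n j A \<in> carrier_mat ?d ?d"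
    using Suc.prems assms by auto
  note d = c[THEN carrier_matD(1)] c[THEN carrier_matD(2)]
  have "parity_string n k * (on_qubit n k pauli_Z * on_qubit n j A) =
      - (on_qubit n j A * (parity_string n k * on_qubit n k pauli_Z))"
  proof (cases "j = k")
    case True
    have "on_qubit n k pauli_Z * on_qubit n j A = - (on_qubit n j A * on_qubit n k pauli_Z)"
      using Suc.prems assms True
      by (simp add: on_qubit_mult on_qubit_uminus[symmetric] mult_carrier_mat[of _ 2 2])
    then have "parity_string n k * (on_qubit n k pauli_Z * on_qubit n j A) =
        - (parity_string n k * on_qubit n j A * on_qubit n k pauli_Z)"
      using c d by simp
    also have "parity_string n k * on_qubit n j A = on_qubit n j A * parity_string n k"
      using parity_string_commute[of k j n A] Suc.prems assms True by simp
    finally show ?thesis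
      using c by simp
  next
    case False
    then have "j < k" using Suc.prems by simp
    have "parity_string n k * (on_qubit n k pauli_Z * on_qubit n j A) =
        (parity_string n k * on_qubit n j A) * on_qubit n k pauli_Z"
      using on_qubit_commute[of k j n pauli_Z A] Suc.prems assms c False by simp
    also have "\<dots> = - (on_qubit n j A * parity_string n k) * on_qubit n k pauli_Z"
      using Suc \<open>j < k\<close> by simp
    finally show ?thesis
      using c d by simp
  qed
  then show ?case
    using Suc.prems assms c by (simp add: parity_string_Suc)
qed simp

lemma parity_string_square:
  "k \<le> n \<Longrightarrow> parity_string n k * parity_string n k = 1\<^sub>m (2 ^ n)"
proof (induction k)
  case (Suc k)
  let ?d = "2 ^ n :: nat"
  note [simp] = assoc_mult_mat[of _ ?d ?d _ ?d _ ?d]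
  let ?S = "parity_string n k" and ?Z = "on_qubit n k pauli_Z"
  have c: "?S \<in> carrier_mat ?d ?d" "?Z \<in> carrier_mat ?d ?d"
    using Suc.prems by auto
  have "?S * ?Z * (?S * ?Z) = ?S * (?Z * ?S) * ?Z"
    using c by simp
  also have "?Z * ?S = ?S * ?Z"
    using parity_string_commute[of k k n pauli_Z] Suc.prems by simp
  also have "?S * (?S * ?Z) * ?Z = (?S * ?S) * (?Z * ?Z)"
    using c by simp
  also have "\<dots> = 1\<^sub>m ?d"
    using Suc by (simp add: on_qubit_mult pauli_mult on_qubit_one)
  finally show ?case
    using Suc.prems by (simp add: parity_string_Suc)
qed simp

lemma parity_string_adjoint:
  "k \<le> n \<Longrightarrow> mat_adjoint (parity_string n k) = parity_string n k"
proof (induction k)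
  case (Suc k)
  then show ?case
    using parity_string_commute[of k k n pauli_Z]
    by (simp add: parity_string_Suc mat_adjoint_mult[of _ "2 ^ n" "2 ^ n" _ "2 ^ n"] on_qubit_adjoint)
qed simp

lemma parity_string_commute_Z:
  assumes "m \<le> n" "j < n"
  shows "parity_string n m * on_qubit n j pauli_Z = on_qubit n j pauli_Z * parity_string n m"
  using assms(1)
proof (induction m)
  case (Suc m)
  let ?d = "2 ^ n :: nat"
  note [simp] = assoc_mult_mat[of _ ?d ?d _ ?d _ ?d]
  let ?Z = "on_qubit n j pauli_Z"
  have c: "?Z \<in> carrier_mat ?d ?d" "parity_string n m \<in> carrier_mat ?d ?d" "on_qubit n m pauli_Z \<in> carrier_mat ?d ?d"
    using Suc.prems assms by auto
  have "on_qubit n m pauli_Z * ?Z = ?Z * on_qubit n m pauli_Z"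
    using on_qubit_commute[of m j n pauli_Z pauli_Z] Suc.prems assms by (cases "m = j") auto
  then have "parity_string n m * on_qubit n m pauli_Z * ?Z = parity_string n m * ?Z * on_qubit n m pauli_Z"
    using c by simp
  also have "\<dots> = ?Z * parity_string n m * on_qubit n m pauli_Z"
    using Suc by simp
  finally show ?case using c Suc.prems by (simp add: parity_string_Suc)
qed (use assms in \<open>simp add: left_mult_one_mat[of _ "2 ^ n" "2 ^ n"] right_mult_one_mat[of _ "2 ^ n" "2 ^ n"]\<close>)

lemma parity_strings_commute:
  assumes "l \<le> n" "k \<le> n"
  shows "parity_string n l * parity_string n k = parity_string n k * parity_string n l"
  using assms(2)
proof (induction k)
  case (Suc k)
  let ?d = "2 ^ n :: nat"
  note assoc = assoc_mult_mat[of _ ?d ?d _ ?d _ ?d]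
  let ?V = "parity_string n l" and ?S = "parity_string n k" and ?Z = "on_qubit n k pauli_Z"
  have c: "?V \<in> carrier_mat ?d ?d" "?S \<in> carrier_mat ?d ?d" "?Z \<in> carrier_mat ?d ?d"
    using Suc.prems assms by auto
  have "?V * (?S * ?Z) = ?V * ?S * ?Z"
    using c by (simp add: assoc)
  also have "\<dots> = ?S * (?V * ?Z)"
    using Suc c by (simp add: assoc)
  also have "\<dots> = ?S * ?Z * ?V"
    using parity_string_commute_Z[of l n k] assms Suc.prems c by (simp add: assoc)
  finally show ?case using Suc.prems by (simp add: parity_string_Suc)
qed (use assms in \<open>simp add: left_mult_one_mat[of _ "2 ^ n" "2 ^ n"] right_mult_one_mat[of _ "2 ^ n" "2 ^ n"]\<close>)

lemma majorana_site_anticommute: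
  "pauli_Z * majorana_site \<mu> = - (majorana_site \<mu> * pauli_Z)"
  by (simp add: majorana_site_def pauli_mult)

lemma majorana_adjoint:
  assumes "\<mu> < 2 * n"
  shows "mat_adjoint (majorana n \<mu>) = majorana n \<mu>"
proof -
  have "mat_adjoint (majorana_site \<mu>) = majorana_site \<mu>" by (simp add: majorana_site_def)
  with assms show ?thesis
    using parity_string_commute[of "\<mu> div 2" "\<mu> div 2" n "majorana_site \<mu>"]
    by (simp add: majorana_eq mat_adjoint_mult[of _ "2 ^ n" "2 ^ n" _ "2 ^ n"] on_qubit_adjoint parity_string_adjoint)
qed

text \<open>On one qubit the strings cancel and the sign is that of X against Y. On different qubits
  the longer string meets the site of the shorter operator once, and every other pair of factors
  commutes.\<close>

lemma majorana_anticommute_less: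
  assumes "\<mu> < \<nu>" "\<nu> < 2 * n"
  shows "majorana n \<mu> * majorana n \<nu> = - (majorana n \<nu> * majorana n \<mu>)"
proof -
  let ?d = "2 ^ n :: nat"
  note [simp] = assoc_mult_mat[of _ ?d ?d _ ?d _ ?d]
  define k l where "k = \<mu> div 2" and "l = \<nu> div 2"
  let ?W = "parity_string n k" and ?V = "parity_string n l"
  let ?A = "on_qubit n k (majorana_site \<mu>)" and ?B = "on_qubit n l (majorana_site \<nu>)"
  have kl: "k \<le> l" "l < n" using assms by (auto simp: k_def l_def)
  then have c: "?W \<in> carrier_mat ?d ?d" "?V \<in> carrier_mat ?d ?d" "?A \<in> carrier_mat ?d ?d" "?B \<in> carrier_mat ?d ?d"
    by auto
  note d = c[THEN carrier_matD(1)] c[THEN carrier_matD(2)]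
  have WA: "?W * ?A = ?A * ?W" and WB: "?W * ?B = ?B * ?W"
    using kl by (auto intro!: parity_string_commute)
  have eq: "majorana n \<mu> = ?W * ?A" "majorana n \<nu> = ?V * ?B"
    using assms by (simp_all add: majorana_eq k_def l_def)
  show ?thesis
  proof (cases "k = l")
    case True
    then have div: "\<mu> div 2 = \<nu> div 2" by (simp add: k_def l_def)
    have "even \<mu> \<and> odd \<nu>" using div assms(1) by presburger
    then have AB: "?A * ?B = - (?B * ?A)"
      using True kl by (simp add: majorana_site_def on_qubit_mult pauli_mult on_qubit_uminus smult_carrier_mat)
    have "?W * ?A * (?V * ?B) = ?W * (?A * ?W) * ?B"
      using c True by simp
    also have "\<dots> = ?W * (?W * ?A) * ?B" by (simp add: WA)
    also have "\<dots> = ?W * ?W * (?A * ?B)" using c by simp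
    also have "\<dots> = - (?W * (?W * ?B) * ?A)" using AB c d by simp
    also have "\<dots> = - (?W * (?B * ?W) * ?A)" by (simp add: WB)
    also have "\<dots> = - (?V * ?B * (?W * ?A))" using c True by simp
    finally show ?thesis by (simp add: eq)
  next
    case False
    then have "k < l" using kl by simp
    have AB: "?A * ?B = ?B * ?A"
      using on_qubit_commute[of k l n] kl False by simp
    have AV: "?V * ?A = - (?A * ?V)"
      using \<open>k < l\<close> kl by (intro parity_string_anticommute majorana_site_anticommute) auto
    have VW: "?V * ?W = ?W * ?V"
      using kl by (intro parity_strings_commute) auto
    have "?V * ?B * (?W * ?A) = ?V * (?B * ?W) * ?A" using c by simp
    also have "\<dots> = ?V * (?W * ?B) * ?A" by (simp only: WB)
    also have "\<dots> = (?V * ?W) * (?B * ?A)" using c by simp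
    also have "\<dots> = (?W * ?V) * (?A * ?B)" by (simp only: VW AB)
    also have "\<dots> = ?W * (?V * ?A) * ?B" using c by simp
    also have "\<dots> = - (?W * ?A * (?V * ?B))" using c d AV by simp
    finally show ?thesis using c d by (simp add: eq)
  qed
qed

lemma majorana_square:
  assumes "\<mu> < 2 * n"
  shows "majorana n \<mu> * majorana n \<mu> = 1\<^sub>m (2 ^ n)"
proof -
  let ?d = "2 ^ n :: nat"
  note assoc = assoc_mult_mat[of _ ?d ?d _ ?d _ ?d]
  define k where "k = \<mu> div 2"
  let ?W = "parity_string n k" and ?A = "on_qubit n k (majorana_site \<mu>)"
  have k: "k < n" using assms by (auto simp: k_def)
  then have c: "?W \<in> carrier_mat ?d ?d" "?A \<in> carrier_mat ?d ?d" by auto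
  have "?W * ?A * (?W * ?A) = ?W * (?A * ?W) * ?A"
    using c by (simp add: assoc)
  also have "?A * ?W = ?W * ?A"
    using k by (intro parity_string_commute[symmetric]) auto
  also have "?W * (?W * ?A) * ?A = (?W * ?W) * (?A * ?A)"
    using c by (simp add: assoc)
  also have "?A * ?A = 1\<^sub>m ?d"
    using k by (simp add: majorana_site_def on_qubit_mult pauli_mult on_qubit_one)
  finally show ?thesis
    using assms k by (simp add: majorana_eq k_def parity_string_square)
qed

lemma majorana_anticommutator:
  assumes "\<mu> < 2 * n" "\<nu> < 2 * n" "i < 2 ^ n" "j < 2 ^ n"
  shows "(majorana n \<mu> * majorana n \<nu>) $$ (i, j) + (majorana n \<nu> * majorana n \<mu>) $$ (i, j) =
    (if \<mu> = \<nu> \<and> i = j then 2 else 0)"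
proof -
  have dim: "dim_row (majorana n \<rho>) = 2 ^ n" "dim_col (majorana n \<rho>) = 2 ^ n" if "\<rho> < 2 * n" for \<rho>
    using majorana_carrier[OF that] by auto
  consider "\<mu> = \<nu>" | "\<mu> < \<nu>" | "\<nu> < \<mu>" by linarith
  then show ?thesis
  proof cases
    case 1
    then show ?thesis using assms by (simp add: majorana_square)
  next
    case 2
    then show ?thesis using majorana_anticommute_less[OF 2] assms dim by simp
  next
    case 3
    then show ?thesis using majorana_anticommute_less[OF 3] assms dim by simp
  qed
qed

text \<open>The full string commutes with the shorter string inside the Majorana operator and meets
  its one X or Y exactly once.\<close>

lemma parity_anticommute_majorana:
  assumes "\<mu> < 2 * n"
  shows "parity_string n n * majorana n \<mu> = - (majorana n \<mu> * parity_string n n)"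
proof -
  let ?d = "2 ^ n :: nat"
  note assoc = assoc_mult_mat[of _ ?d ?d _ ?d _ ?d]
  define k where "k = \<mu> div 2"
  let ?V = "parity_string n n" and ?W = "parity_string n k" and ?A = "on_qubit n k (majorana_site \<mu>)"
  have k: "k < n" using assms by (auto simp: k_def)
  then have c: "?V \<in> carrier_mat ?d ?d" "?W \<in> carrier_mat ?d ?d" "?A \<in> carrier_mat ?d ?d" by auto
  note d = c[THEN carrier_matD(1)] c[THEN carrier_matD(2)]
  have "?V * (?W * ?A) = ?V * ?W * ?A" using c by (simp add: assoc)
  also have "?V * ?W = ?W * ?V" using parity_strings_commute[of n n k] k by simp
  also have "?W * ?V * ?A = ?W * (?V * ?A)" using c by (simp add: assoc)
  also have "?V * ?A = - (?A * ?V)"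
    using k by (intro parity_string_anticommute majorana_site_anticommute) auto
  finally show ?thesis
    using assms k c d by (simp add: majorana_eq k_def assoc)
qed

subsection \<open>Gaussian unitaries\<close>

text \<open>Shaped like the sum inside \<open>gaussian_unitary\<close>, so that unfolding identifies
  the two.\<close>

definition mat_lincomb :: "nat \<Rightarrow> 'i set \<Rightarrow> ('i \<Rightarrow> complex) \<Rightarrow> ('i \<Rightarrow> complex mat) \<Rightarrow> complex mat" where
  "mat_lincomb d I c A = mat d d (\<lambda>ij. \<Sum>i\<in>I. c i * A i $$ ij)"

lemma mat_lincomb_carrier [simp]: "mat_lincomb d I c A \<in> carrier_mat d d"
  by (simp add: mat_lincomb_def)

lemma mat_lincomb_dim [simp]: "dim_row (mat_lincomb d I c A) = d" "dim_col (mat_lincomb d I c A) = d"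
  by (simp_all add: mat_lincomb_def)

lemma mat_lincomb_index [simp]:
  "i < d \<Longrightarrow> j < d \<Longrightarrow> mat_lincomb d I c A $$ (i, j) = (\<Sum>k\<in>I. c k * A k $$ (i, j))"
  by (simp add: mat_lincomb_def)

lemma mat_lincomb_cong:
  "(\<And>i. i \<in> I \<Longrightarrow> c i = c' i) \<Longrightarrow> (\<And>i. i \<in> I \<Longrightarrow> A i = A' i) \<Longrightarrow> mat_lincomb d I c A = mat_lincomb d I c' A'"
  by (intro eq_matI) auto

lemma mult_mat_lincomb:
  assumes "B \<in> carrier_mat d d" "\<And>i. i \<in> I \<Longrightarrow> A i \<in> carrier_mat d d"
  shows "B * mat_lincomb d I c A = mat_lincomb d I c (\<lambda>i. B * A i)"
proof (rule eq_matI)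
  fix i j assume ij: "i < dim_row (mat_lincomb d I c (\<lambda>i. B * A i))" "j < dim_col (mat_lincomb d I c (\<lambda>i. B * A i))"
  have dim: "dim_row (A k) = d" "dim_col (A k) = d" if "k \<in> I" for k
    using assms(2)[OF that] by auto
  have "(B * mat_lincomb d I c A) $$ (i, j) = (\<Sum>l = 0..<d. \<Sum>k\<in>I. c k * (B $$ (i, l) * A k $$ (l, j)))"
    using assms ij by (simp add: scalar_prod_def sum_distrib_left mult.left_commute)
  also have "\<dots> = (\<Sum>k\<in>I. c k * (\<Sum>l = 0..<d. B $$ (i, l) * A k $$ (l, j)))"
    by (subst sum.swap) (simp add: sum_distrib_left)
  also have "\<dots> = mat_lincomb d I c (\<lambda>i. B * A i) $$ (i, j)"
    using assms(1) dim ij by (simp add: scalar_prod_def)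
  finally show "(B * mat_lincomb d I c A) $$ (i, j) = mat_lincomb d I c (\<lambda>i. B * A i) $$ (i, j)" .
qed (use assms in auto)

lemma mat_lincomb_mult:
  assumes "B \<in> carrier_mat d d" "\<And>i. i \<in> I \<Longrightarrow> A i \<in> carrier_mat d d"
  shows "mat_lincomb d I c A * B = mat_lincomb d I c (\<lambda>i. A i * B)"
proof (rule eq_matI)
  fix i j assume ij: "i < dim_row (mat_lincomb d I c (\<lambda>i. A i * B))" "j < dim_col (mat_lincomb d I c (\<lambda>i. A i * B))"
  have dim: "dim_row (A k) = d" "dim_col (A k) = d" if "k \<in> I" for k
    using assms(2)[OF that] by auto
  have "(mat_lincomb d I c A * B) $$ (i, j) = (\<Sum>l = 0..<d. \<Sum>k\<in>I. c k * (A k $$ (i, l) * B $$ (l, j)))"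
    using assms ij by (simp add: scalar_prod_def sum_distrib_right mult.assoc)
  also have "\<dots> = (\<Sum>k\<in>I. c k * (\<Sum>l = 0..<d. A k $$ (i, l) * B $$ (l, j)))"
    by (subst sum.swap) (simp add: sum_distrib_left)
  also have "\<dots> = mat_lincomb d I c (\<lambda>i. A i * B) $$ (i, j)"
    using assms(1) dim ij by (simp add: scalar_prod_def)
  finally show "(mat_lincomb d I c A * B) $$ (i, j) = mat_lincomb d I c (\<lambda>i. A i * B) $$ (i, j)" .
qed (use assms in auto)

text \<open>The embedding of real vectors of dimension \<open>2 * n\<close> into the Clifford
  algebra generated by the Majorana operators.\<close>

definition majorana_lin :: "nat \<Rightarrow> (nat \<Rightarrow> real) \<Rightarrow> complex mat" where
  "majorana_lin n x = mat_lincomb (2 ^ n) {..<2 * n} (\<lambda>\<nu>. complex_of_real (x \<nu>)) (majorana n)"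

lemma majorana_lin_carrier [simp]: "majorana_lin n x \<in> carrier_mat (2 ^ n) (2 ^ n)"
  by (simp add: majorana_lin_def)

lemma majorana_lin_dim [simp]: "dim_row (majorana_lin n x) = 2 ^ n" "dim_col (majorana_lin n x) = 2 ^ n"
  by (simp_all add: majorana_lin_def)

lemma majorana_dim [simp]:
  "\<mu> < 2 * n \<Longrightarrow> dim_row (majorana n \<mu>) = 2 ^ n" "\<mu> < 2 * n \<Longrightarrow> dim_col (majorana n \<mu>) = 2 ^ n"
  by (auto dest: majorana_carrier)

lemma majorana_lin_cong: "(\<And>\<nu>. \<nu> < 2 * n \<Longrightarrow> x \<nu> = y \<nu>) \<Longrightarrow> majorana_lin n x = majorana_lin n y"
  unfolding majorana_lin_def by (rule mat_lincomb_cong) auto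

lemma majorana_lin_delta:
  assumes "\<mu> < 2 * n"
  shows "majorana_lin n (\<lambda>\<nu>. if \<nu> = \<mu> then 1 else 0) = majorana n \<mu>"
  by (rule eq_matI) (use assms in \<open>auto simp: majorana_lin_def if_distrib[of complex_of_real] if_distrib[of "\<lambda>a. a * _"] cong: if_cong\<close>)

lemma majorana_lin_adjoint: "mat_adjoint (majorana_lin n x) = majorana_lin n x"
proof (rule eq_matI)
  fix i j assume ij: "i < dim_row (majorana_lin n x)" "j < dim_col (majorana_lin n x)"
  have "cnj (majorana n \<mu> $$ (j, i)) = majorana n \<mu> $$ (i, j)" if "\<mu> < 2 * n" for \<mu>
    using ij that mat_adjoint_index[of i "majorana n \<mu>" j] majorana_adjoint[OF that] by simp
  then show "mat_adjoint (majorana_lin n x) $$ (i, j) = majorana_lin n x $$ (i, j)"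
    using ij by (simp add: majorana_lin_def)
qed auto

lemma majorana_lin_mult:
  "majorana_lin n x * majorana_lin n y =
    mat_lincomb (2 ^ n) {..<2 * n} (\<lambda>\<mu>. complex_of_real (x \<mu>))
      (\<lambda>\<mu>. mat_lincomb (2 ^ n) {..<2 * n} (\<lambda>\<nu>. complex_of_real (y \<nu>)) (\<lambda>\<nu>. majorana n \<mu> * majorana n \<nu>))"
proof -
  have "majorana_lin n x * majorana_lin n y = mat_lincomb (2 ^ n) {..<2 * n} (\<lambda>\<mu>. complex_of_real (x \<mu>))
      (\<lambda>\<mu>. majorana n \<mu> * majorana_lin n y)"
    unfolding majorana_lin_def[of n x] by (rule mat_lincomb_mult) auto
  also have "\<dots> = mat_lincomb (2 ^ n) {..<2 * n} (\<lambda>\<mu>. complex_of_real (x \<mu>))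
      (\<lambda>\<mu>. mat_lincomb (2 ^ n) {..<2 * n} (\<lambda>\<nu>. complex_of_real (y \<nu>)) (\<lambda>\<nu>. majorana n \<mu> * majorana n \<nu>))"
    unfolding majorana_lin_def by (intro mat_lincomb_cong refl mult_mat_lincomb) auto
  finally show ?thesis .
qed

lemma majorana_lin_mult_index:
  assumes "i < 2 ^ n" "j < 2 ^ n"
  shows "(majorana_lin n x * majorana_lin n y) $$ (i, j) =
    (\<Sum>\<mu><2 * n. \<Sum>\<nu><2 * n. complex_of_real (x \<mu> * y \<nu>) * (majorana n \<mu> * majorana n \<nu>) $$ (i, j))"
  unfolding majorana_lin_mult using assms by (simp add: sum_distrib_left mult.assoc)

text \<open>The Clifford relation: symmetrizing the double sum leaves only its diagonal terms. In
  particular a unit vector gives an involution.\<close>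

lemma majorana_lin_anticommutator:
  assumes ij: "i < 2 ^ n" "j < 2 ^ n"
  shows "(majorana_lin n x * majorana_lin n y) $$ (i, j) + (majorana_lin n y * majorana_lin n x) $$ (i, j) =
    (if i = j then 2 * complex_of_real (\<Sum>\<mu><2 * n. x \<mu> * y \<mu>) else 0)"
proof -
  have "(majorana_lin n x * majorana_lin n y) $$ (i, j) + (majorana_lin n y * majorana_lin n x) $$ (i, j) =
    (\<Sum>\<mu><2 * n. \<Sum>\<nu><2 * n. complex_of_real (x \<mu> * y \<nu>) * (majorana n \<mu> * majorana n \<nu>) $$ (i, j)) +
    (\<Sum>\<mu><2 * n. \<Sum>\<nu><2 * n. complex_of_real (y \<nu> * x \<mu>) * (majorana n \<nu> * majorana n \<mu>) $$ (i, j))"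
    using ij by (simp only: majorana_lin_mult_index)
      (subst (2) sum.swap, rule refl)
  also have "\<dots> = (\<Sum>\<mu><2 * n. \<Sum>\<nu><2 * n. complex_of_real (x \<mu> * y \<nu>) *
      ((majorana n \<mu> * majorana n \<nu>) $$ (i, j) + (majorana n \<nu> * majorana n \<mu>) $$ (i, j)))"
    by (simp add: sum.distrib distrib_left mult.commute)
  also have "\<dots> = (\<Sum>\<mu><2 * n. \<Sum>\<nu><2 * n. complex_of_real (x \<mu> * y \<nu>) * (if \<mu> = \<nu> \<and> i = j then 2 else 0))"
    by (intro sum.cong refl) (simp only: lessThan_iff majorana_anticommutator[OF _ _ ij])
  also have "\<dots> = (if i = j then 2 * complex_of_real (\<Sum>\<mu><2 * n. x \<mu> * y \<mu>) else 0)"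
    by (auto simp: if_distrib[of "\<lambda>a. _ * a"] sum_distrib_left mult.commute cong: if_cong)
  finally show ?thesis .
qed

lemma majorana_lin_square:
  "majorana_lin n x * majorana_lin n x = complex_of_real (\<Sum>\<mu><2 * n. (x \<mu>)\<^sup>2) \<cdot>\<^sub>m 1\<^sub>m (2 ^ n)"
proof (rule eq_matI)
  fix i j
  assume "i < dim_row (complex_of_real (\<Sum>\<mu><2 * n. (x \<mu>)\<^sup>2) \<cdot>\<^sub>m 1\<^sub>m (2 ^ n))"
    "j < dim_col (complex_of_real (\<Sum>\<mu><2 * n. (x \<mu>)\<^sup>2) \<cdot>\<^sub>m 1\<^sub>m (2 ^ n))"
  then show "(majorana_lin n x * majorana_lin n x) $$ (i, j) =
      (complex_of_real (\<Sum>\<mu><2 * n. (x \<mu>)\<^sup>2) \<cdot>\<^sub>m 1\<^sub>m (2 ^ n)) $$ (i, j)"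
    using majorana_lin_anticommutator[of i n j x x]
    by (auto simp: power2_eq_square simp flip: mult_2 split: if_splits)
qed auto

section \<open>Composition, inversion and generation of Gaussian unitaries\<close>

lemma unitary_mat_mult:
  assumes "unitary_mat d A" "unitary_mat d B"
  shows "unitary_mat d (A * B)"
proof -
  note assoc = assoc_mult_mat[of _ d d _ d _ d]
  have c: "A \<in> carrier_mat d d" "B \<in> carrier_mat d d" "mat_adjoint A \<in> carrier_mat d d" "mat_adjoint B \<in> carrier_mat d d"
    using assms by (auto simp: unitary_mat_def)
  have "mat_adjoint B * mat_adjoint A * (A * B) = mat_adjoint B * (mat_adjoint A * A) * B"
    "A * B * (mat_adjoint B * mat_adjoint A) = A * (B * mat_adjoint B) * mat_adjoint A"
    using c by (simp_all add: assoc mult_carrier_mat[of _ d d])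
  then show ?thesis
    using assms c by (simp add: unitary_mat_def mat_adjoint_mult[OF c(1,2)] mult_carrier_mat[of _ d d])
qed

lemma mat_adjoint_adjoint [simp]: "mat_adjoint (mat_adjoint A) = (A :: complex mat)"
  by (rule eq_matI) auto

lemma unitary_mat_adjoint: "unitary_mat d A \<Longrightarrow> unitary_mat d (mat_adjoint A)"
  by (auto simp: unitary_mat_def)

text \<open>Refines \<open>gaussian_unitary\<close> by naming the matrix, so that the matrices can
  be tracked through products and adjoints.\<close>

definition implements :: "nat \<Rightarrow> complex mat \<Rightarrow> real mat \<Rightarrow> bool" where
  "implements n G Q \<longleftrightarrow> unitary_mat (2 ^ n) G \<and>
    (\<forall>\<mu> < 2 * n. mat_adjoint G * majorana n \<mu> * G = majorana_lin n (\<lambda>\<nu>. Q $$ (\<mu>, \<nu>)))"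

lemma gaussian_unitary_iff:
  "gaussian_unitary n G \<longleftrightarrow> (\<exists>Q. real_orthogonal_mat (2 * n) Q \<and> implements n G Q)"
  by (auto simp: gaussian_unitary_def implements_def majorana_lin_def mat_lincomb_def)

text \<open>By linearity conjugation acts on a row of coefficients as right multiplication by
  \<open>Q\<close>.\<close>

lemma implements_conj_lin:
  assumes "implements n G Q"
  shows "mat_adjoint G * majorana_lin n x * G = majorana_lin n (\<lambda>\<rho>. \<Sum>\<nu><2 * n. x \<nu> * Q $$ (\<nu>, \<rho>))"
proof -
  have G: "G \<in> carrier_mat (2 ^ n) (2 ^ n)"
    using assms by (simp add: implements_def unitary_mat_def)
  have "mat_adjoint G * majorana_lin n x * G =
      mat_lincomb (2 ^ n) {..<2 * n} (\<lambda>\<nu>. complex_of_real (x \<nu>)) (\<lambda>\<nu>. mat_adjoint G * majorana n \<nu> * G)"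
    unfolding majorana_lin_def using G
    by (subst mult_mat_lincomb; (subst mat_lincomb_mult)?) (auto intro!: mult_carrier_mat[of _ _ "2 ^ n"])
  also have "\<dots> = mat_lincomb (2 ^ n) {..<2 * n} (\<lambda>\<nu>. complex_of_real (x \<nu>)) (\<lambda>\<nu>. majorana_lin n (\<lambda>\<rho>. Q $$ (\<nu>, \<rho>)))"
    using assms by (intro mat_lincomb_cong) (auto simp: implements_def)
  also have "\<dots> = majorana_lin n (\<lambda>\<rho>. \<Sum>\<nu><2 * n. x \<nu> * Q $$ (\<nu>, \<rho>))"
  proof (rule eq_matI)
    fix i j assume ij: "i < dim_row (majorana_lin n (\<lambda>\<rho>. \<Sum>\<nu><2 * n. x \<nu> * Q $$ (\<nu>, \<rho>)))"
      "j < dim_col (majorana_lin n (\<lambda>\<rho>. \<Sum>\<nu><2 * n. x \<nu> * Q $$ (\<nu>, \<rho>)))"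
    have "(\<Sum>\<nu><2 * n. complex_of_real (x \<nu>) * (\<Sum>\<rho><2 * n. complex_of_real (Q $$ (\<nu>, \<rho>)) * majorana n \<rho> $$ (i, j))) =
       (\<Sum>\<rho><2 * n. \<Sum>\<nu><2 * n. complex_of_real (x \<nu>) * (complex_of_real (Q $$ (\<nu>, \<rho>)) * majorana n \<rho> $$ (i, j)))"
      by (subst sum.swap) (simp add: sum_distrib_left)
    with ij show "mat_lincomb (2 ^ n) {..<2 * n} (\<lambda>\<nu>. complex_of_real (x \<nu>)) (\<lambda>\<nu>. majorana_lin n (\<lambda>\<rho>. Q $$ (\<nu>, \<rho>))) $$ (i, j)
        = majorana_lin n (\<lambda>\<rho>. \<Sum>\<nu><2 * n. x \<nu> * Q $$ (\<nu>, \<rho>)) $$ (i, j)"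
      by (simp add: majorana_lin_def sum_distrib_right mult.assoc)
  qed auto
  finally show ?thesis .
qed

text \<open>Conjugating by \<open>G\<close> yields row \<open>\<mu>\<close> of \<open>Q\<close>,
  which \<open>G'\<close> then multiplies by \<open>Q'\<close> from the right; hence the factors
  keep their order.\<close>

lemma implements_mult:
  assumes "implements n G Q" "implements n G' Q'" "Q \<in> carrier_mat (2 * n) (2 * n)" "Q' \<in> carrier_mat (2 * n) (2 * n)"
  shows "implements n (G * G') (Q * Q')"
  unfolding implements_def
proof (intro conjI allI impI)
  let ?d = "2 ^ n :: nat"
  have u: "unitary_mat ?d G" "unitary_mat ?d G'"
    using assms by (auto simp: implements_def)
  then show "unitary_mat ?d (G * G')" by (rule unitary_mat_mult)
  have c: "G \<in> carrier_mat ?d ?d" "G' \<in> carrier_mat ?d ?d" "mat_adjoint G \<in> carrier_mat ?d ?d" "mat_adjoint G' \<in> carrier_mat ?d ?d"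
    using u by (auto simp: unitary_mat_def)
  fix \<mu> assume \<mu>: "\<mu> < 2 * n"
  have "mat_adjoint (G * G') * majorana n \<mu> * (G * G') = mat_adjoint G' * (mat_adjoint G * majorana n \<mu> * G) * G'"
    using c \<mu> by (simp add: mat_adjoint_mult[OF c(1,2)] assoc_mult_mat[of _ ?d ?d _ ?d _ ?d] mult_carrier_mat[of _ ?d ?d])
  also have "mat_adjoint G * majorana n \<mu> * G = majorana_lin n (\<lambda>\<nu>. Q $$ (\<mu>, \<nu>))"
    using assms \<mu> by (simp add: implements_def)
  also have "mat_adjoint G' * \<dots> * G' = majorana_lin n (\<lambda>\<rho>. \<Sum>\<nu><2 * n. Q $$ (\<mu>, \<nu>) * Q' $$ (\<nu>, \<rho>))"
    by (rule implements_conj_lin) fact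
  also have "\<dots> = majorana_lin n (\<lambda>\<rho>. (Q * Q') $$ (\<mu>, \<rho>))"
    using assms(3,4) \<mu> by (intro majorana_lin_cong) (auto simp: scalar_prod_def lessThan_atLeast0)
  finally show "mat_adjoint (G * G') * majorana n \<mu> * (G * G') = majorana_lin n (\<lambda>\<rho>. (Q * Q') $$ (\<mu>, \<rho>))" .
qed

lemma real_orthogonal_mat_cols:
  "real_orthogonal_mat d Q \<longleftrightarrow> Q \<in> carrier_mat d d \<and>
    (\<forall>i<d. \<forall>j<d. (\<Sum>k<d. Q $$ (k, i) * Q $$ (k, j)) = (if i = j then 1 else 0))"
proof (intro iffI conjI)
  assume Q: "Q \<in> carrier_mat d d \<and> (\<forall>i<d. \<forall>j<d. (\<Sum>k<d. Q $$ (k, i) * Q $$ (k, j)) = (if i = j then 1 else 0))"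
  then have "transpose_mat Q * Q = 1\<^sub>m d"
    by (intro eq_matI) (auto simp: scalar_prod_def lessThan_atLeast0)
  then show "real_orthogonal_mat d Q"
    using Q mat_mult_left_right_inverse[of "transpose_mat Q" d Q] by (simp add: real_orthogonal_mat_def)
next
  assume Q: "real_orthogonal_mat d Q"
  then show "Q \<in> carrier_mat d d" by (simp add: real_orthogonal_mat_def)
  then show "\<forall>i<d. \<forall>j<d. (\<Sum>k<d. Q $$ (k, i) * Q $$ (k, j)) = (if i = j then 1 else 0)"
    using Q index_mult_mat(1)[of _ "transpose_mat Q" _ Q]
    by (auto simp: real_orthogonal_mat_def scalar_prod_def lessThan_atLeast0)
qed

lemma real_orthogonal_mat_transpose: "real_orthogonal_mat d Q \<Longrightarrow> real_orthogonal_mat d (transpose_mat Q)"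
  by (auto simp: real_orthogonal_mat_def)

lemma real_orthogonal_mat_rows:
  "real_orthogonal_mat d Q \<longleftrightarrow> Q \<in> carrier_mat d d \<and>
    (\<forall>i<d. \<forall>j<d. (\<Sum>k<d. Q $$ (i, k) * Q $$ (j, k)) = (if i = j then 1 else 0))"
proof -
  have "real_orthogonal_mat d Q \<longleftrightarrow> real_orthogonal_mat d (transpose_mat Q)"
    using real_orthogonal_mat_transpose[of d Q] real_orthogonal_mat_transpose[of d "transpose_mat Q"] by auto
  then show ?thesis
    unfolding real_orthogonal_mat_cols[of d "transpose_mat Q"] by auto
qed

lemma real_orthogonal_mat_mult:
  assumes "real_orthogonal_mat d A" "real_orthogonal_mat d B"
  shows "real_orthogonal_mat d (A * B)"
proof -
  have c: "A \<in> carrier_mat d d" "B \<in> carrier_mat d d" "transpose_mat A \<in> carrier_mat d d" "transpose_mat B \<in> carrier_mat d d"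
    using assms by (auto simp: real_orthogonal_mat_def)
  have "transpose_mat B * transpose_mat A * (A * B) = transpose_mat B * (transpose_mat A * A) * B"
    "A * B * (transpose_mat B * transpose_mat A) = A * (B * transpose_mat B) * transpose_mat A"
    using c by (simp_all add: assoc_mult_mat[of _ d d _ d _ d] mult_carrier_mat[of _ d d])
  then show ?thesis
    using assms c by (simp add: real_orthogonal_mat_def transpose_mult[OF c(1,2)] mult_carrier_mat[of _ d d])
qed

lemma implements_adjoint:
  assumes "implements n G Q" "real_orthogonal_mat (2 * n) Q"
  shows "implements n (mat_adjoint G) (transpose_mat Q)"
  unfolding implements_def
proof (intro conjI allI impI)
  let ?d = "2 ^ n :: nat"
  have u: "unitary_mat ?d G" using assms by (simp add: implements_def)
  then show "unitary_mat ?d (mat_adjoint G)" by (rule unitary_mat_adjoint)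
  have c: "G \<in> carrier_mat ?d ?d" "mat_adjoint G \<in> carrier_mat ?d ?d" using u by (auto simp: unitary_mat_def)
  fix \<mu> assume \<mu>: "\<mu> < 2 * n"
  \<comment> \<open>Orthonormality of the columns makes column \<open>\<mu>\<close> of
    \<open>Q\<close> the vector that conjugation by \<open>G\<close> sends to
    \<open>majorana n \<mu>\<close>; undoing the conjugation recovers it.\<close>
  define x where "x = (\<lambda>\<nu>. Q $$ (\<nu>, \<mu>))"
  have "mat_adjoint G * majorana_lin n x * G = majorana_lin n (\<lambda>\<rho>. \<Sum>\<nu><2 * n. x \<nu> * Q $$ (\<nu>, \<rho>))"
    by (rule implements_conj_lin) fact
  also have "\<dots> = majorana_lin n (\<lambda>\<nu>. if \<nu> = \<mu> then 1 else 0)"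
    using assms(2) \<mu> by (intro majorana_lin_cong) (auto simp: real_orthogonal_mat_cols x_def)
  also have "\<dots> = majorana n \<mu>" using \<mu> by (rule majorana_lin_delta)
  finally have "G * majorana n \<mu> * mat_adjoint G = G * (mat_adjoint G * majorana_lin n x * G) * mat_adjoint G" by simp
  also have "\<dots> = (G * mat_adjoint G) * majorana_lin n x * (G * mat_adjoint G)"
    using c by (simp add: assoc_mult_mat[of _ ?d ?d _ ?d _ ?d] mult_carrier_mat[of _ ?d ?d])
  also have "\<dots> = majorana_lin n x"
    using u by (simp add: unitary_mat_def left_mult_one_mat[of _ ?d ?d] right_mult_one_mat[of _ ?d ?d])
  also have "\<dots> = majorana_lin n (\<lambda>\<nu>. transpose_mat Q $$ (\<mu>, \<nu>))"
    using assms(2) \<mu> by (intro majorana_lin_cong) (auto simp: real_orthogonal_mat_def x_def)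
  finally show "mat_adjoint (mat_adjoint G) * majorana n \<mu> * mat_adjoint G =
      majorana_lin n (\<lambda>\<nu>. transpose_mat Q $$ (\<mu>, \<nu>))" by simp
qed

text \<open>The Householder matrix 1 - 2 v v^T, a reflection when \<open>v\<close> is a unit
  vector.\<close>

definition reflection :: "nat \<Rightarrow> (nat \<Rightarrow> real) \<Rightarrow> real mat" where
  "reflection d v = mat d d (\<lambda>(i, j). (if i = j then 1 else 0) - 2 * v i * v j)"

lemma reflection_carrier [simp]: "reflection d v \<in> carrier_mat d d"
  by (simp add: reflection_def)

lemma reflection_mult_index:
  assumes "Q \<in> carrier_mat d d" "i < d" "j < d"
  shows "(reflection d v * Q) $$ (i, j) = Q $$ (i, j) - 2 * v i * (\<Sum>k<d. v k * Q $$ (k, j))"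
proof -
  have "(reflection d v * Q) $$ (i, j) = (\<Sum>k<d. ((if i = k then 1 else 0) - 2 * v i * v k) * Q $$ (k, j))"
    using assms by (simp add: reflection_def scalar_prod_def lessThan_atLeast0)
  also have "\<dots> = (\<Sum>k<d. (if i = k then Q $$ (k, j) else 0)) - (\<Sum>k<d. 2 * v i * (v k * Q $$ (k, j)))"
    by (subst sum_subtractf[symmetric], rule sum.cong) (auto simp: algebra_simps)
  finally show ?thesis
    using assms by (simp add: sum_distrib_left)
qed

lemma reflection_square:
  assumes "(\<Sum>k<d. (v k)\<^sup>2) = 1"
  shows "reflection d v * reflection d v = 1\<^sub>m d"
proof (rule eq_matI)
  fix i j assume ij: "i < dim_row (1\<^sub>m d :: real mat)" "j < dim_col (1\<^sub>m d :: real mat)"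
  have "(\<Sum>k<d. v k * reflection d v $$ (k, j)) = (\<Sum>k<d. (if k = j then v k else 0)) - (\<Sum>k<d. 2 * v j * (v k)\<^sup>2)"
    using ij by (subst sum_subtractf[symmetric], intro sum.cong) (auto simp: reflection_def algebra_simps power2_eq_square)
  also have "\<dots> = - v j"
    using ij assms by (simp flip: sum_distrib_left)
  finally show "(reflection d v * reflection d v) $$ (i, j) = 1\<^sub>m d $$ (i, j)"
    using ij by (simp add: reflection_mult_index) (simp add: reflection_def)
qed (simp_all add: reflection_def)

lemma reflection_orthogonal:
  assumes "(\<Sum>k<d. (v k)\<^sup>2) = 1"
  shows "real_orthogonal_mat d (reflection d v)"
proof -
  have "transpose_mat (reflection d v) = reflection d v"
    by (rule eq_matI) (auto simp: reflection_def)
  then show ?thesis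
    using reflection_square[OF assms] by (simp add: real_orthogonal_mat_def)
qed

text \<open>
  Conjugation by \<open>majorana_lin n v\<close> is minus the reflection in \<open>v\<close>; the parity operator supplies the
  missing sign.
\<close>

lemma reflection_implements:
  assumes v: "(\<Sum>k<2 * n. (v k)\<^sup>2) = 1"
  shows "implements n (majorana_lin n v * parity_string n n) (reflection (2 * n) v)"
  unfolding implements_def
proof (intro conjI allI impI)
  let ?d = "2 ^ n :: nat"
  let ?L = "majorana_lin n v" and ?W = "parity_string n n"
  note assoc = assoc_mult_mat[of _ ?d ?d _ ?d _ ?d]
  have LL: "?L * ?L = 1\<^sub>m ?d"
    by (simp add: majorana_lin_square v) (rule eq_matI, auto)
  have WW: "?W * ?W = 1\<^sub>m ?d" by (simp add: parity_string_square)
  have c: "?L \<in> carrier_mat ?d ?d" "?W \<in> carrier_mat ?d ?d" by auto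
  note d = c[THEN carrier_matD(1)] c[THEN carrier_matD(2)]
  show "unitary_mat ?d (?L * ?W)"
    by (rule unitary_mat_mult) (use c LL WW in \<open>simp_all add: unitary_mat_def majorana_lin_adjoint parity_string_adjoint\<close>)
  fix \<mu> assume \<mu>: "\<mu> < 2 * n"
  let ?g = "majorana n \<mu>"
  have g: "?g \<in> carrier_mat ?d ?d" using \<mu> by simp
  have anti: "?g * ?L = complex_of_real (2 * v \<mu>) \<cdot>\<^sub>m 1\<^sub>m ?d - ?L * ?g"
  proof (rule eq_matI)
    fix i j assume ij: "i < dim_row (complex_of_real (2 * v \<mu>) \<cdot>\<^sub>m 1\<^sub>m ?d - ?L * ?g)"
      "j < dim_col (complex_of_real (2 * v \<mu>) \<cdot>\<^sub>m 1\<^sub>m ?d - ?L * ?g)"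
    have "(\<Sum>\<nu><2 * n. (if \<nu> = \<mu> then 1 else 0) * v \<nu>) = v \<mu>"
      using \<mu> by (simp add: if_distrib[of "\<lambda>a. a * _"] cong: if_cong)
    with ij g c d show "(?g * ?L) $$ (i, j) = (complex_of_real (2 * v \<mu>) \<cdot>\<^sub>m 1\<^sub>m ?d - ?L * ?g) $$ (i, j)"
      using majorana_lin_anticommutator[of i n j "\<lambda>\<nu>. if \<nu> = \<mu> then 1 else 0" v] \<mu>
      by (simp add: majorana_lin_delta eq_diff_eq)
  qed (use g c d in auto)
  have "?L * (?g * ?L) = complex_of_real (2 * v \<mu>) \<cdot>\<^sub>m ?L - ?L * (?L * ?g)"
    unfolding anti using c g
    by (subst mult_minus_distrib_mat[of _ ?d ?d _ ?d]) (auto simp: mult_smult_distrib[of _ ?d ?d _ ?d] mult_carrier_mat[of _ ?d ?d])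
  also have "?L * (?L * ?g) = ?g"
    using c g LL by (simp flip: assoc)
  \<comment> \<open>The right side is the Clifford element of 2 v(\<mu>) v - e(\<mu>), the negative
    of row \<open>\<mu>\<close> of the reflection. Parity conjugation negates everything linear in
    the Majorana operators and so corrects the sign.\<close>
  finally have LgL: "?L * (?g * ?L) = complex_of_real (2 * v \<mu>) \<cdot>\<^sub>m ?L - ?g" .
  have WgW: "?W * majorana n \<nu> * ?W = - majorana n \<nu>" if "\<nu> < 2 * n" for \<nu>
    using parity_anticommute_majorana[OF that] c d that WW
    by (simp add: assoc[of "majorana n \<nu>" ?W ?W] majorana_carrier[OF that] right_mult_one_mat[of _ ?d ?d])
  have WLW: "?W * ?L * ?W = - ?L"
  proof -
    have "?W * ?L * ?W = mat_lincomb ?d {..<2 * n} (\<lambda>\<nu>. complex_of_real (v \<nu>)) (\<lambda>\<nu>. ?W * majorana n \<nu> * ?W)"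
      unfolding majorana_lin_def using c
      by (subst mult_mat_lincomb; (subst mat_lincomb_mult)?) (auto intro!: mult_carrier_mat[of _ _ ?d])
    also have "\<dots> = mat_lincomb ?d {..<2 * n} (\<lambda>\<nu>. complex_of_real (v \<nu>)) (\<lambda>\<nu>. - majorana n \<nu>)"
      by (intro mat_lincomb_cong WgW) auto
    also have "\<dots> = - ?L"
      by (rule eq_matI) (auto simp: majorana_lin_def sum_negf)
    finally show ?thesis .
  qed
  have "mat_adjoint (?L * ?W) * ?g * (?L * ?W) = ?W * (?L * (?g * ?L)) * ?W"
    using c g by (simp add: mat_adjoint_mult[OF c] majorana_lin_adjoint parity_string_adjoint assoc mult_carrier_mat[of _ ?d ?d])
  also have "\<dots> = complex_of_real (2 * v \<mu>) \<cdot>\<^sub>m (?W * ?L * ?W) - ?W * ?g * ?W"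
    unfolding LgL using c g
    by (simp add: mult_minus_distrib_mat[of _ ?d ?d _ ?d] minus_mult_distrib_mat[of _ ?d ?d _ _ ?d] mult_carrier_mat[of _ ?d ?d] smult_carrier_mat
       mult_smult_distrib[of _ ?d ?d _ ?d] mult_smult_assoc_mat[of _ ?d ?d _ ?d])
  also have "\<dots> = complex_of_real (2 * v \<mu>) \<cdot>\<^sub>m (- ?L) - (- ?g)"
    by (simp only: WLW WgW[OF \<mu>])
  also have "\<dots> = majorana_lin n (\<lambda>\<nu>. reflection (2 * n) v $$ (\<mu>, \<nu>))"
  proof (rule eq_matI)
    fix i j assume "i < dim_row (majorana_lin n (\<lambda>\<nu>. reflection (2 * n) v $$ (\<mu>, \<nu>)))"
      "j < dim_col (majorana_lin n (\<lambda>\<nu>. reflection (2 * n) v $$ (\<mu>, \<nu>)))"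
    then have ij: "i < ?d" "j < ?d" by auto
    have "majorana_lin n (\<lambda>\<nu>. reflection (2 * n) v $$ (\<mu>, \<nu>)) $$ (i, j) =
        (\<Sum>\<nu><2 * n. (if \<nu> = \<mu> then majorana n \<nu> $$ (i, j) else 0)) -
        (\<Sum>\<nu><2 * n. 2 * v \<mu> * (v \<nu> * majorana n \<nu> $$ (i, j)))"
      using ij \<mu> unfolding majorana_lin_def
      by (subst sum_subtractf[symmetric], simp, intro sum.cong) (auto simp: reflection_def algebra_simps)
    also have "\<dots> = majorana n \<mu> $$ (i, j) - 2 * v \<mu> * majorana_lin n v $$ (i, j)"
      using \<mu> ij by (simp add: majorana_lin_def sum_distrib_left)
    finally show "(complex_of_real (2 * v \<mu>) \<cdot>\<^sub>m (- ?L) - (- ?g)) $$ (i, j) =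
        majorana_lin n (\<lambda>\<nu>. reflection (2 * n) v $$ (\<mu>, \<nu>)) $$ (i, j)"
      using ij g c d \<mu> by simp
  qed (use g c d \<mu> in auto)
  finally show "mat_adjoint (?L * ?W) * ?g * (?L * ?W) = majorana_lin n (\<lambda>\<nu>. reflection (2 * n) v $$ (\<mu>, \<nu>))" .
qed

lemma one_implements: "implements n (1\<^sub>m (2 ^ n)) (1\<^sub>m (2 * n))"
  unfolding implements_def
proof (intro conjI allI impI)
  fix \<mu> assume \<mu>: "\<mu> < 2 * n"
  then have "majorana_lin n (\<lambda>\<nu>. 1\<^sub>m (2 * n) $$ (\<mu>, \<nu>)) = majorana_lin n (\<lambda>\<nu>. if \<nu> = \<mu> then 1 else 0)"
    by (intro majorana_lin_cong) auto
  with \<mu> show "mat_adjoint (1\<^sub>m (2 ^ n)) * majorana n \<mu> * 1\<^sub>m (2 ^ n) = majorana_lin n (\<lambda>\<nu>. 1\<^sub>m (2 * n) $$ (\<mu>, \<nu>))"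
    by (simp add: majorana_lin_delta left_mult_one_mat[of _ "2 ^ n" "2 ^ n"] right_mult_one_mat[of _ "2 ^ n" "2 ^ n"])
qed (simp add: unitary_mat_def)

text \<open>Cartan--Dieudonne: a reflection makes one more column of the matrix trivial.\<close>

lemma orthogonal_implementable:
  assumes "real_orthogonal_mat (2 * n) Q"
  shows "\<exists>G. implements n G Q"
proof -
  let ?d = "2 * n"
  \<comment> \<open>The induction runs on the number \<open>2 * n - r\<close> of columns not yet
    trivial; it ends at the identity matrix.\<close>
  have "\<exists>G. implements n G Q"
    if "real_orthogonal_mat ?d Q" "r \<le> ?d" "\<forall>j<r. \<forall>i<?d. Q $$ (i, j) = (if i = j then 1 else 0)" for r Q
    using that
  proof (induction "?d - r" arbitrary: r Q)
    case 0
    then have "Q = 1\<^sub>m ?d"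
      by (intro eq_matI) (auto simp: real_orthogonal_mat_def)
    then show ?case using one_implements by blast
  next
    case (Suc m)
    then have r: "r < ?d" and Q: "Q \<in> carrier_mat ?d ?d"
      by (auto simp: real_orthogonal_mat_def)
    have orth: "(\<Sum>k<?d. Q $$ (k, i) * Q $$ (k, j)) = (if i = j then 1 else 0)" if "i < ?d" "j < ?d" for i j
      using Suc.prems(1) that by (simp add: real_orthogonal_mat_cols)
    \<comment> \<open>The reflection in the difference of column \<open>r\<close> and the basis
      vector of index \<open>r\<close> exchanges these two unit vectors.\<close>
    define u where "u i = Q $$ (i, r) - (if i = r then 1 else 0)" for i
    define s where "s = (\<Sum>k<?d. (u k)\<^sup>2)"
    have usum: "(\<Sum>k<?d. u k * Q $$ (k, j)) = (if j = r then 1 else 0) - Q $$ (r, j)" if "j < ?d" for j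
    proof -
      have "(\<Sum>k<?d. u k * Q $$ (k, j)) = (\<Sum>k<?d. Q $$ (k, r) * Q $$ (k, j)) - (\<Sum>k<?d. (if k = r then Q $$ (k, j) else 0))"
        by (subst sum_subtractf[symmetric], rule sum.cong) (auto simp: u_def algebra_simps)
      then show ?thesis using orth[OF r that] r by (cases "j = r") simp_all
    qed
    \<comment> \<open>Since column \<open>r\<close> has length 1, the squared length of
      \<open>u\<close> is linear in the entry \<open>(r, r)\<close>; this is what cancels when the
      reflection is applied to column \<open>r\<close>.\<close>
    have s_eq: "s = 2 * (1 - Q $$ (r, r))"
    proof -
      have "s = (\<Sum>k<?d. u k * Q $$ (k, r)) - (\<Sum>k<?d. if k = r then u k else 0)"
        unfolding s_def by (subst sum_subtractf[symmetric], rule sum.cong) (auto simp: u_def algebra_simps power2_eq_square)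
      then show ?thesis using usum[OF r] r by (simp add: u_def)
    qed
    show ?case
    proof (cases "s = 0")
      case True
      then have "\<forall>i<?d. Q $$ (i, r) = (if i = r then 1 else 0)"
        unfolding s_def by (subst (asm) sum_nonneg_eq_0_iff) (auto simp: u_def split: if_splits)
      then have "\<forall>j<Suc r. \<forall>i<?d. Q $$ (i, j) = (if i = j then 1 else 0)"
        using Suc.prems(3) by (auto simp: less_Suc_eq)
      then show ?thesis using Suc r by (intro Suc.hyps(1)[of "Suc r"]) auto
    next
      case False
      then have s: "s > 0" unfolding s_def by (metis sum_nonneg zero_le_power2 less_eq_real_def)
      define v where "v i = u i / sqrt s" for i
      have v: "(\<Sum>k<?d. (v k)\<^sup>2) = 1"
        using s by (simp add: v_def power_divide flip: sum_divide_distrib) (simp add: s_def)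
      have vsum: "(\<Sum>k<?d. v k * Q $$ (k, j)) = ((if j = r then 1 else 0) - Q $$ (r, j)) / sqrt s" if "j < ?d" for j
        using usum[OF that] by (simp add: v_def flip: sum_divide_distrib)
      let ?H = "reflection ?d v"
      have HQ: "\<forall>j<Suc r. \<forall>i<?d. (?H * Q) $$ (i, j) = (if i = j then 1 else 0)"
      proof (intro allI impI)
        fix i j assume j: "j < Suc r" and i: "i < ?d"
        have *: "(?H * Q) $$ (i, j) = Q $$ (i, j) - 2 * u i * ((if j = r then 1 else 0) - Q $$ (r, j)) / s"
          using Q i j r s vsum[of j] by (simp add: reflection_mult_index v_def)
        show "(?H * Q) $$ (i, j) = (if i = j then 1 else 0)"
        proof (cases "j = r")
          case True
          moreover have "2 * u i * (1 - Q $$ (r, r)) / s = u i"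
            using s unfolding s_eq by (simp add: divide_simps)
          ultimately show ?thesis using * by (simp add: u_def)
        next
          case False
          \<comment> \<open>For \<open>j < r\<close> the entry \<open>(r, j)\<close> of
            \<open>Q\<close> is 0, so the correction vanishes and earlier columns stay
            trivial.\<close>
          then show ?thesis using * Suc.prems(3) i j r by auto
        qed
      qed
      have "real_orthogonal_mat ?d (?H * Q)"
        using reflection_orthogonal[OF v] Suc.prems(1) by (rule real_orthogonal_mat_mult)
      then obtain G where G: "implements n G (?H * Q)"
        using Suc.hyps(1)[of "Suc r" "?H * Q"] Suc.hyps(2) HQ r
        by (metis Suc_leI diff_Suc_1 diff_Suc_eq_diff_pred diff_commute)
      have "?H * (?H * Q) = ?H * ?H * Q"
        using Q by (intro assoc_mult_mat[of ?H ?d ?d ?H ?d Q ?d, symmetric]) auto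
      then have "?H * (?H * Q) = Q"
        using Q reflection_square[OF v] by simp
      moreover have "?H * Q \<in> carrier_mat ?d ?d"
        using Q by (rule mult_carrier_mat[OF reflection_carrier])
      ultimately show ?thesis
        using implements_mult[OF reflection_implements[OF v] G reflection_carrier] by auto
    qed
  qed
  from this[of Q 0] assms show ?thesis by simp
qed

subsection \<open>Trace distance of pure states\<close>

definition mat_trace :: "complex mat \<Rightarrow> complex" where
  "mat_trace A = (\<Sum>i<dim_row A. A $$ (i, i))"

lemma mat_trace_comm:
  assumes "A \<in> carrier_mat r c" "B \<in> carrier_mat c r"
  shows "mat_trace (A * B) = mat_trace (B * A)"
proof -
  have "mat_trace (A * B) = (\<Sum>i<r. \<Sum>j<c. A $$ (i, j) * B $$ (j, i))"
    using assms by (simp add: mat_trace_def scalar_prod_def lessThan_atLeast0)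
  also have "\<dots> = (\<Sum>j<c. \<Sum>i<r. B $$ (j, i) * A $$ (i, j))"
    by (subst sum.swap) (simp add: mult.commute)
  also have "\<dots> = mat_trace (B * A)"
    using assms by (simp add: mat_trace_def scalar_prod_def lessThan_atLeast0)
  finally show ?thesis .
qed

text \<open>Schur triangularization puts the eigenvalues on the diagonal, and the trace is invariant
  under similarity.\<close>

lemma mat_trace_eq_sum_eigenvalues:
  assumes A: "A \<in> carrier_mat d d" and es: "char_poly A = (\<Prod>e\<leftarrow>es. [:- e, 1:])"
  shows "mat_trace A = sum_list es"
proof -
  obtain B P Q where "schur_decomposition A es = (B, P, Q)"
    by (cases "schur_decomposition A es")
  from schur_decomposition[OF A es this]
  have sim: "similar_mat_wit A B P Q" and diag: "diag_mat B = es" by auto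
  note s = similar_mat_witD2[OF A sim]
  have "mat_trace A = mat_trace (P * (B * Q))"
    using s by (simp add: assoc_mult_mat[of _ d d _ d _ d])
  also have "\<dots> = mat_trace (B * Q * P)"
    using s by (intro mat_trace_comm[of _ d d]) auto
  also have "\<dots> = mat_trace B"
    using s by (simp add: assoc_mult_mat[of _ d d _ d _ d])
  also have "\<dots> = sum_list es"
    unfolding diag[symmetric] using s(5) by (simp add: mat_trace_def diag_mat_def sum_list_sum_nth lessThan_atLeast0)
  finally show ?thesis .
qed

lemma proots_prod_linear_factors: "proots (\<Prod>e\<leftarrow>es. [:- e, 1:]) = mset (es :: complex list)"
proof (induction es)
  case (Cons e es)
  have "(\<Prod>e\<leftarrow>es. [:- e, 1:]) \<noteq> 0" by (auto simp: prod_list_zero_iff)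
  with Cons show ?case by (simp add: proots_mult del: mult_pCons_left)
qed simp

lemma cscalar_prod_le:
  fixes v w :: "complex vec"
  assumes "v \<in> carrier_vec d" "w \<in> carrier_vec d"
  shows "cmod (v \<bullet>c w) \<le> sqrt (Re (v \<bullet>c v)) * sqrt (Re (w \<bullet>c w))"
proof -
  have sq: "Re (u \<bullet>c u) = (\<Sum>i<d. (cmod (u $ i))\<^sup>2)" if "u \<in> carrier_vec d" for u :: "complex vec"
    using that by (auto simp: scalar_prod_def lessThan_atLeast0 complex_mult_cnj cmod_power2)
  have "cmod (v \<bullet>c w) \<le> (\<Sum>i<d. \<bar>cmod (v $ i)\<bar> * \<bar>cmod (w $ i)\<bar>)"
    using assms by (auto simp: scalar_prod_def lessThan_atLeast0 norm_mult intro!: order_trans[OF norm_sum])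
  also have "\<dots> \<le> L2_set (\<lambda>i. cmod (v $ i)) {..<d} * L2_set (\<lambda>i. cmod (w $ i)) {..<d}"
    by (rule L2_set_mult_ineq)
  finally show ?thesis using assms by (simp add: sq L2_set_def)
qed

lemma smult_mat_mult_vec:
  assumes "A \<in> carrier_mat r c" "v \<in> carrier_vec c"
  shows "(k \<cdot>\<^sub>m A) *\<^sub>v v = k \<cdot>\<^sub>v (A *\<^sub>v (v :: complex vec))"
  by (rule eq_vecI) (use assms in \<open>auto simp: scalar_prod_def sum_distrib_left mult.assoc\<close>)

text \<open>The third assumption forces every eigenvalue of \<open>mat_adjoint A * A\<close> to be 0
  or \<open>s\<close>. The trace then fixes the sum of their square roots, without counting
  multiplicities.\<close>

lemma trace_norm_projector_multiple:
  assumes A: "A \<in> carrier_mat d d" and s: "s \<ge> 0"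
    and cubic: "mat_adjoint A * A * (mat_adjoint A * A) = complex_of_real s \<cdot>\<^sub>m (mat_adjoint A * A)"
    and tr: "mat_trace (mat_adjoint A * A) = complex_of_real (2 * s)"
  shows "trace_norm A = 2 * sqrt s"
proof -
  define B where "B = mat_adjoint A * A"
  have B: "B \<in> carrier_mat d d" using A by (simp add: B_def mult_carrier_mat[of _ d d])
  obtain es where es: "char_poly B = (\<Prod>e\<leftarrow>es. [:- e, 1:])"
    using char_poly_factorized[OF B] by blast
  have ev: "e = 0 \<or> e = complex_of_real s" if "e \<in> set es" for e
  proof -
    have "poly (char_poly B) e = 0"
      using that unfolding es poly_prod_list by (auto simp: prod_list_zero_iff)
    then obtain v where v: "v \<in> carrier_vec d" "v \<noteq> 0\<^sub>v d" "B *\<^sub>v v = e \<cdot>\<^sub>v v"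
      using B by (auto simp: eigenvalue_root_char_poly[OF B, symmetric] eigenvalue_def eigenvector_def)
    have "B * B *\<^sub>v v = e * e \<cdot>\<^sub>v v"
      using B v by (simp add: assoc_mult_mat_vec[of _ d d _ d] mult_mat_vec[of _ d d] smult_smult_assoc)
    moreover have "B * B *\<^sub>v v = complex_of_real s * e \<cdot>\<^sub>v v"
      using B v cubic by (simp add: B_def[symmetric] smult_mat_mult_vec[of _ d d] smult_smult_assoc)
    ultimately have eq: "e * e \<cdot>\<^sub>v v = complex_of_real s * e \<cdot>\<^sub>v v" by simp
    obtain i where i: "i < d" "v $ i \<noteq> 0"
      using v(1,2) by (metis carrier_vecD eq_vecI index_zero_vec)
    have "e * e * v $ i = complex_of_real s * e * v $ i"
      using arg_cong[OF eq, of "\<lambda>w. w $ i"] i v(1) by simp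
    then show ?thesis using i by simp
  qed
  have "trace_norm A = (\<Sum>x\<in>#mset es. sqrt (Re x))"
    unfolding trace_norm_def B_def[symmetric] es proots_prod_linear_factors ..
  also have "\<dots> = (\<Sum>x\<leftarrow>es. sqrt (Re x))"
    by (simp add: sum_mset_sum_list flip: mset_map)
  finally have tn: "trace_norm A = (\<Sum>x\<leftarrow>es. sqrt (Re x))" .
  \<comment> \<open>For x equal to 0 or \<open>s\<close>, sqrt s * sqrt x = x, so after this scaling
    the sum of roots becomes the trace.\<close>
  have "sqrt s * trace_norm A = (\<Sum>x\<leftarrow>es. sqrt s * sqrt (Re x))"
    unfolding tn by (rule sum_list_const_mult[symmetric])
  also have "\<dots> = (\<Sum>x\<leftarrow>es. Re x)"
    using ev s by (intro arg_cong[of _ _ sum_list] map_cong) fastforce+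
  also have "\<dots> = Re (sum_list es)"
    by (induction es) auto
  also have "\<dots> = 2 * s"
    using tr unfolding B_def[symmetric] mat_trace_eq_sum_eigenvalues[OF B es] by simp
  finally have *: "sqrt s * trace_norm A = 2 * s" .
  show ?thesis
  proof (cases "s = 0")
    case True
    then have "\<forall>x\<in>set es. sqrt (Re x) = 0" using ev by fastforce
    then have "(\<Sum>x\<leftarrow>es. sqrt (Re x)) = 0" by (induction es) auto
    then show ?thesis using tn True by simp
  next
    case False
    then have "sqrt s > 0" using s by simp
    moreover have "sqrt s * trace_norm A = sqrt s * (2 * sqrt s)" using * s by simp
    ultimately show ?thesis by simp
  qed
qed

text \<open>With A the difference of the two projectors and s = 1 - |c|^2 for the overlap c, one has
  A^3 = s A and tr(A^2) = 2 s, so A^2 fits the lemma above. The second claim is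
  Cauchy-Schwarz.\<close>

lemma trace_distance_density:
  assumes \<psi>: "\<psi> \<in> carrier_vec d" "\<psi> \<bullet>c \<psi> = 1" and \<phi>: "\<phi> \<in> carrier_vec d" "\<phi> \<bullet>c \<phi> = 1"
  shows "trace_distance (density \<psi>) (density \<phi>) = sqrt (1 - (cmod (\<psi> \<bullet>c \<phi>))\<^sup>2)"
    and "cmod (\<psi> \<bullet>c \<phi>) \<le> 1"
proof -
  define A where "A = density \<psi> - density \<phi>"
  define c where "c = \<psi> \<bullet>c \<phi>"
  have A: "A \<in> carrier_mat d d"
    using \<psi> \<phi> by (intro carrier_matI) (auto simp: A_def density_def)
  then have dA: "dim_row A = d" "dim_col A = d" by auto
  have A_idx: "A $$ (i, j) = \<psi> $ i * cnj (\<psi> $ j) - \<phi> $ i * cnj (\<phi> $ j)" if "i < d" "j < d" for i j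
    using that \<psi> \<phi> by (auto simp: A_def density_def)
  have adj: "mat_adjoint A = A"
    by (rule eq_matI) (auto simp: dA A_idx mult.commute)
  have sums: "(\<Sum>k<d. cnj (\<psi> $ k) * \<psi> $ k) = 1" "(\<Sum>k<d. cnj (\<phi> $ k) * \<phi> $ k) = 1"
    "(\<Sum>k<d. cnj (\<phi> $ k) * \<psi> $ k) = c" "(\<Sum>k<d. cnj (\<psi> $ k) * \<phi> $ k) = cnj c"
    using \<psi> \<phi> by (auto simp: scalar_prod_def lessThan_atLeast0 c_def mult.commute)
  \<comment> \<open>\<open>A\<close> preserves the span of the two state vectors; its action on them
    determines all products computed below.\<close>
  have left: "(\<Sum>k<d. A $$ (i, k) * \<psi> $ k) = \<psi> $ i - c * \<phi> $ i"
    "(\<Sum>k<d. A $$ (i, k) * \<phi> $ k) = cnj c * \<psi> $ i - \<phi> $ i" if "i < d" for i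
  proof -
    have "(\<Sum>k<d. A $$ (i, k) * f k) =
       \<psi> $ i * (\<Sum>k<d. cnj (\<psi> $ k) * f k) - \<phi> $ i * (\<Sum>k<d. cnj (\<phi> $ k) * f k)" for f
      unfolding sum_distrib_left sum_subtractf[symmetric]
      using that by (intro sum.cong) (auto simp: A_idx algebra_simps)
    then show "(\<Sum>k<d. A $$ (i, k) * \<psi> $ k) = \<psi> $ i - c * \<phi> $ i"
      "(\<Sum>k<d. A $$ (i, k) * \<phi> $ k) = cnj c * \<psi> $ i - \<phi> $ i"
      by (simp_all add: sums)
  qed
  have mult_idx: "(X * A) $$ (i, j) = (\<Sum>k<d. X $$ (i, k) * \<psi> $ k) * cnj (\<psi> $ j) - (\<Sum>k<d. X $$ (i, k) * \<phi> $ k) * cnj (\<phi> $ j)"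
    if "X \<in> carrier_mat d d" "i < d" "j < d" for X i j
  proof -
    have "(X * A) $$ (i, j) = (\<Sum>k<d. X $$ (i, k) * A $$ (k, j))"
      using that A by (auto simp: scalar_prod_def lessThan_atLeast0)
    also have "\<dots> = (\<Sum>k<d. X $$ (i, k) * \<psi> $ k * cnj (\<psi> $ j) - X $$ (i, k) * \<phi> $ k * cnj (\<phi> $ j))"
      using that by (intro sum.cong) (auto simp: A_idx algebra_simps)
    finally show ?thesis by (simp add: sum_subtractf sum_distrib_right)
  qed
  define B where "B = A * A"
  have B: "B \<in> carrier_mat d d" using A by (simp add: B_def)
  have B_idx: "B $$ (i, j) = (\<psi> $ i - c * \<phi> $ i) * cnj (\<psi> $ j) - (cnj c * \<psi> $ i - \<phi> $ i) * cnj (\<phi> $ j)"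
    if "i < d" "j < d" for i j
    unfolding B_def using that A by (simp only: mult_idx left)
  define s where "s = 1 - (cmod c)\<^sup>2"
  have cs: "1 - c * cnj c = complex_of_real s"
    by (simp add: s_def complex_mult_cnj cmod_power2)
  have "cmod c \<le> 1"
    using cscalar_prod_le[OF \<psi>(1) \<phi>(1)] \<psi> \<phi> by (simp add: c_def)
  then show "cmod (\<psi> \<bullet>c \<phi>) \<le> 1" by (simp add: c_def)
  have s: "s \<ge> 0"
    using \<open>cmod c \<le> 1\<close> by (simp add: s_def abs_square_le_1)
  have BA: "B * A = complex_of_real s \<cdot>\<^sub>m A"
  proof (rule eq_matI)
    fix i j assume "i < dim_row (complex_of_real s \<cdot>\<^sub>m A)" "j < dim_col (complex_of_real s \<cdot>\<^sub>m A)"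
    then have ij: "i < d" "j < d" by (auto simp: dA)
    have "(\<Sum>k<d. B $$ (i, k) * f k) =
       (\<psi> $ i - c * \<phi> $ i) * (\<Sum>k<d. cnj (\<psi> $ k) * f k) - (cnj c * \<psi> $ i - \<phi> $ i) * (\<Sum>k<d. cnj (\<phi> $ k) * f k)" for f
      unfolding sum_distrib_left sum_subtractf[symmetric]
      using ij by (intro sum.cong) (auto simp: B_idx algebra_simps)
    note sumB = this
    have "(\<Sum>k<d. B $$ (i, k) * \<psi> $ k) = (1 - c * cnj c) * \<psi> $ i"
      "(\<Sum>k<d. B $$ (i, k) * \<phi> $ k) = (1 - c * cnj c) * \<phi> $ i"
      unfolding sumB sums by (simp_all add: algebra_simps)
    then show "(B * A) $$ (i, j) = (complex_of_real s \<cdot>\<^sub>m A) $$ (i, j)"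
      using ij dA by (simp add: mult_idx[OF B] cs A_idx algebra_simps)
  qed (use A B in auto)
  have "B * B = complex_of_real s \<cdot>\<^sub>m B"
  proof -
    have "B * B = B * A * A" using A B unfolding B_def[of] by (simp add: assoc_mult_mat[of _ d d _ d _ d])
    then show ?thesis using A BA by (simp add: B_def mult_smult_assoc_mat[of _ d d _ d])
  qed
  moreover have "mat_trace B = complex_of_real (2 * s)"
  proof -
    have "mat_trace B = (\<Sum>k<d. cnj (\<psi> $ k) * \<psi> $ k - c * (cnj (\<psi> $ k) * \<phi> $ k)
        - cnj c * (cnj (\<phi> $ k) * \<psi> $ k) + cnj (\<phi> $ k) * \<phi> $ k)"
      using B unfolding mat_trace_def by (intro sum.cong) (auto simp: B_idx algebra_simps)
    also have "\<dots> = 1 - c * cnj c - cnj c * c + 1"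
      by (simp add: sum.distrib sum_subtractf sums flip: sum_distrib_left)
    also have "\<dots> = complex_of_real (2 * s)"
      using cs by (simp flip: cs)
    finally show ?thesis .
  qed
  ultimately have "trace_norm A = 2 * sqrt s"
    using A s by (intro trace_norm_projector_multiple[of _ d]) (simp_all add: adj B_def)
  then show "trace_distance (density \<psi>) (density \<phi>) = sqrt (1 - (cmod (\<psi> \<bullet>c \<phi>))\<^sup>2)"
    by (simp add: trace_distance_def A_def s_def c_def)
qed

subsection \<open>Normal form of antisymmetric matrices\<close>

text \<open>Real vectors are functions on the naturals of which only the first \<open>d\<close>
  coordinates are read. This lets the compactness argument below work in a product of
  intervals.\<close>

definition ip :: "nat \<Rightarrow> (nat \<Rightarrow> real) \<Rightarrow> (nat \<Rightarrow> real) \<Rightarrow> real" where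
  "ip d x y = (\<Sum>i<d. x i * y i)"

definition bilin :: "nat \<Rightarrow> real mat \<Rightarrow> (nat \<Rightarrow> real) \<Rightarrow> (nat \<Rightarrow> real) \<Rightarrow> real" where
  "bilin d A x y = (\<Sum>i<d. \<Sum>j<d. x i * A $$ (i, j) * y j)"

lemma ip_commute: "ip d x y = ip d y x"
  by (simp add: ip_def mult.commute)

lemma ip_lincomb_right: "ip d x (\<lambda>i. a * y i + b * z i) = a * ip d x y + b * ip d x z"
  by (simp add: ip_def algebra_simps sum.distrib sum_distrib_left)

lemma ip_lincomb_left: "ip d (\<lambda>i. a * y i + b * z i) x = a * ip d y x + b * ip d z x"
  by (simp add: ip_def algebra_simps sum.distrib sum_distrib_left)

lemma ip_scale: "ip d x (\<lambda>i. y i / c) = ip d x y / c" "ip d (\<lambda>i. x i / c) y = ip d x y / c"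
  by (simp_all add: ip_def sum_divide_distrib)

lemma ip_cong: "(\<And>i. i < d \<Longrightarrow> x i = x' i) \<Longrightarrow> (\<And>i. i < d \<Longrightarrow> y i = y' i) \<Longrightarrow> ip d x y = ip d x' y'"
  by (simp add: ip_def)

lemma bilin_cong: "(\<And>i. i < d \<Longrightarrow> x i = x' i) \<Longrightarrow> (\<And>i. i < d \<Longrightarrow> y i = y' i) \<Longrightarrow> bilin d A x y = bilin d A x' y'"
  by (simp add: bilin_def)

lemma ip_self_eq_0: "ip d x x = 0 \<Longrightarrow> i < d \<Longrightarrow> x i = 0"
  by (simp add: ip_def sum_nonneg_eq_0_iff)

lemma ip_self_nonneg: "ip d x x \<ge> 0"
  by (simp add: ip_def sum_nonneg)

lemma bilin_lincomb_right: "bilin d A x (\<lambda>i. a * y i + b * z i) = a * bilin d A x y + b * bilin d A x z"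
  by (simp add: bilin_def algebra_simps sum.distrib sum_distrib_left)

lemma bilin_scale_right: "bilin d A x (\<lambda>i. y i / c) = bilin d A x y / c"
  by (simp add: bilin_def sum_divide_distrib)

definition antisymmetric_mat :: "nat \<Rightarrow> real mat \<Rightarrow> bool" where
  "antisymmetric_mat d A \<longleftrightarrow> A \<in> carrier_mat d d \<and> (\<forall>i<d. \<forall>j<d. A $$ (i, j) = - A $$ (j, i))"

lemma bilin_antisym:
  assumes "antisymmetric_mat d A"
  shows "bilin d A x y = - bilin d A y x"
proof -
  have "bilin d A x y = (\<Sum>j<d. \<Sum>i<d. x i * A $$ (i, j) * y j)"
    unfolding bilin_def by (rule sum.swap)
  also have "\<dots> = (\<Sum>j<d. \<Sum>i<d. - (y j * A $$ (j, i) * x i))"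
  proof (intro sum.cong refl)
    fix i j assume "j \<in> {..<d}" "i \<in> {..<d}"
    then have "A $$ (i, j) = - A $$ (j, i)"
      using assms unfolding antisymmetric_mat_def by blast
    then show "x i * A $$ (i, j) * y j = - (y j * A $$ (j, i) * x i)" by simp
  qed
  finally show ?thesis by (simp add: bilin_def sum_negf)
qed

text \<open>Fewer linear conditions than dimensions: padded with zero rows to a square matrix they
  have determinant 0, and a kernel vector is normalized. The \<open>e j\<close> may be arbitrary,
  which the dimension count further below uses with rows of two different matrices.\<close>

lemma exists_orthogonal_unit:
  assumes "m < d"
  shows "\<exists>x. ip d x x = 1 \<and> (\<forall>j<m. ip d (e j) x = 0)"
proof -
  let ?B = "mat\<^sub>r d d (\<lambda>i. if i = m then 0\<^sub>v d else if i < m then vec d (e i) else 0\<^sub>v d) :: real mat"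
  have B: "?B \<in> carrier_mat d d" by simp
  have "det ?B = 0"
    using assms by (intro det_row_0[of m d "\<lambda>i. if i < m then vec d (e i) else 0\<^sub>v d"]) auto
  then obtain v where v: "v \<in> carrier_vec d" "v \<noteq> 0\<^sub>v d" "?B *\<^sub>v v = 0\<^sub>v d"
    using det_0_iff_vec_prod_zero_field[OF B] by blast
  define y where "y i = v $ i" for i
  have y: "ip d (e j) y = 0" if "j < m" for j
  proof -
    have "(?B *\<^sub>v v) $ j = 0" using v(3) that assms by simp
    then show ?thesis
      using that assms v(1) by (auto simp: ip_def y_def scalar_prod_def lessThan_atLeast0)
  qed
  have "ip d y y \<noteq> 0"
  proof
    assume "ip d y y = 0"
    then have "v = 0\<^sub>v d" using v(1) ip_self_eq_0[of d y] by (intro eq_vecI) (auto simp: y_def)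
    with v(2) show False by simp
  qed
  then have pos: "ip d y y > 0" using ip_self_nonneg[of d y] by simp
  have "ip d (\<lambda>i. y i / sqrt (ip d y y)) (\<lambda>i. y i / sqrt (ip d y y)) = 1"
    using pos by (simp add: ip_scale)
  moreover have "\<forall>j<m. ip d (e j) (\<lambda>i. y i / sqrt (ip d y y)) = 0"
    using y by (simp add: ip_scale)
  ultimately show ?thesis by blast
qed

definition orthonormal_pair :: "nat \<Rightarrow> (nat \<Rightarrow> nat \<Rightarrow> real) \<Rightarrow> nat \<Rightarrow> (nat \<Rightarrow> real) \<Rightarrow> (nat \<Rightarrow> real) \<Rightarrow> bool" where
  "orthonormal_pair d e m x y \<longleftrightarrow> ip d x x = 1 \<and> ip d y y = 1 \<and> ip d x y = 0 \<and>
     (\<forall>j<m. ip d (e j) x = 0 \<and> ip d (e j) y = 0)"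

lemma orthonormal_pair_cong:
  assumes "\<And>i. i < d \<Longrightarrow> x i = x' i" "\<And>i. i < d \<Longrightarrow> y i = y' i"
  shows "orthonormal_pair d e m x y = orthonormal_pair d e m x' y'"
  unfolding orthonormal_pair_def
  using ip_cong[of d x x' x x'] ip_cong[of d y y' y y'] ip_cong[of d x x' y y'] ip_cong[of d _ _ x x'] ip_cong[of d _ _ y y'] assms
  by auto

text \<open>A continuous form attains its maximum on a compact set. Two free dimensions beyond the
  \<open>m\<close> constraints make that set nonempty.\<close>

lemma exists_maximal_orthonormal_pair:
  assumes "m + 2 \<le> d"
  shows "\<exists>x y. orthonormal_pair d e m x y \<and> (\<forall>x' y'. orthonormal_pair d e m x' y' \<longrightarrow> bilin d A x' y' \<le> bilin d A x y)"
proof -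
  \<comment> \<open>Compact as a product of compact factors (Tychonoff); pinning the coordinates
    from \<open>d\<close> on to 0 is what makes all factors compact.\<close>
  define K :: "(nat \<Rightarrow> real) set" where "K = PiE UNIV (\<lambda>i. if i < d then {-1..1} else {0})"
  have K: "compact K"
    using compactin_PiE[of "\<lambda>i. euclidean :: real topology" UNIV "\<lambda>i. if i < d then {-1..1} else {0}"]
    by (simp add: K_def euclidean_product_topology)
  have cont: "continuous_on UNIV (\<lambda>p :: (nat \<Rightarrow> real) \<times> (nat \<Rightarrow> real). fst p i)"
      "continuous_on UNIV (\<lambda>p :: (nat \<Rightarrow> real) \<times> (nat \<Rightarrow> real). snd p i)" for i
    by (rule continuous_on_compose2[OF continuous_on_product_coordinates], auto intro: continuous_intros)+
  have closed: "closed {p. orthonormal_pair d e m (fst p) (snd p)}"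
    unfolding orthonormal_pair_def ip_def
    by (intro closed_Collect_conj closed_Collect_all closed_Collect_imp closed_Collect_eq open_Collect_const continuous_intros cont)
  define S where "S = (K \<times> K) \<inter> {p. orthonormal_pair d e m (fst p) (snd p)}"
  have "compact S"
    unfolding S_def using compact_Times[OF K K] closed by (rule compact_Int_closed)
  \<comment> \<open>Zeroing the coordinates from \<open>d\<close> on changes neither the constraints
    nor the form, so maximality on the compact set extends to all admissible pairs.\<close>
  moreover have trunc: "(\<lambda>i. if i < d then x i else 0, \<lambda>i. if i < d then y i else 0) \<in> S"
    if xy: "orthonormal_pair d e m x y" for x y
  proof -
    have "\<bar>z i\<bar> \<le> 1" if "ip d z z = 1" "i < d" for z i
    proof -
      have "(z i)\<^sup>2 \<le> (\<Sum>j<d. (z j)\<^sup>2)"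
        using that by (intro member_le_sum) auto
      then show ?thesis
        using that by (simp add: ip_def power2_eq_square abs_le_square_iff[of _ 1, simplified])
    qed
    then have "\<bar>x i\<bar> \<le> 1 \<and> \<bar>y i\<bar> \<le> 1" if "i < d" for i
      using xy that unfolding orthonormal_pair_def by blast
    then have "(\<lambda>i. if i < d then x i else 0) \<in> K" "(\<lambda>i. if i < d then y i else 0) \<in> K"
      unfolding K_def by (auto simp: abs_le_iff minus_le_iff)
    moreover have "orthonormal_pair d e m (\<lambda>i. if i < d then x i else 0) (\<lambda>i. if i < d then y i else 0)"
      using xy orthonormal_pair_cong[of d x "\<lambda>i. if i < d then x i else 0" y "\<lambda>i. if i < d then y i else 0"] by simp
    ultimately show ?thesis by (simp add: S_def)
  qed
  moreover have "S \<noteq> {}"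
  proof -
    obtain x where x: "ip d x x = 1" "\<forall>j<m. ip d (e j) x = 0"
      using exists_orthogonal_unit[of m d e] assms by auto
    \<comment> \<open>The first vector is appended as constraint number \<open>m\<close>, which
      makes the second one orthogonal to it.\<close>
    obtain y where y: "ip d y y = 1" "\<forall>j<Suc m. ip d ((e(m := x)) j) y = 0"
      using exists_orthogonal_unit[of "Suc m" d "e(m := x)"] assms by auto
    have "orthonormal_pair d e m x y"
      unfolding orthonormal_pair_def using x y(1) y(2)[rule_format, of m] y(2)
      by (auto dest: less_SucI)
    then show ?thesis using trunc by blast
  qed
  moreover have "continuous_on S (\<lambda>p. bilin d A (fst p) (snd p))"
    unfolding bilin_def
    by (intro continuous_intros continuous_on_subset[OF cont(1)] continuous_on_subset[OF cont(2)]) auto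
  ultimately obtain p where p: "p \<in> S" "\<forall>q\<in>S. bilin d A (fst q) (snd q) \<le> bilin d A (fst p) (snd p)"
    using continuous_attains_sup[of S] by blast
  have "bilin d A x' y' \<le> bilin d A (fst p) (snd p)" if "orthonormal_pair d e m x' y'" for x' y'
  proof -
    have "bilin d A x' y' = bilin d A (\<lambda>i. if i < d then x' i else 0) (\<lambda>i. if i < d then y' i else 0)"
      by (rule bilin_cong) auto
    then show ?thesis using p(2) trunc[OF that] by fastforce
  qed
  moreover have "orthonormal_pair d e m (fst p) (snd p)" using p(1) by (simp add: S_def)
  ultimately show ?thesis by blast
qed

text \<open>On the unit circle \<open>c * a + s * b\<close> reaches the length of (a, b), in the
  direction of (a, b) itself; if this does not exceed \<open>a\<close>, then \<open>b\<close>
  vanishes. It serves as a first-order optimality condition without derivatives.\<close>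

lemma rotation_maximal_imp_zero:
  fixes a b :: real
  assumes "a \<ge> 0" and max: "\<And>c s. c\<^sup>2 + s\<^sup>2 = 1 \<Longrightarrow> c * a + s * b \<le> a"
  shows "b = 0"
proof (cases "a\<^sup>2 + b\<^sup>2 = 0")
  case True
  then show ?thesis by (simp add: sum_power2_eq_zero_iff)
next
  case False
  define r where "r = sqrt (a\<^sup>2 + b\<^sup>2)"
  have r: "r > 0" "r\<^sup>2 = a\<^sup>2 + b\<^sup>2"
    using False by (auto simp: r_def sum_power2_gt_zero_iff sum_power2_eq_zero_iff)
  have "a / r * a + b / r * b \<le> a"
    using r False by (intro max) (simp add: power_divide flip: add_divide_distrib)
  also have "a / r * a + b / r * b = (a\<^sup>2 + b\<^sup>2) / r"
    by (simp add: power2_eq_square add_divide_distrib)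
  also have "\<dots> = r\<^sup>2 / r"
    using r(2) by simp
  finally have "r \<le> a" using r(1) by (simp add: power2_eq_square)
  then have "r\<^sup>2 \<le> a\<^sup>2" using r(1) by (intro power_mono) auto
  then show ?thesis using r(2) by simp
qed

text \<open>Swapping the pair flips the sign of the form, hence the maximum is nonnegative. Rotating
  one member of the pair towards a unit vector orthogonal to everything keeps the pair admissible,
  so optimality kills the form on that vector.\<close>

lemma maximal_pair_annihilates:
  assumes A: "antisymmetric_mat d A"
    and xy: "orthonormal_pair d e m x y"
    and max: "\<And>x' y'. orthonormal_pair d e m x' y' \<Longrightarrow> bilin d A x' y' \<le> bilin d A x y"
  shows "bilin d A x y \<ge> 0"
    and "(\<And>j. j < m \<Longrightarrow> ip d (e j) z = 0) \<Longrightarrow> ip d x z = 0 \<Longrightarrow> ip d y z = 0 \<Longrightarrow> bilin d A x z = 0 \<and> bilin d A y z = 0"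
proof -
  have "orthonormal_pair d e m y x"
    using xy by (auto simp: orthonormal_pair_def ip_commute)
  then show nonneg: "bilin d A x y \<ge> 0"
    using max[of y x] bilin_antisym[OF A, of x y] by simp
  assume z: "\<And>j. j < m \<Longrightarrow> ip d (e j) z = 0" "ip d x z = 0" "ip d y z = 0"
  show "bilin d A x z = 0 \<and> bilin d A y z = 0"
  proof (cases "ip d z z = 0")
    case True
    then have "bilin d A u z = bilin d A u (\<lambda>i. 0)" for u
      using ip_self_eq_0[OF True] by (intro bilin_cong) auto
    then show ?thesis by (simp add: bilin_def)
  next
    case False
    then have pos: "ip d z z > 0" using ip_self_nonneg[of d z] by simp
    define w where "w i = z i / sqrt (ip d z z)" for i
    have w: "ip d w w = 1" "ip d x w = 0" "ip d y w = 0" "ip d w x = 0" "ip d w y = 0" "\<And>j. j < m \<Longrightarrow> ip d (e j) w = 0"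
      using pos z z(2,3)[unfolded ip_commute[of d _ z]] unfolding w_def by (simp_all add: ip_scale)
    have o: "ip d x x = 1" "ip d y y = 1" "ip d x y = 0" "ip d y x = 0" "\<And>j. j < m \<Longrightarrow> ip d (e j) x = 0" "\<And>j. j < m \<Longrightarrow> ip d (e j) y = 0"
      using xy by (auto simp: orthonormal_pair_def ip_commute)
    have "bilin d A x w = 0"
    proof (rule rotation_maximal_imp_zero[OF nonneg])
      fix c s :: real assume cs: "c\<^sup>2 + s\<^sup>2 = 1"
      have "orthonormal_pair d e m x (\<lambda>i. c * y i + s * w i)"
        unfolding orthonormal_pair_def ip_lincomb_right ip_lincomb_left
        using cs w o by (simp add: power2_eq_square)
      from max[OF this] show "c * bilin d A x y + s * bilin d A x w \<le> bilin d A x y"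
        by (simp only: bilin_lincomb_right)
    qed
    moreover have "bilin d A y w = 0"
    proof -
      have "- bilin d A y w = 0"
      proof (rule rotation_maximal_imp_zero[OF nonneg])
        fix c s :: real assume cs: "c\<^sup>2 + s\<^sup>2 = 1"
        have "orthonormal_pair d e m (\<lambda>i. c * x i + s * w i) y"
          unfolding orthonormal_pair_def ip_lincomb_right ip_lincomb_left
          using cs w o by (simp add: power2_eq_square)
        from max[OF this] have "- bilin d A y (\<lambda>i. c * x i + s * w i) \<le> bilin d A x y"
          using bilin_antisym[OF A, of y "\<lambda>i. c * x i + s * w i"] by linarith
        then show "c * bilin d A x y + s * - bilin d A y w \<le> bilin d A x y"
          unfolding bilin_lincomb_right using bilin_antisym[OF A, of y x] by simp
      qed
      then show ?thesis by simp
    qed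
    ultimately show ?thesis
      using pos unfolding w_def by (simp add: bilin_scale_right)
  qed
qed

text \<open>
  Greedy choice of a basis: each new pair maximizes the bilinear form among the orthonormal pairs
  orthogonal to the earlier ones, which makes the form vanish between it and everything orthogonal to it.
\<close>

definition maximal_pairs :: "nat \<Rightarrow> real mat \<Rightarrow> nat \<Rightarrow> (nat \<Rightarrow> nat \<Rightarrow> real) \<Rightarrow> (nat \<Rightarrow> real) \<Rightarrow> bool" where
  "maximal_pairs d A k e l \<longleftrightarrow>
    (\<forall>i<2 * k. \<forall>j<2 * k. ip d (e i) (e j) = (if i = j then 1 else 0)) \<and>
    (\<forall>i<k. bilin d A (e (2 * i)) (e (2 * i + 1)) = l i \<and> 0 \<le> l i) \<and>
    (\<forall>j<2 * k. \<forall>z. (\<forall>i<2 * k. ip d (e i) z = 0) \<longrightarrow> bilin d A (e j) z = 0) \<and>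
    (\<forall>i<2 * k. \<forall>j<2 * k. i div 2 \<noteq> j div 2 \<longrightarrow> bilin d A (e i) (e j) = 0) \<and>
    (\<forall>i<k. \<forall>j<i. l i \<le> l j) \<and>
    (\<forall>i<k. \<forall>x y. orthonormal_pair d e (2 * k) x y \<longrightarrow> bilin d A x y \<le> l i)"

text \<open>The last clause of \<open>maximal_pairs\<close> carries the induction: it bounds the
  form on every remaining pair by each earlier value, which gives the decreasing order when the next
  maximum is appended.\<close>

lemma exists_maximal_pairs:
  assumes A: "antisymmetric_mat d A" and "2 * k \<le> d"
  shows "\<exists>e l. maximal_pairs d A k e l"
  using assms(2)
proof (induction k)
  case 0
  show ?case by (simp add: maximal_pairs_def)
next
  case (Suc k)
  then obtain e l where IH: "maximal_pairs d A k e l"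
    by fastforce
  note orth = IH[unfolded maximal_pairs_def, THEN conjunct1, rule_format]
  note diag = IH[unfolded maximal_pairs_def, THEN conjunct2, THEN conjunct1, rule_format]
  note ann = IH[unfolded maximal_pairs_def, THEN conjunct2, THEN conjunct2, THEN conjunct1, rule_format]
  note off = IH[unfolded maximal_pairs_def, THEN conjunct2, THEN conjunct2, THEN conjunct2, THEN conjunct1, rule_format]
  note dec = IH[unfolded maximal_pairs_def, THEN conjunct2, THEN conjunct2, THEN conjunct2, THEN conjunct2, THEN conjunct1, rule_format]
  note bound = IH[unfolded maximal_pairs_def, THEN conjunct2, THEN conjunct2, THEN conjunct2, THEN conjunct2, THEN conjunct2, rule_format]
  obtain x y where xy: "orthonormal_pair d e (2 * k) x y"
    and max: "\<And>x' y'. orthonormal_pair d e (2 * k) x' y' \<Longrightarrow> bilin d A x' y' \<le> bilin d A x y"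
    using exists_maximal_orthonormal_pair[of "2 * k" d e A] Suc.prems by auto
  define e' where "e' = e(2 * k := x, 2 * k + 1 := y)"
  define l' where "l' = l(k := bilin d A x y)"
  have e': "e' (2 * k) = x" "e' (Suc (2 * k)) = y" "\<And>i. i < 2 * k \<Longrightarrow> e' i = e i"
    by (auto simp: e'_def)
  have l': "l' k = bilin d A x y" "\<And>i. i < k \<Longrightarrow> l' i = l i"
    by (auto simp: l'_def)
  have o: "ip d x x = 1" "ip d y y = 1" "ip d x y = 0" "ip d y x = 0"
    "\<And>j. j < 2 * k \<Longrightarrow> ip d (e j) x = 0" "\<And>j. j < 2 * k \<Longrightarrow> ip d (e j) y = 0"
    "\<And>j. j < 2 * k \<Longrightarrow> ip d x (e j) = 0" "\<And>j. j < 2 * k \<Longrightarrow> ip d y (e j) = 0"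
    using xy by (auto simp: orthonormal_pair_def ip_commute)
  have cases: "i < 2 * k \<or> i = 2 * k \<or> i = Suc (2 * k)" if "i < 2 * Suc k" for i
    using that by auto
  \<comment> \<open>More constraints leave fewer admissible pairs, so earlier maxima still bound the
    later ones.\<close>
  have pair_mono: "orthonormal_pair d e (2 * k) x' y'" if "orthonormal_pair d e' (2 * Suc k) x' y'" for x' y'
    using that e'(3) unfolding orthonormal_pair_def by (metis less_SucI mult_Suc_right add_2_eq_Suc)
  have new: "bilin d A x (e j) = 0" "bilin d A y (e j) = 0" "bilin d A (e j) x = 0" "bilin d A (e j) y = 0"
    if "j < 2 * k" for j
    using ann[OF that, of x] ann[OF that, of y] o bilin_antisym[OF A, of _ "e j"] by auto
  have "maximal_pairs d A (Suc k) e' l'"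
    unfolding maximal_pairs_def
  proof (intro conjI allI impI)
    fix i j assume "i < 2 * Suc k" "j < 2 * Suc k"
    then show "ip d (e' i) (e' j) = (if i = j then 1 else 0)"
      using cases[of i] cases[of j] o orth e' by auto
  next
    fix i assume "i < Suc k"
    then show "bilin d A (e' (2 * i)) (e' (2 * i + 1)) = l' i" "0 \<le> l' i"
      using diag[of i] maximal_pair_annihilates(1)[OF A xy max] e' l' by (cases "i = k"; force)+
  next
    fix j z assume j: "j < 2 * Suc k" and z: "\<forall>i<2 * Suc k. ip d (e' i) z = 0"
    have z1: "ip d (e i) z = 0" if "i < 2 * k" for i
      using z[rule_format, of i] e'(3)[OF that] that by simp
    have z': "\<And>i. i < 2 * k \<Longrightarrow> ip d (e i) z = 0" "ip d x z = 0" "ip d y z = 0"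
      using z[rule_format, of "2 * k"] z[rule_format, of "Suc (2 * k)"] z1 e' by auto
    show "bilin d A (e' j) z = 0"
      using cases[OF j] ann[of j z] z' maximal_pair_annihilates(2)[OF A xy max z'] e' by auto
  next
    fix i j assume "i < 2 * Suc k" "j < 2 * Suc k" "i div 2 \<noteq> j div 2"
    then show "bilin d A (e' i) (e' j) = 0"
      using cases[of i] cases[of j] off[of i j] new e' by auto
  next
    fix i j assume "i < Suc k" "j < i"
    then show "l' i \<le> l' j"
      using dec[of i j] bound[of j x y] xy l' by (cases "i = k") auto
  next
    fix i x' y' assume "i < Suc k" "orthonormal_pair d e' (2 * Suc k) x' y'"
    then show "bilin d A x' y' \<le> l' i"
      using pair_mono bound[of i x' y'] max[of x' y'] l' by (cases "i = k") auto
  qed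
  then show ?case by blast
qed

text \<open>Indices \<open>2 * p\<close> and \<open>2 * p + 1\<close> belong to qubit
  \<open>p\<close>. The signs are chosen such that for a correlation matrix the entry
  \<open>(2 * p, 2 * p + 1)\<close>, here \<open>l p\<close>, is the expectation of Z on that
  qubit.\<close>

definition normal_form :: "nat \<Rightarrow> (nat \<Rightarrow> real) \<Rightarrow> real mat" where
  "normal_form n l = mat (2 * n) (2 * n)
     (\<lambda>(i, j). if i div 2 \<noteq> j div 2 \<or> i = j then 0 else if even i then l (i div 2) else - l (i div 2))"

lemma normal_form_carrier [simp]: "normal_form n l \<in> carrier_mat (2 * n) (2 * n)"
  by (simp add: normal_form_def)

lemma mat_conj_index:
  fixes Q A :: "real mat"
  assumes "Q \<in> carrier_mat d d" "A \<in> carrier_mat d d" "i < d" "j < d"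
  shows "(Q * A * transpose_mat Q) $$ (i, j) = bilin d A (\<lambda>k. Q $$ (i, k)) (\<lambda>k. Q $$ (j, k))"
proof -
  have "(Q * A * transpose_mat Q) $$ (i, j) = (Q * (A * transpose_mat Q)) $$ (i, j)"
    using assms by (subst assoc_mult_mat[of _ d d _ d _ d]) auto
  also have "\<dots> = (\<Sum>a<d. Q $$ (i, a) * (\<Sum>b<d. A $$ (a, b) * Q $$ (j, b)))"
    using assms by (auto simp: scalar_prod_def lessThan_atLeast0)
  also have "\<dots> = bilin d A (\<lambda>k. Q $$ (i, k)) (\<lambda>k. Q $$ (j, k))"
    by (simp add: bilin_def sum_distrib_left mult.assoc)
  finally show ?thesis .
qed

text \<open>The greedy basis, used as the rows of \<open>Q\<close>, makes the form vanish between
  different pairs, so only the blocks within pairs survive.\<close>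

theorem antisymmetric_normal_form:
  assumes A: "antisymmetric_mat (2 * n) A"
  shows "\<exists>Q l. real_orthogonal_mat (2 * n) Q \<and> Q * A * transpose_mat Q = normal_form n l \<and>
    (\<forall>p<n. 0 \<le> l p) \<and> (\<forall>p q. p \<le> q \<longrightarrow> q < n \<longrightarrow> l p \<le> l q)"
proof -
  let ?d = "2 * n"
  have Ac: "A \<in> carrier_mat ?d ?d" using A by (simp add: antisymmetric_mat_def)
  obtain e l where el: "maximal_pairs ?d A n e l"
    using exists_maximal_pairs[OF A, of n] by auto
  note orth = el[unfolded maximal_pairs_def, THEN conjunct1, rule_format]
  note diag = el[unfolded maximal_pairs_def, THEN conjunct2, THEN conjunct1, rule_format]
  note off = el[unfolded maximal_pairs_def, THEN conjunct2, THEN conjunct2, THEN conjunct2, THEN conjunct1, rule_format]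
  note dec = el[unfolded maximal_pairs_def, THEN conjunct2, THEN conjunct2, THEN conjunct2, THEN conjunct2, THEN conjunct1, rule_format]
  \<comment> \<open>Reverses the order of the pairs but not the order within a pair: the greedy
    values decrease, whereas the normal form lists them increasingly.\<close>
  define r where "r i = 2 * (n - 1 - i div 2) + i mod 2" for i
  have r_less: "r i < ?d" if "i < ?d" for i
    using that unfolding r_def by (cases "even i") auto
  have r_div: "r i div 2 = n - 1 - i div 2" and r_mod: "r i mod 2 = i mod 2" for i
    by (simp_all add: r_def)
  have r_div_eq: "r i div 2 = r j div 2 \<longleftrightarrow> i div 2 = j div 2" if "i < ?d" "j < ?d" for i j
    using that unfolding r_div by auto
  have r_inj: "r i = r j \<longleftrightarrow> i = j" if "i < ?d" "j < ?d" for i j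
    using r_div_eq[OF that] r_mod by (metis div_mult_mod_eq)
  define Q where "Q = mat ?d ?d (\<lambda>(i, k). e (r i) k)"
  have Q: "Q \<in> carrier_mat ?d ?d" by (simp add: Q_def)
  have row: "ip ?d (\<lambda>k. Q $$ (i, k)) (\<lambda>k. Q $$ (j, k)) = ip ?d (e (r i)) (e (r j))"
    "bilin ?d A (\<lambda>k. Q $$ (i, k)) (\<lambda>k. Q $$ (j, k)) = bilin ?d A (e (r i)) (e (r j))" if "i < ?d" "j < ?d" for i j
    using that by (auto simp: Q_def intro!: ip_cong bilin_cong)
  have "real_orthogonal_mat ?d Q"
    unfolding real_orthogonal_mat_rows using Q row(1) orth r_less r_inj by (simp add: ip_def)
  moreover have "Q * A * transpose_mat Q = normal_form n (\<lambda>p. l (n - 1 - p))"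
  proof (rule eq_matI)
    fix i j assume "i < dim_row (normal_form n (\<lambda>p. l (n - 1 - p)))" "j < dim_col (normal_form n (\<lambda>p. l (n - 1 - p)))"
    then have ij: "i < ?d" "j < ?d" by (auto simp: normal_form_def)
    have "bilin ?d A (e (r i)) (e (r j)) = normal_form n (\<lambda>p. l (n - 1 - p)) $$ (i, j)"
    proof (cases "i div 2 = j div 2")
      case False
      then show ?thesis using off[of "r i" "r j"] ij r_less r_div_eq by (auto simp: normal_form_def)
    next
      case True
      define p where "p = n - 1 - i div 2"
      have p: "p < n" using ij by (simp add: p_def)
      have ri: "r i = 2 * p + i mod 2" "r j = 2 * p + j mod 2" using True by (simp_all add: r_def p_def)
      have self: "bilin ?d A u u = 0" for u using bilin_antisym[OF A, of u u] by simp
      have pe: "bilin ?d A (e (2 * p)) (e (2 * p + 1)) = l p" "bilin ?d A (e (2 * p + 1)) (e (2 * p)) = - l p"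
        using diag[OF p] bilin_antisym[OF A, of "e (2 * p + 1)" "e (2 * p)"] by auto
      have ij_eq: "i = j \<longleftrightarrow> i mod 2 = j mod 2" using True by (metis div_mult_mod_eq)
      have nf: "normal_form n (\<lambda>p. l (n - 1 - p)) $$ (i, j) = (if i = j then 0 else if even i then l p else - l p)"
        using ij True by (simp add: normal_form_def p_def)
      consider "i = j" | "i \<noteq> j" "i mod 2 = 0" "j mod 2 = 1" | "i \<noteq> j" "i mod 2 = 1" "j mod 2 = 0"
        using ij_eq by linarith
      then show ?thesis
      proof cases
        case 1
        then show ?thesis using self nf by simp
      next
        case 2
        then have "even i" by presburger
        with 2 show ?thesis using pe(1) nf by (simp add: ri)
      next
        case 3
        then have "odd i" by presburger
        with 3 show ?thesis using pe(2) nf by (simp add: ri)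
      qed
    qed
    with ij row(2) show "(Q * A * transpose_mat Q) $$ (i, j) = normal_form n (\<lambda>p. l (n - 1 - p)) $$ (i, j)"
      by (simp add: mat_conj_index[OF Q Ac])
  qed (use Q Ac in \<open>auto simp: normal_form_def\<close>)
  moreover have "l (n - 1 - p) \<le> l (n - 1 - q)" if "p \<le> q" "q < n" for p q
    using dec[of "n - 1 - p" "n - 1 - q"] that by (cases "p = q") auto
  moreover have "0 \<le> l (n - 1 - p)" if "p < n" for p
    using diag[of "n - 1 - p"] that by auto
  ultimately show ?thesis by blast
qed

subsection \<open>Normal eigenvalues\<close>

lemma sum_pairs: "(\<Sum>i<2 * n. f i) = (\<Sum>p<n. f (2 * p) + f (2 * p + 1))" for f :: "nat \<Rightarrow> 'a::comm_monoid_add"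
  by (induction n) (simp_all add: add.assoc)

lemma prod_list_pairs:
  "prod_list (map f [0..<2 * n]) = prod_list (map (\<lambda>p. f (2 * p) * f (2 * p + 1)) [0..<n])"
  for f :: "nat \<Rightarrow> 'a::comm_monoid_mult"
  by (induction n) (simp_all add: mult.assoc)

definition partner :: "nat \<Rightarrow> nat" where
  "partner i = (if even i then i + 1 else i - 1)"

lemma partner_simps [simp]: "partner (2 * m) = 2 * m + 1" "partner (Suc (2 * m)) = 2 * m"
  by (simp_all add: partner_def)

lemma nat_parity_cases:
  fixes i :: nat
  obtains m where "i = 2 * m" | m where "i = Suc (2 * m)"
  by (cases "even i") (auto elim!: evenE oddE)

lemma partner_less: "i < 2 * n \<Longrightarrow> partner i < 2 * n"
  by (rule nat_parity_cases[of i]) auto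

lemma partner_div: "partner i div 2 = i div 2"
  by (rule nat_parity_cases[of i]) auto

lemma partner_even: "even (partner i) \<longleftrightarrow> odd i"
  by (rule nat_parity_cases[of i]) auto

lemma eq_partner_iff: "j = partner i \<longleftrightarrow> j \<noteq> i \<and> j div 2 = i div 2"
proof (rule nat_parity_cases[of i])
  fix m assume "i = 2 * m"
  moreover have "j = 2 * m + 1 \<longleftrightarrow> j \<noteq> 2 * m \<and> j div 2 = m" by linarith
  ultimately show ?thesis by simp
next
  fix m assume "i = Suc (2 * m)"
  moreover have "j = 2 * m \<longleftrightarrow> j \<noteq> Suc (2 * m) \<and> j div 2 = m" by linarith
  ultimately show ?thesis by simp
qed

lemma normal_form_index:
  assumes "i < 2 * n" "j < 2 * n"
  shows "normal_form n l $$ (i, j) = (if j = partner i then (if even i then l (i div 2) else - l (i div 2)) else 0)"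
  using assms eq_partner_iff[of j i] by (auto simp: normal_form_def)

section \<open>Euclidean norms and the dimension count\<close>

definition mv :: "nat \<Rightarrow> real mat \<Rightarrow> (nat \<Rightarrow> real) \<Rightarrow> nat \<Rightarrow> real" where
  "mv d A x i = (\<Sum>j<d. A $$ (i, j) * x j)"

definition nrm :: "nat \<Rightarrow> (nat \<Rightarrow> real) \<Rightarrow> real" where
  "nrm d x = L2_set x {..<d}"

lemma nrm_nonneg: "0 \<le> nrm d x"
  by (simp add: nrm_def)

lemma nrm_cong: "(\<And>i. i < d \<Longrightarrow> x i = y i) \<Longrightarrow> nrm d x = nrm d y"
  by (simp add: nrm_def L2_set_def)

lemma nrm_square: "(nrm d x)\<^sup>2 = (\<Sum>i<d. (x i)\<^sup>2)"
  by (simp add: nrm_def L2_set_def sum_nonneg)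

lemma mv_mult:
  assumes "A \<in> carrier_mat d d" "B \<in> carrier_mat d d" "i < d"
  shows "mv d (A * B) x i = mv d A (mv d B x) i"
proof -
  have "mv d (A * B) x i = (\<Sum>j<d. \<Sum>k<d. A $$ (i, k) * (B $$ (k, j) * x j))"
    using assms by (auto simp: mv_def scalar_prod_def lessThan_atLeast0 sum_distrib_right mult.assoc)
  also have "\<dots> = mv d A (mv d B x) i"
    by (subst sum.swap) (simp add: mv_def sum_distrib_left)
  finally show ?thesis .
qed

lemma nrm_mv_orthogonal:
  assumes "real_orthogonal_mat d Q"
  shows "nrm d (mv d Q x) = nrm d x"
proof -
  have orth: "(\<Sum>i<d. Q $$ (i, j) * Q $$ (i, k)) = (if j = k then 1 else 0)" if "j < d" "k < d" for j k
    using assms that by (simp add: real_orthogonal_mat_cols)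
  have "(nrm d (mv d Q x))\<^sup>2 = (\<Sum>i<d. (mv d Q x i)\<^sup>2)"
    by (rule nrm_square)
  also have "\<dots> = (\<Sum>i<d. \<Sum>j<d. \<Sum>k<d. x j * x k * (Q $$ (i, j) * Q $$ (i, k)))"
    unfolding mv_def power2_eq_square sum_product by (intro sum.cong refl) (simp add: ac_simps)
  also have "\<dots> = (\<Sum>j<d. \<Sum>i<d. \<Sum>k<d. x j * x k * (Q $$ (i, j) * Q $$ (i, k)))"
    by (rule sum.swap)
  also have "\<dots> = (\<Sum>j<d. \<Sum>k<d. \<Sum>i<d. x j * x k * (Q $$ (i, j) * Q $$ (i, k)))"
    by (rule sum.cong[OF refl], rule sum.swap)
  also have "\<dots> = (\<Sum>j<d. \<Sum>k<d. x j * x k * (\<Sum>i<d. Q $$ (i, j) * Q $$ (i, k)))"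
    by (simp only: sum_distrib_left)
  also have "\<dots> = (\<Sum>j<d. \<Sum>k<d. if j = k then x j * x k else 0)"
    by (intro sum.cong refl) (auto simp: orth)
  also have "\<dots> = (nrm d x)\<^sup>2"
    unfolding nrm_square by (simp add: power2_eq_square)
  finally show ?thesis
    using nrm_nonneg by (simp add: power2_eq_iff_nonneg)
qed

lemma mv_normal_form:
  assumes "i < 2 * n"
  shows "mv (2 * n) (normal_form n l) y i = (if even i then 1 else - 1) * (l (i div 2) * y (partner i))"
  using assms partner_less[OF assms]
  by (simp add: mv_def normal_form_index if_distrib[of "\<lambda>a. a * _"] cong: if_cong)

lemma nrm_normal_form:
  "(nrm (2 * n) (mv (2 * n) (normal_form n l) y))\<^sup>2 = (\<Sum>i<2 * n. (l (i div 2))\<^sup>2 * (y i)\<^sup>2)"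
proof -
  have "(nrm (2 * n) (mv (2 * n) (normal_form n l) y))\<^sup>2 = (\<Sum>i<2 * n. (l (i div 2))\<^sup>2 * (y (partner i))\<^sup>2)"
    unfolding nrm_square by (intro sum.cong refl) (auto simp: mv_normal_form power_mult_distrib)
  also have "\<dots> = (\<Sum>i<2 * n. (l (i div 2))\<^sup>2 * (y i)\<^sup>2)"
    unfolding sum_pairs by (simp add: add.commute)
  finally show ?thesis .
qed

text \<open>A normal form exchanges the coordinates of each pair and scales them by
  \<open>l p\<close>; a vector supported on the pairs from \<open>t\<close> on only meets factors at
  least \<open>l t\<close>.\<close>

lemma nrm_normal_form_ge:
  assumes l: "\<forall>p<n. 0 \<le> l p" "\<forall>p q. p \<le> q \<longrightarrow> q < n \<longrightarrow> l p \<le> l q" and "t < n"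
    and y: "\<And>i. i < 2 * t \<Longrightarrow> y i = 0"
  shows "l t * nrm (2 * n) y \<le> nrm (2 * n) (mv (2 * n) (normal_form n l) y)"
proof -
  have "(l t * nrm (2 * n) y)\<^sup>2 = (\<Sum>i<2 * n. (l t)\<^sup>2 * (y i)\<^sup>2)"
    by (simp add: power_mult_distrib nrm_square sum_distrib_left)
  also have "\<dots> \<le> (\<Sum>i<2 * n. (l (i div 2))\<^sup>2 * (y i)\<^sup>2)"
  proof (rule sum_mono)
    fix i assume i: "i \<in> {..<2 * n}"
    show "(l t)\<^sup>2 * (y i)\<^sup>2 \<le> (l (i div 2))\<^sup>2 * (y i)\<^sup>2"
    proof (cases "i < 2 * t")
      case False
      then have "t \<le> i div 2" "i div 2 < n" using i by auto
      then show ?thesis using l \<open>t < n\<close> by (intro mult_right_mono power_mono) auto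
    qed (simp add: y)
  qed
  finally show ?thesis
    unfolding nrm_normal_form[symmetric] by (rule power2_le_imp_le[OF _ nrm_nonneg])
qed

text \<open>The counterpart for vectors supported on the pairs 0 to \<open>t\<close>, that is on the
  indices below \<open>2 * t + 2\<close>.\<close>

lemma nrm_normal_form_le:
  assumes l: "\<forall>p<n. 0 \<le> l p" "\<forall>p q. p \<le> q \<longrightarrow> q < n \<longrightarrow> l p \<le> l q" and "t < n"
    and y: "\<And>i. 2 * t + 2 \<le> i \<Longrightarrow> i < 2 * n \<Longrightarrow> y i = 0"
  shows "nrm (2 * n) (mv (2 * n) (normal_form n l) y) \<le> l t * nrm (2 * n) y"
proof -
  have "(nrm (2 * n) (mv (2 * n) (normal_form n l) y))\<^sup>2 \<le> (\<Sum>i<2 * n. (l t)\<^sup>2 * (y i)\<^sup>2)"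
    unfolding nrm_normal_form
  proof (rule sum_mono)
    fix i assume i: "i \<in> {..<2 * n}"
    show "(l (i div 2))\<^sup>2 * (y i)\<^sup>2 \<le> (l t)\<^sup>2 * (y i)\<^sup>2"
    proof (cases "2 * t + 2 \<le> i")
      case False
      then have "i div 2 \<le> t" by auto
      then show ?thesis using l \<open>t < n\<close> by (intro mult_right_mono power_mono) auto
    qed (use i y in simp)
  qed
  also have "\<dots> = (l t * nrm (2 * n) y)\<^sup>2"
    by (simp add: power_mult_distrib nrm_square sum_distrib_left)
  finally show ?thesis
    by (rule power2_le_imp_le) (use l(1) \<open>t < n\<close> nrm_nonneg in auto)
qed

text \<open>Since \<open>N * Q = Q * A\<close> and \<open>Q\<close> preserves norms, estimates for
  normal forms transfer to \<open>A\<close> in the rotated coordinates.\<close>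

lemma nrm_mv_conj:
  assumes Q: "real_orthogonal_mat d Q" and A: "A \<in> carrier_mat d d" and N: "Q * A * transpose_mat Q = N"
  shows "nrm d (mv d A x) = nrm d (mv d N (mv d Q x))"
proof -
  note assoc = assoc_mult_mat[of _ d d _ d _ d]
  have c: "Q \<in> carrier_mat d d" "transpose_mat Q \<in> carrier_mat d d" using Q by (auto simp: real_orthogonal_mat_def)
  have Nc: "N \<in> carrier_mat d d" using c A unfolding N[symmetric] by (intro mult_carrier_mat[of _ _ d]) auto
  have "N * Q = Q * A * (transpose_mat Q * Q)"
    unfolding N[symmetric] using c A by (simp add: assoc mult_carrier_mat[of _ d d])
  also have "\<dots> = Q * A"
    using Q c A by (simp add: real_orthogonal_mat_def right_mult_one_mat[of _ d d] mult_carrier_mat[of _ d d])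
  finally have NQ: "N * Q = Q * A" .
  have "nrm d (mv d A x) = nrm d (mv d Q (mv d A x))"
    by (rule nrm_mv_orthogonal[OF Q, symmetric])
  also have "\<dots> = nrm d (mv d N (mv d Q x))"
    by (rule nrm_cong) (simp add: mv_mult[OF c(1) A, symmetric] mv_mult[OF Nc c(1), symmetric] NQ)
  finally show ?thesis .
qed

text \<open>There are 2 t + (2 n - 2 t - 2) = 2 n - 2 linear conditions in dimension 2 n. The
  overlap arises because pair \<open>t\<close> is constrained on neither side.\<close>

lemma exists_common_vector:
  assumes "Q \<in> carrier_mat (2 * n) (2 * n)" "Q' \<in> carrier_mat (2 * n) (2 * n)" "t < n"
  shows "\<exists>x. nrm (2 * n) x = 1 \<and> (\<forall>i<2 * t. mv (2 * n) Q x i = 0) \<and>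
    (\<forall>i. 2 * t + 2 \<le> i \<longrightarrow> i < 2 * n \<longrightarrow> mv (2 * n) Q' x i = 0)"
proof -
  \<comment> \<open>The shift by 2 skips the rows \<open>2 * t\<close> and \<open>2 * t + 1\<close>
    of \<open>Q'\<close>.\<close>
  define e where "e j k = (if j < 2 * t then Q $$ (j, k) else Q' $$ (j + 2, k))" for j k
  obtain x where x: "ip (2 * n) x x = 1" "\<forall>j<2 * n - 2. ip (2 * n) (e j) x = 0"
    using exists_orthogonal_unit[of "2 * n - 2" "2 * n" e] assms by auto
  have "(nrm (2 * n) x)\<^sup>2 = 1"
    unfolding nrm_square using x(1) by (simp add: ip_def power2_eq_square)
  then have "nrm (2 * n) x = 1"
    using nrm_nonneg[of "2 * n" x] by (simp add: power2_eq_1_iff)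
  moreover have "mv (2 * n) Q x i = 0" if "i < 2 * t" for i
    using x(2)[rule_format, of i] that assms by (simp add: ip_def mv_def e_def)
  moreover have "mv (2 * n) Q' x i = 0" if "2 * t + 2 \<le> i" "i < 2 * n" for i
  proof -
    have "i - 2 < 2 * n - 2" "\<not> i - 2 < 2 * t" "i - 2 + 2 = i" using that by auto
    then show ?thesis using x(2)[rule_format, of "i - 2"] by (simp add: ip_def mv_def e_def)
  qed
  ultimately show ?thesis by blast
qed

section \<open>Characteristic polynomial and uniqueness of the normal eigenvalues\<close>

abbreviation normal_poly :: "real list \<Rightarrow> complex poly" where
  "normal_poly ls \<equiv> (\<Prod>x \<leftarrow> ls. [:- (\<i> * complex_of_real x), 1:] * [:\<i> * complex_of_real x, 1:])"

text \<open>Each block is diagonalized by the vectors (1, i) and (1, -i), with eigenvalues i l and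
  -i l. They are orthogonal of squared length 2, which explains the halved adjoint \<open>V\<close>
  as inverse.\<close>

lemma char_poly_normal_form:
  "char_poly (map_mat complex_of_real (normal_form n l)) = normal_poly (map l [0..<n])"
proof -
  let ?d = "2 * n"
  define ev where "ev j = (if even j then \<i> else - \<i>) * complex_of_real (l (j div 2))" for j
  define w where "w i j = (if i div 2 \<noteq> j div 2 then 0 else if even i then 1 else if even j then \<i> else - \<i>)" for i j :: nat
  define W where "W = mat ?d ?d (\<lambda>(i, j). w i j)"
  define V where "V = mat ?d ?d (\<lambda>(i, j). cnj (w j i) / 2)"
  define L where "L = mat ?d ?d (\<lambda>(i, j). if i = j then ev i else 0)"
  let ?N = "map_mat complex_of_real (normal_form n l)"
  have c: "W \<in> carrier_mat ?d ?d" "V \<in> carrier_mat ?d ?d" "L \<in> carrier_mat ?d ?d" "?N \<in> carrier_mat ?d ?d"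
    by (auto simp: W_def V_def L_def)
  have WV: "W * V = 1\<^sub>m ?d"
  proof (rule eq_matI)
    fix i j assume "i < dim_row (1\<^sub>m ?d :: complex mat)" "j < dim_col (1\<^sub>m ?d :: complex mat)"
    then have ij: "i < ?d" "j < ?d" by auto
    have "(W * V) $$ (i, j) = (\<Sum>k<?d. w i k * cnj (w j k) / 2)"
      using ij by (simp add: W_def V_def scalar_prod_def lessThan_atLeast0)
    also have "\<dots> = (\<Sum>p<n. if p = i div 2 then
        (if j div 2 = p then (if even i \<noteq> even j then 0 else 1) else 0) else 0)"
      unfolding sum_pairs by (intro sum.cong refl) (auto simp: w_def)
    also have "\<dots> = (if i div 2 = j div 2 \<and> even i = even j then 1 else 0)"
      using ij by (auto simp: less_mult_imp_div_less mult.commute)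
    also have "i div 2 = j div 2 \<and> even i = even j \<longleftrightarrow> i = j"
      by (metis div_mult_mod_eq parity_cases)
    finally show "(W * V) $$ (i, j) = 1\<^sub>m ?d $$ (i, j)" using ij by simp
  qed (auto simp: W_def V_def)
  have NW: "?N * W = W * L"
  proof (rule eq_matI)
    fix i j assume "i < dim_row (W * L)" "j < dim_col (W * L)"
    then have ij: "i < ?d" "j < ?d" by (auto simp: W_def L_def)
    have "(?N * W) $$ (i, j) = (\<Sum>k<?d. complex_of_real (normal_form n l $$ (i, k)) * w k j)"
      using ij c by (auto simp: W_def scalar_prod_def lessThan_atLeast0 normal_form_def intro!: sum.cong)
    also have "\<dots> = (\<Sum>k<?d. if k = partner i then (if even i then 1 else - 1) * complex_of_real (l (i div 2)) * w k j else 0)"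
      using ij by (intro sum.cong refl) (auto simp: normal_form_index)
    also have "\<dots> = (if even i then 1 else - 1) * complex_of_real (l (i div 2)) * w (partner i) j"
      using partner_less[OF ij(1)] by simp
    also have "\<dots> = w i j * ev j"
      unfolding w_def ev_def partner_div partner_even by (cases "i div 2 = j div 2") auto
    also have "\<dots> = (\<Sum>k<?d. if k = j then w i k * ev k else 0)"
      using ij by simp
    also have "\<dots> = (\<Sum>k<?d. w i k * (if k = j then ev k else 0))"
      by (intro sum.cong) auto
    also have "\<dots> = (W * L) $$ (i, j)"
      using ij by (simp add: W_def L_def scalar_prod_def lessThan_atLeast0)
    finally show "(?N * W) $$ (i, j) = (W * L) $$ (i, j)" .
  qed (auto simp: W_def L_def normal_form_def)
  have "?N = ?N * (W * V)" using c by (simp add: WV right_mult_one_mat[of _ ?d ?d])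
  also have "\<dots> = ?N * W * V" using c by (intro assoc_mult_mat[of _ ?d ?d _ ?d _ ?d, symmetric])
  also have "\<dots> = W * L * V" by (simp only: NW)
  finally have "similar_mat ?N L"
    using c WV mat_mult_left_right_inverse[OF c(1) c(2) WV] by (intro similar_matI[of _ _ W V ?d]) auto
  then have "char_poly ?N = char_poly L" by (rule char_poly_similar)
  also have "\<dots> = (\<Prod>a\<leftarrow>diag_mat L. [:- a, 1:])"
    using c(3) by (rule char_poly_upper_triangular) (auto simp: L_def)
  also have "diag_mat L = map ev [0..<?d]"
    unfolding diag_mat_def by (auto simp: L_def)
  also have "(\<Prod>a\<leftarrow>map ev [0..<?d]. [:- a, 1:]) = prod_list (map (\<lambda>i. [:- ev i, 1:]) [0..<2 * n])"
    by (simp add: comp_def)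
  also have "\<dots> = (\<Prod>p\<leftarrow>[0..<n]. [:- ev (2 * p), 1:] * [:- ev (2 * p + 1), 1:])"
    by (rule prod_list_pairs)
  also have "\<dots> = normal_poly (map l [0..<n])"
    by (simp add: ev_def comp_def del: mult_pCons_left mult_pCons_right)
  finally show ?thesis .
qed

lemma proots_normal_factors:
  "proots (normal_poly ls) =
    image_mset (\<lambda>x. \<i> * complex_of_real x) (mset ls) + image_mset (\<lambda>x. - (\<i> * complex_of_real x)) (mset ls)"
proof (induction ls)
  case (Cons x ls)
  have nz: "normal_poly ls \<noteq> 0"
    by (auto simp: prod_list_zero_iff simp del: mult_pCons_left mult_pCons_right)
  have "proots ([:- (\<i> * complex_of_real x), 1:] * [:\<i> * complex_of_real x, 1:]) = {#\<i> * complex_of_real x, - (\<i> * complex_of_real x)#}"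
    by (subst proots_mult) (auto simp del: mult_pCons_left mult_pCons_right)
  with Cons nz show ?case
    by (simp add: proots_mult del: mult_pCons_left mult_pCons_right)
qed simp

text \<open>The absolute imaginary part sends the roots i x and -i x both to x, so the roots
  determine the list as a multiset, counted twice; sortedness fixes the order.\<close>

lemma normal_factors_unique:
  assumes "sorted ls" "\<forall>x\<in>set ls. 0 \<le> x" "sorted ls'" "\<forall>x\<in>set ls'. 0 \<le> x"
    and eq: "normal_poly ls = normal_poly ls'"
  shows "ls = ls'"
proof -
  have "image_mset (\<lambda>z. \<bar>Im z\<bar>) (proots (normal_poly ls)) =
      mset ls + mset ls" if "\<forall>x\<in>set ls. 0 \<le> x" for ls
  proof -
    have "image_mset (\<lambda>x. \<bar>x\<bar>) (mset ls) = image_mset (\<lambda>x. x) (mset ls)"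
      by (rule image_mset_cong) (use that in auto)
    then show ?thesis unfolding proots_normal_factors by (simp add: multiset.map_comp comp_def)
  qed
  from this[OF assms(2)] this[OF assms(4)] have "mset ls + mset ls = mset ls' + mset ls'"
    unfolding eq by simp
  then have "count (mset ls) x + count (mset ls) x = count (mset ls') x + count (mset ls') x" for x
    by (metis count_union)
  then have "mset ls = mset ls'" by (intro multiset_eqI) (simp flip: mult_2)
  then show ?thesis
    using assms(1,3) by (metis properties_for_sort)
qed

text \<open>Evaluates the definite description from any normal form: orthogonal conjugation is a
  similarity, so the characteristic polynomial is known, and its factorization is unique.\<close>

lemma normal_eigenvalues_eq:
  assumes A: "A \<in> carrier_mat (2 * n) (2 * n)" and Q: "real_orthogonal_mat (2 * n) Q"
    and N: "Q * A * transpose_mat Q = normal_form n l"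
    and l: "\<forall>p<n. 0 \<le> l p" "\<forall>p q. p \<le> q \<longrightarrow> q < n \<longrightarrow> l p \<le> l q"
  shows "normal_eigenvalues A = map l [0..<n]"
proof -
  let ?d = "2 * n" and ?h = "map_mat complex_of_real"
  have c: "Q \<in> carrier_mat ?d ?d" "transpose_mat Q \<in> carrier_mat ?d ?d" "Q * A \<in> carrier_mat ?d ?d"
    and QQ: "transpose_mat Q * Q = 1\<^sub>m ?d" "Q * transpose_mat Q = 1\<^sub>m ?d"
    using Q A by (auto simp: real_orthogonal_mat_def)
  have one: "?h (1\<^sub>m ?d) = 1\<^sub>m ?d" by (rule eq_matI) auto
  have h_mult: "?h (X * Y) = ?h X * ?h Y" if "X \<in> carrier_mat ?d ?d" "Y \<in> carrier_mat ?d ?d" for X Y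
    using that by (rule of_real_hom.mat_hom_mult)
  have "?h (normal_form n l) = ?h Q * ?h A * ?h (transpose_mat Q)"
    unfolding N[symmetric] h_mult[OF c(3,2)] h_mult[OF c(1) A] ..
  moreover have "?h Q * ?h (transpose_mat Q) = 1\<^sub>m ?d" "?h (transpose_mat Q) * ?h Q = 1\<^sub>m ?d"
    unfolding h_mult[OF c(1,2), symmetric] h_mult[OF c(2,1), symmetric] QQ one by (rule refl)+
  ultimately have "similar_mat (?h (normal_form n l)) (?h A)"
    using c A by (intro similar_matI[of _ _ "?h Q" "?h (transpose_mat Q)" ?d]) auto
  then have cp: "char_poly (?h A) = normal_poly (map l [0..<n])"
    by (metis char_poly_similar char_poly_normal_form)
  have sorted: "sorted (map l [0..<n])"
    using l(2) by (auto simp: sorted_iff_nth_mono)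
  have nonneg: "\<forall>x\<in>set (map l [0..<n]). 0 \<le> x"
    using l(1) by auto
  show ?thesis
    unfolding normal_eigenvalues_def
  proof (rule the_equality, intro conjI sorted nonneg cp, elim conjE)
    fix ls assume ls: "sorted ls" "\<forall>x\<in>set ls. 0 \<le> x"
      and eq: "char_poly (?h A) = normal_poly ls"
    show "ls = map l [0..<n]"
      by (rule normal_factors_unique[OF ls sorted nonneg eq[symmetric, unfolded cp]])
  qed
qed

text \<open>A Courant-Fischer argument with the perturbation built in. Where the first
  \<open>2 * t\<close> rows of \<open>Q\<close> vanish, \<open>B\<close> stretches by at least
  \<open>c\<close>; on the span of the lowest \<open>t + 1\<close> pairs of \<open>A\<close>,
  \<open>A\<close> stretches by at most the eigenvalue sought. A common unit vector compares the
  two.\<close>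

lemma normal_eigenvalues_ge:
  assumes A: "antisymmetric_mat (2 * n) A" and B: "B \<in> carrier_mat (2 * n) (2 * n)"
    and Q: "Q \<in> carrier_mat (2 * n) (2 * n)" and t: "t < n"
    and below: "\<And>x. (\<And>i. i < 2 * t \<Longrightarrow> mv (2 * n) Q x i = 0) \<Longrightarrow> c * nrm (2 * n) x \<le> nrm (2 * n) (mv (2 * n) B x)"
    and err: "\<And>x. nrm (2 * n) (mv (2 * n) B x) \<le> nrm (2 * n) (mv (2 * n) A x) + \<epsilon> * nrm (2 * n) x"
  shows "c - \<epsilon> \<le> normal_eigenvalues A ! t"
proof -
  obtain Q' l where Q': "real_orthogonal_mat (2 * n) Q'" "Q' * A * transpose_mat Q' = normal_form n l"
    and l: "\<forall>p<n. 0 \<le> l p" "\<forall>p q. p \<le> q \<longrightarrow> q < n \<longrightarrow> l p \<le> l q"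
    using antisymmetric_normal_form[OF A] by (elim exE conjE) (rule that)
  have Ac: "A \<in> carrier_mat (2 * n) (2 * n)" and Qc: "Q' \<in> carrier_mat (2 * n) (2 * n)"
    using A Q' by (auto simp: antisymmetric_mat_def real_orthogonal_mat_def)
  obtain x where x: "nrm (2 * n) x = 1" "\<And>i. i < 2 * t \<Longrightarrow> mv (2 * n) Q x i = 0"
    "\<And>i. 2 * t + 2 \<le> i \<Longrightarrow> i < 2 * n \<Longrightarrow> mv (2 * n) Q' x i = 0"
    using exists_common_vector[OF Q Qc t] by blast
  have "c \<le> nrm (2 * n) (mv (2 * n) A x) + \<epsilon>"
    using below[OF x(2)] err[of x] x(1) by simp
  also have "nrm (2 * n) (mv (2 * n) A x) \<le> l t"
    using nrm_normal_form_le[OF l t, of "mv (2 * n) Q' x", OF x(3)] nrm_mv_conj[OF Q'(1) Ac Q'(2)] nrm_mv_orthogonal[OF Q'(1)] x(1) by simp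
  finally show ?thesis
    using t by (simp add: normal_eigenvalues_eq[OF Ac Q' l])
qed

text \<open>The dual estimate: \<open>B\<close> is bounded above on a space of low pairs, which
  meets the space of the pairs of \<open>A\<close> from \<open>t\<close> on.\<close>

lemma normal_eigenvalues_le:
  assumes A: "antisymmetric_mat (2 * n) A" and B: "B \<in> carrier_mat (2 * n) (2 * n)"
    and Q: "Q \<in> carrier_mat (2 * n) (2 * n)" and t: "t < n"
    and above: "\<And>x. (\<And>i. 2 * t + 2 \<le> i \<Longrightarrow> i < 2 * n \<Longrightarrow> mv (2 * n) Q x i = 0) \<Longrightarrow> nrm (2 * n) (mv (2 * n) B x) \<le> c * nrm (2 * n) x"
    and err: "\<And>x. nrm (2 * n) (mv (2 * n) A x) \<le> nrm (2 * n) (mv (2 * n) B x) + \<epsilon> * nrm (2 * n) x"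
  shows "normal_eigenvalues A ! t \<le> c + \<epsilon>"
proof -
  obtain Q' l where Q': "real_orthogonal_mat (2 * n) Q'" "Q' * A * transpose_mat Q' = normal_form n l"
    and l: "\<forall>p<n. 0 \<le> l p" "\<forall>p q. p \<le> q \<longrightarrow> q < n \<longrightarrow> l p \<le> l q"
    using antisymmetric_normal_form[OF A] by (elim exE conjE) (rule that)
  have Ac: "A \<in> carrier_mat (2 * n) (2 * n)" and Qc: "Q' \<in> carrier_mat (2 * n) (2 * n)"
    using A Q' by (auto simp: antisymmetric_mat_def real_orthogonal_mat_def)
  obtain x where x: "nrm (2 * n) x = 1" "\<And>i. i < 2 * t \<Longrightarrow> mv (2 * n) Q' x i = 0"
    "\<And>i. 2 * t + 2 \<le> i \<Longrightarrow> i < 2 * n \<Longrightarrow> mv (2 * n) Q x i = 0"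
    using exists_common_vector[OF Qc Q t] by blast
  have "l t \<le> nrm (2 * n) (mv (2 * n) A x)"
    using nrm_normal_form_ge[OF l t, of "mv (2 * n) Q' x", OF x(2)] nrm_mv_conj[OF Q'(1) Ac Q'(2)] nrm_mv_orthogonal[OF Q'(1)] x(1) by simp
  also have "\<dots> \<le> c + \<epsilon>"
    using above[OF x(3)] err[of x] x(1) by simp
  finally show ?thesis
    using t by (simp add: normal_eigenvalues_eq[OF Ac Q' l])
qed

text \<open>One factor sqrt d comes from Cauchy-Schwarz within a row and another from summing the
  squares of \<open>d\<close> rows. With \<open>d = 2 * n\<close> this is why entries must be
  accurate to \<open>\<epsilon>_corr / (2 * n)\<close>.\<close>

lemma nrm_mv_diff_entries:
  assumes "\<And>i j. i < d \<Longrightarrow> j < d \<Longrightarrow> \<bar>A $$ (i, j) - B $$ (i, j)\<bar> \<le> \<epsilon>" "0 \<le> \<epsilon>"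
  shows "nrm d (mv d A x) \<le> nrm d (mv d B x) + real d * \<epsilon> * nrm d x"
proof -
  define y where "y i = (\<Sum>j<d. (A $$ (i, j) - B $$ (i, j)) * x j)" for i
  have "nrm d (mv d A x) = nrm d (\<lambda>i. mv d B x i + y i)"
    by (rule nrm_cong) (simp add: mv_def y_def left_diff_distrib sum_subtractf)
  also have "\<dots> \<le> nrm d (mv d B x) + nrm d y"
    unfolding nrm_def by (rule L2_set_triangle_ineq)
  also have "nrm d y \<le> real d * \<epsilon> * nrm d x"
  proof -
    have "\<bar>y i\<bar> \<le> \<epsilon> * (\<Sum>j<d. \<bar>x j\<bar>)" if "i < d" for i
      unfolding y_def sum_distrib_left
      by (intro order_trans[OF sum_abs] sum_mono) (use assms that in \<open>auto simp: abs_mult intro!: mult_right_mono\<close>)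
    moreover have "(\<Sum>j<d. \<bar>x j\<bar>) \<le> sqrt (real d) * nrm d x"
      using L2_set_mult_ineq[of "\<lambda>_. 1" x "{..<d}"] by (simp add: nrm_def L2_set_def)
    ultimately have "\<bar>y i\<bar> \<le> \<epsilon> * (sqrt (real d) * nrm d x)" if "i < d" for i
      using that assms(2) by (meson mult_left_mono order_trans)
    then have "nrm d y \<le> L2_set (\<lambda>_. \<epsilon> * (sqrt (real d) * nrm d x)) {..<d}"
      unfolding nrm_def L2_set_def by (intro real_sqrt_le_mono sum_mono abs_le_square_iff[THEN iffD1]) (fastforce simp: abs_le_iff)
    also have "\<dots> = sqrt (real d) * (\<epsilon> * (sqrt (real d) * nrm d x))"
      using assms(2) nrm_nonneg[of d x] by (simp add: L2_set_def real_sqrt_mult)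
    also have "\<dots> = real d * \<epsilon> * nrm d x"
      by simp
    finally show ?thesis .
  qed
  finally show ?thesis by simp
qed

subsection \<open>Correlation matrices\<close>

definition expect :: "complex vec \<Rightarrow> complex mat \<Rightarrow> complex" where
  "expect \<psi> A = (A *\<^sub>v \<psi>) \<bullet>c \<psi>"

text \<open>The real part only matters on the diagonal, where it turns the expectation of
  \<open>-\<i>\<close> times the identity into 0, as the commutator does in the usual
  definition.\<close>

definition corr :: "nat \<Rightarrow> complex vec \<Rightarrow> real mat" where
  "corr n \<psi> = mat (2 * n) (2 * n) (\<lambda>p. Re (expect \<psi> (pair_observable n p)))"

lemma corr_carrier [simp]: "corr n \<psi> \<in> carrier_mat (2 * n) (2 * n)"
  by (simp add: corr_def)

lemma expect_eq:
  assumes "\<psi> \<in> carrier_vec d" "A \<in> carrier_mat d d"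
  shows "expect \<psi> A = (\<Sum>i<d. \<Sum>j<d. A $$ (i, j) * (\<psi> $ j * cnj (\<psi> $ i)))"
  using assms by (auto simp: expect_def scalar_prod_def lessThan_atLeast0 sum_distrib_right mult.assoc)

lemma expect_lincomb:
  assumes "\<psi> \<in> carrier_vec d" "\<And>k. k \<in> I \<Longrightarrow> A k \<in> carrier_mat d d"
  shows "expect \<psi> (mat_lincomb d I c A) = (\<Sum>k\<in>I. c k * expect \<psi> (A k))"
proof -
  have "expect \<psi> (mat_lincomb d I c A) = (\<Sum>i<d. \<Sum>j<d. \<Sum>k\<in>I. c k * (A k $$ (i, j) * (\<psi> $ j * cnj (\<psi> $ i))))"
    using assms(1) by (simp add: expect_eq[of _ d] sum_distrib_right mult.assoc)
  also have "\<dots> = (\<Sum>i<d. \<Sum>k\<in>I. \<Sum>j<d. c k * (A k $$ (i, j) * (\<psi> $ j * cnj (\<psi> $ i))))"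
    by (rule sum.cong[OF refl], rule sum.swap)
  also have "\<dots> = (\<Sum>k\<in>I. \<Sum>i<d. \<Sum>j<d. c k * (A k $$ (i, j) * (\<psi> $ j * cnj (\<psi> $ i))))"
    by (rule sum.swap)
  also have "\<dots> = (\<Sum>k\<in>I. c k * expect \<psi> (A k))"
    using assms by (intro sum.cong refl) (simp add: expect_eq[of _ d] sum_distrib_left)
  finally show ?thesis .
qed

lemma expect_smult:
  assumes "\<psi> \<in> carrier_vec d" "A \<in> carrier_mat d d"
  shows "expect \<psi> (c \<cdot>\<^sub>m A) = c * expect \<psi> A"
  using assms by (simp add: expect_eq[of _ d] sum_distrib_left mult.assoc)

lemma expect_conj:
  assumes "\<psi> \<in> carrier_vec d" "A \<in> carrier_mat d d" "G \<in> carrier_mat d d"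
  shows "expect (G *\<^sub>v \<psi>) A = expect \<psi> (mat_adjoint G * A * G)"
proof -
  have G': "mat_adjoint G \<in> carrier_mat d d" using assms by simp
  have "expect \<psi> (mat_adjoint G * A * G) = (mat_adjoint G *\<^sub>v (A *\<^sub>v (G *\<^sub>v \<psi>))) \<bullet>c \<psi>"
    using assms G' by (simp add: expect_def assoc_mult_mat_vec[of _ d d _ d] mult_carrier_mat[of _ d d] mult_mat_vec_carrier[of _ d d])
  also have "\<dots> = (A *\<^sub>v (G *\<^sub>v \<psi>)) \<bullet>c (mat_adjoint (mat_adjoint G) *\<^sub>v \<psi>)"
    using assms G' by (intro cscalar_prod_mult_mat_vec[of _ d d]) (auto intro!: mult_mat_vec_carrier[of _ d d])
  finally show ?thesis by (simp add: expect_def)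
qed

lemma corr_index:
  assumes "\<psi> \<in> carrier_vec (2 ^ n)" "j < 2 * n" "k < 2 * n"
  shows "corr n \<psi> $$ (j, k) = Re (- \<i> * expect \<psi> (majorana n j * majorana n k))"
  using assms expect_smult[OF assms(1), of "majorana n j * majorana n k" "- \<i>"]
  by (simp add: corr_def pair_observable_def mult_carrier_mat[of _ "2 ^ n" "2 ^ n"])

text \<open>Expresses the form of the correlation matrix by Clifford elements, so that operator
  bounds become bounds on the matrix.\<close>

lemma bilin_corr:
  assumes \<psi>: "\<psi> \<in> carrier_vec (2 ^ n)"
  shows "bilin (2 * n) (corr n \<psi>) y x = Re (- \<i> * expect \<psi> (majorana_lin n y * majorana_lin n x))"
proof -
  have "expect \<psi> (majorana_lin n y * majorana_lin n x) =
      (\<Sum>j<2 * n. complex_of_real (y j) * (\<Sum>k<2 * n. complex_of_real (x k) * expect \<psi> (majorana n j * majorana n k)))"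
    unfolding majorana_lin_mult
    by (subst expect_lincomb[OF \<psi>], simp, intro sum.cong[OF refl] arg_cong[of _ _ "\<lambda>z. _ * z"] expect_lincomb[OF \<psi>])
      (auto intro!: mult_carrier_mat[of _ _ "2 ^ n"])
  also have "- \<i> * \<dots> = (\<Sum>j<2 * n. \<Sum>k<2 * n. complex_of_real (y j * x k) * (- \<i> * expect \<psi> (majorana n j * majorana n k)))"
    by (simp only: sum_distrib_left of_real_mult ac_simps)
  also have "Re \<dots> = (\<Sum>j<2 * n. \<Sum>k<2 * n. y j * x k * Re (- \<i> * expect \<psi> (majorana n j * majorana n k)))"
    by simp
  also have "\<dots> = bilin (2 * n) (corr n \<psi>) y x"
    unfolding bilin_def by (intro sum.cong refl) (simp add: corr_index[OF \<psi>])
  finally show ?thesis by simp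
qed

text \<open>Off the diagonal this is anticommutation; on it the expectation of the identity is real
  and its multiple by \<open>-\<i>\<close> has no real part.\<close>

lemma corr_antisymmetric:
  assumes \<psi>: "\<psi> \<in> carrier_vec (2 ^ n)"
  shows "antisymmetric_mat (2 * n) (corr n \<psi>)"
proof -
  have anti: "corr n \<psi> $$ (j, k) = - corr n \<psi> $$ (k, j)" if jk: "j < 2 * n" "k < 2 * n" for j k
  proof (cases "j = k")
    case True
    have "expect \<psi> (majorana n j * majorana n j) = complex_of_real (\<Sum>i<2 ^ n. (cmod (\<psi> $ i))\<^sup>2)"
      using \<psi> by (auto simp: majorana_square[OF jk(1)] expect_def scalar_prod_def lessThan_atLeast0 of_real_sum complex_norm_square simp del: of_real_power)
    then show ?thesis using True \<psi> jk by (simp add: corr_index)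
  next
    case False
    have "expect \<psi> (majorana n j * majorana n k) + expect \<psi> (majorana n k * majorana n j) =
        (\<Sum>a<2 ^ n. \<Sum>b<2 ^ n. ((majorana n j * majorana n k) $$ (a, b) + (majorana n k * majorana n j) $$ (a, b)) * (\<psi> $ b * cnj (\<psi> $ a)))"
      using \<psi> jk by (simp add: expect_eq[of _ "2 ^ n"] mult_carrier_mat[of _ "2 ^ n" "2 ^ n"] sum.distrib distrib_right)
    also have "\<dots> = 0"
      using False jk by (intro sum.neutral ballI) (simp only: lessThan_iff majorana_anticommutator, simp)
    finally have "expect \<psi> (majorana n j * majorana n k) = - expect \<psi> (majorana n k * majorana n j)"
      by (simp only: add_eq_0_iff2)
    then show ?thesis using \<psi> jk by (simp add: corr_index)
  qed
  show ?thesis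
    unfolding antisymmetric_mat_def by (intro conjI corr_carrier allI impI anti)
qed

text \<open>A Clifford element is self-adjoint with scalar square, hence a multiple of an
  isometry.\<close>

lemma majorana_lin_vec_norm:
  assumes v: "v \<in> carrier_vec (2 ^ n)"
  shows "sqrt (Re ((majorana_lin n x *\<^sub>v v) \<bullet>c (majorana_lin n x *\<^sub>v v))) = sqrt (ip (2 * n) x x) * sqrt (Re (v \<bullet>c v))"
proof -
  let ?L = "majorana_lin n x" and ?d = "2 ^ n :: nat"
  have "(?L *\<^sub>v v) \<bullet>c (?L *\<^sub>v v) = (mat_adjoint ?L *\<^sub>v (?L *\<^sub>v v)) \<bullet>c v"
    using cscalar_prod_mult_mat_vec[of "mat_adjoint ?L" ?d ?d "?L *\<^sub>v v" v] v
    by (simp add: mult_mat_vec_carrier[of _ ?d ?d])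
  also have "mat_adjoint ?L *\<^sub>v (?L *\<^sub>v v) = (?L * ?L) *\<^sub>v v"
    using v by (simp add: majorana_lin_adjoint assoc_mult_mat_vec[of _ ?d ?d _ ?d])
  also have "\<dots> = complex_of_real (ip (2 * n) x x) \<cdot>\<^sub>v v"
    using v by (simp add: majorana_lin_square smult_mat_mult_vec[of _ ?d ?d] ip_def power2_eq_square)
  also have "(complex_of_real (ip (2 * n) x x) \<cdot>\<^sub>v v) \<bullet>c v = complex_of_real (ip (2 * n) x x) * (v \<bullet>c v)"
    using v by simp
  finally show ?thesis by (simp add: real_sqrt_mult)
qed

text \<open>Cauchy-Schwarz, with each Clifford factor stretching by exactly the length of its
  coefficient vector.\<close>

lemma bilinear_form_majorana_le:
  assumes v: "v \<in> carrier_vec (2 ^ n)" "w \<in> carrier_vec (2 ^ n)"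
  shows "cmod (((majorana_lin n y * majorana_lin n x) *\<^sub>v v) \<bullet>c w) \<le>
    sqrt (ip (2 * n) y y) * sqrt (ip (2 * n) x x) * (sqrt (Re (v \<bullet>c v)) * sqrt (Re (w \<bullet>c w)))"
proof -
  let ?d = "2 ^ n :: nat"
  have lv: "majorana_lin n x *\<^sub>v v \<in> carrier_vec ?d" using v by (simp add: mult_mat_vec_carrier[of _ ?d ?d])
  have "cmod (((majorana_lin n y * majorana_lin n x) *\<^sub>v v) \<bullet>c w) = cmod ((majorana_lin n y *\<^sub>v (majorana_lin n x *\<^sub>v v)) \<bullet>c w)"
    using v by (simp add: assoc_mult_mat_vec[of _ ?d ?d _ ?d])
  also have "\<dots> \<le> sqrt (Re ((majorana_lin n y *\<^sub>v (majorana_lin n x *\<^sub>v v)) \<bullet>c (majorana_lin n y *\<^sub>v (majorana_lin n x *\<^sub>v v)))) * sqrt (Re (w \<bullet>c w))"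
    using v lv by (intro cscalar_prod_le[of _ ?d]) (auto simp: mult_mat_vec_carrier[of _ ?d ?d])
  finally show ?thesis
    unfolding majorana_lin_vec_norm[OF lv] majorana_lin_vec_norm[OF v(1)] by (simp add: ac_simps)
qed

lemma exists_phase: "\<exists>u. u * cnj u = 1 \<and> cnj u * c = complex_of_real (cmod c)"
proof (cases "c = 0")
  case False
  let ?u = "c / complex_of_real (cmod c)"
  have *: "c * cnj c = complex_of_real (cmod c) * complex_of_real (cmod c)"
    by (simp flip: complex_norm_square power2_eq_square)
  have "?u * cnj ?u = 1" "cnj ?u * c = complex_of_real (cmod c)"
    using False * by (simp_all add: mult.commute[of "cnj c"])
  then show ?thesis by blast
qed (auto intro: exI[of _ 1])

text \<open>
  For unit vectors with \<open>a \<bullet>c b\<close> real and nonnegative, the difference of the two expectations polarizes into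
  forms in \<open>a - b\<close> and \<open>a + b\<close>, whose norms multiply to twice the trace distance.
\<close>

lemma corr_diff_le:
  assumes \<psi>: "pure_state n \<psi>" and \<phi>: "pure_state n \<phi>"
  shows "\<bar>bilin (2 * n) (corr n \<psi>) y x - bilin (2 * n) (corr n \<phi>) y x\<bar> \<le>
    2 * trace_distance (density \<psi>) (density \<phi>) * (sqrt (ip (2 * n) y y) * sqrt (ip (2 * n) x x))"
proof -
  let ?d = "2 ^ n :: nat"
  define H where "H = majorana_lin n y * majorana_lin n x"
  have H: "H \<in> carrier_mat ?d ?d" by (simp add: H_def mult_carrier_mat[of _ ?d ?d])
  have c: "\<psi> \<in> carrier_vec ?d" "\<phi> \<in> carrier_vec ?d" "\<psi> \<bullet>c \<psi> = 1" "\<phi> \<bullet>c \<phi> = 1"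
    using \<psi> \<phi> by (auto simp: pure_state_def)
  obtain u where u: "u * cnj u = 1" "cnj u * (\<psi> \<bullet>c \<phi>) = complex_of_real (cmod (\<psi> \<bullet>c \<phi>))"
    using exists_phase by blast
  \<comment> \<open>The phase of the overlap is absorbed into \<open>\<phi>\<close>. No expectation
    changes, and the overlap becomes the nonnegative real \<open>r\<close>.\<close>
  define b where "b = u \<cdot>\<^sub>v \<phi>"
  have b: "b \<in> carrier_vec ?d" using c by (simp add: b_def)
  define r where "r = cmod (\<psi> \<bullet>c \<phi>)"
  have r: "r \<le> 1" using trace_distance_density(2)[OF c(1,3,2,4)] by (simp add: r_def)
  have conj_sum: "v \<bullet>c w = (\<Sum>i<?d. v $ i * cnj (w $ i))" if "v \<in> carrier_vec ?d" "w \<in> carrier_vec ?d" for v w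
    using that by (auto simp: scalar_prod_def lessThan_atLeast0)
  have bb: "b \<bullet>c b = 1"
  proof -
    have "b \<bullet>c b = (\<Sum>i<?d. (u * cnj u) * (\<phi> $ i * cnj (\<phi> $ i)))"
      unfolding conj_sum[OF b b] using c by (intro sum.cong) (auto simp: b_def)
    then show ?thesis using c(4) unfolding conj_sum[OF c(2) c(2)] by (simp add: u)
  qed
  have ab: "\<psi> \<bullet>c b = complex_of_real r" "b \<bullet>c \<psi> = complex_of_real r"
  proof -
    have "\<psi> \<bullet>c b = cnj u * (\<psi> \<bullet>c \<phi>)"
      unfolding conj_sum[OF c(1) b] conj_sum[OF c(1) c(2)] sum_distrib_left
      using c by (intro sum.cong) (auto simp: b_def)
    then show *: "\<psi> \<bullet>c b = complex_of_real r" using u by (simp add: r_def)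
    have "b \<bullet>c \<psi> = cnj (\<psi> \<bullet>c b)" using b c by (simp add: conj_sum mult.commute)
    then show "b \<bullet>c \<psi> = complex_of_real r" by (simp add: *)
  qed
  have eb: "expect b H = expect \<phi> H"
  proof -
    have "expect b H = (\<Sum>i<?d. \<Sum>j<?d. (u * cnj u) * (H $$ (i, j) * (\<phi> $ j * cnj (\<phi> $ i))))"
      unfolding expect_eq[OF b H] using c by (intro sum.cong refl) (simp add: b_def)
    then show ?thesis unfolding expect_eq[OF c(2) H] by (simp add: u)
  qed
  define m p where "m = \<psi> - b" and "p = \<psi> + b"
  have mp: "m \<in> carrier_vec ?d" "p \<in> carrier_vec ?d" using c b by (auto simp: m_def p_def)
  have mm: "m \<bullet>c m = complex_of_real (2 - 2 * r)" and pp: "p \<bullet>c p = complex_of_real (2 + 2 * r)"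
  proof -
    have "m \<bullet>c m = \<psi> \<bullet>c \<psi> - \<psi> \<bullet>c b - b \<bullet>c \<psi> + b \<bullet>c b" "p \<bullet>c p = \<psi> \<bullet>c \<psi> + \<psi> \<bullet>c b + b \<bullet>c \<psi> + b \<bullet>c b"
      unfolding conj_sum[OF mp(1) mp(1)] conj_sum[OF mp(2) mp(2)] conj_sum[OF c(1) c(1)] conj_sum[OF c(1) b]
        conj_sum[OF b c(1)] conj_sum[OF b b] sum.distrib[symmetric] sum_subtractf[symmetric]
      using c b by (intro sum.cong refl; simp add: m_def p_def algebra_simps)+
    then show "m \<bullet>c m = complex_of_real (2 - 2 * r)" "p \<bullet>c p = complex_of_real (2 + 2 * r)"
      by (simp_all add: ab bb c)
  qed
  have form: "(H *\<^sub>v v) \<bullet>c w = (\<Sum>i<?d. \<Sum>j<?d. H $$ (i, j) * (v $ j * cnj (w $ i)))"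
    if "v \<in> carrier_vec ?d" "w \<in> carrier_vec ?d" for v w
    using that H by (auto simp: scalar_prod_def lessThan_atLeast0 sum_distrib_right mult.assoc)
  \<comment> \<open>On the right the cross terms between \<open>\<psi>\<close> and \<open>b\<close>
    cancel. Both summands contain \<open>m\<close>, which is short when the states are
    close.\<close>
  have "2 * (expect \<psi> H - expect b H) = (H *\<^sub>v m) \<bullet>c p + (H *\<^sub>v p) \<bullet>c m"
    unfolding form[OF mp] form[OF mp(2,1)] expect_def form[OF c(1) c(1)] form[OF b b]
      sum.distrib[symmetric] sum_subtractf[symmetric] sum_distrib_left
    using c b by (intro sum.cong refl) (simp add: m_def p_def algebra_simps)
  then have "cmod (2 * (expect \<psi> H - expect b H)) \<le> cmod ((H *\<^sub>v m) \<bullet>c p) + cmod ((H *\<^sub>v p) \<bullet>c m)"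
    by (simp add: norm_triangle_ineq)
  also have "\<dots> \<le> 2 * (sqrt (ip (2 * n) y y) * sqrt (ip (2 * n) x x) * (sqrt (2 - 2 * r) * sqrt (2 + 2 * r)))"
    using bilinear_form_majorana_le[OF mp, of y x] bilinear_form_majorana_le[OF mp(2,1), of y x]
    unfolding H_def[symmetric] mm pp by (simp add: ac_simps)
  also have "sqrt (2 - 2 * r) * sqrt (2 + 2 * r) = 2 * sqrt (1 - r\<^sup>2)"
  proof -
    have "(2 - 2 * r) * (2 + 2 * r) = 2\<^sup>2 * (1 - r\<^sup>2)" by (simp add: power2_eq_square algebra_simps)
    then have "sqrt (2 - 2 * r) * sqrt (2 + 2 * r) = sqrt (2\<^sup>2 * (1 - r\<^sup>2))"
      by (simp only: real_sqrt_mult[symmetric])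
    also have "\<dots> = 2 * sqrt (1 - r\<^sup>2)"
      by (subst real_sqrt_mult) simp
    finally show ?thesis .
  qed
  finally have "cmod (expect \<psi> H - expect \<phi> H) \<le> 2 * sqrt (1 - r\<^sup>2) * (sqrt (ip (2 * n) y y) * sqrt (ip (2 * n) x x))"
    unfolding eb norm_mult by (simp add: ac_simps)
  moreover have "bilin (2 * n) (corr n \<psi>) y x - bilin (2 * n) (corr n \<phi>) y x = Re (- \<i> * (expect \<psi> H - expect \<phi> H))"
    using c by (simp add: bilin_corr H_def)
  moreover have "\<bar>Re (- \<i> * (expect \<psi> H - expect \<phi> H))\<bar> \<le> cmod (expect \<psi> H - expect \<phi> H)"
    using abs_Re_le_cmod[of "- \<i> * (expect \<psi> H - expect \<phi> H)"] by (simp only: norm_mult norm_minus_cancel norm_ii mult_1)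
  ultimately show ?thesis
    using trace_distance_density(1)[OF c(1,3,2,4)] by (simp add: r_def)
qed

lemma implements_conj_mult:
  assumes G: "implements n G Q" and jk: "j < 2 * n" "k < 2 * n"
  shows "mat_adjoint G * (majorana n j * majorana n k) * G =
    majorana_lin n (\<lambda>\<nu>. Q $$ (j, \<nu>)) * majorana_lin n (\<lambda>\<nu>. Q $$ (k, \<nu>))"
proof -
  let ?d = "2 ^ n :: nat"
  note assoc = assoc_mult_mat[of _ ?d ?d _ ?d _ ?d]
  have Gc: "G \<in> carrier_mat ?d ?d" "mat_adjoint G \<in> carrier_mat ?d ?d" and GG: "G * mat_adjoint G = 1\<^sub>m ?d"
    using G by (auto simp: implements_def unitary_mat_def)
  let ?a = "majorana n j" and ?b = "majorana n k"
  have ab: "?a \<in> carrier_mat ?d ?d" "?b \<in> carrier_mat ?d ?d" using jk by auto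
  have "mat_adjoint G * (?a * ?b) * G = mat_adjoint G * ?a * (1\<^sub>m ?d * ?b) * G"
    using Gc ab by (simp add: assoc mult_carrier_mat[of _ ?d ?d])
  also have "\<dots> = (mat_adjoint G * ?a * G) * (mat_adjoint G * ?b * G)"
    unfolding GG[symmetric] using Gc ab by (simp add: assoc mult_carrier_mat[of _ ?d ?d])
  finally show ?thesis
    using G jk by (simp add: implements_def)
qed

text \<open>The Heisenberg picture: moving \<open>G\<close> onto the observables replaces each
  Majorana operator by a row of \<open>Q\<close>.\<close>

lemma corr_covariance:
  assumes G: "implements n G Q" and Q: "Q \<in> carrier_mat (2 * n) (2 * n)" and \<psi>: "\<psi> \<in> carrier_vec (2 ^ n)"
  shows "corr n (G *\<^sub>v \<psi>) = Q * corr n \<psi> * transpose_mat Q"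
proof (rule eq_matI)
  let ?d = "2 ^ n :: nat"
  have Gc: "G \<in> carrier_mat ?d ?d"
    using G by (auto simp: implements_def unitary_mat_def)
  fix j k assume "j < dim_row (Q * corr n \<psi> * transpose_mat Q)" "k < dim_col (Q * corr n \<psi> * transpose_mat Q)"
  then have jk: "j < 2 * n" "k < 2 * n" using Q by auto
  have "corr n (G *\<^sub>v \<psi>) $$ (j, k) = Re (- \<i> * expect \<psi> (mat_adjoint G * (majorana n j * majorana n k) * G))"
    using \<psi> Gc jk by (simp add: corr_index mult_mat_vec_carrier[of _ ?d ?d] expect_conj[of _ ?d] mult_carrier_mat[of _ ?d ?d])
  also have "\<dots> = (Q * corr n \<psi> * transpose_mat Q) $$ (j, k)"
    unfolding implements_conj_mult[OF G jk] by (simp only: mat_conj_index[OF Q corr_carrier jk] bilin_corr[OF \<psi>])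
  finally show "corr n (G *\<^sub>v \<psi>) $$ (j, k) = (Q * corr n \<psi> * transpose_mat Q) $$ (j, k)" .
qed (use Q in \<open>auto simp: corr_def\<close>)

lemma expect_on_qubit_Z:
  assumes "\<psi> \<in> carrier_vec (2 ^ n)" "k < n"
  shows "expect \<psi> (on_qubit n k pauli_Z) = complex_of_real (\<Sum>x<2 ^ n. Z_outcome n k x * (cmod (\<psi> $ x))\<^sup>2)"
proof -
  have "expect \<psi> (on_qubit n k pauli_Z) = (\<Sum>x<2 ^ n. \<Sum>y<2 ^ n. if y = x then complex_of_real (Z_outcome n k x) * (\<psi> $ x * cnj (\<psi> $ x)) else 0)"
    unfolding expect_eq[OF assms(1) on_qubit_carrier[OF assms(2) pauli_carrier(3)]]
    using assms(2) by (intro sum.cong refl) (auto simp: on_qubit_Z_index)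
  also have "\<dots> = (\<Sum>x<2 ^ n. complex_of_real (Z_outcome n k x) * (\<psi> $ x * cnj (\<psi> $ x)))"
    by simp
  finally show ?thesis by (simp only: complex_norm_square[symmetric] of_real_mult[symmetric] of_real_sum)
qed

text \<open>The two strings of the same qubit cancel, and X Y = i Z.\<close>

lemma on_qubit_Z_eq_pair_observable:
  assumes k: "k < n"
  shows "on_qubit n k pauli_Z = pair_observable n (2 * k, 2 * k + 1)"
proof -
  let ?d = "2 ^ n :: nat"
  note assoc = assoc_mult_mat[of _ ?d ?d _ ?d _ ?d]
  let ?W = "parity_string n k" and ?X = "on_qubit n k pauli_X" and ?Y = "on_qubit n k pauli_Y"
  have c: "?W \<in> carrier_mat ?d ?d" "?X \<in> carrier_mat ?d ?d" "?Y \<in> carrier_mat ?d ?d"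
    using k by auto
  have "majorana n (2 * k) * majorana n (2 * k + 1) = ?W * (?X * ?W) * ?Y"
    using k c by (simp add: majorana_eq majorana_site_def assoc mult_carrier_mat[of _ ?d ?d])
  also have "?X * ?W = ?W * ?X" using k by (intro parity_string_commute[symmetric]) auto
  also have "?W * (?W * ?X) * ?Y = (?W * ?W) * (?X * ?Y)"
    using c by (simp add: assoc mult_carrier_mat[of _ ?d ?d])
  also have "\<dots> = on_qubit n k (\<i> \<cdot>\<^sub>m pauli_Z)"
    using k c by (simp add: parity_string_square on_qubit_mult pauli_mult left_mult_one_mat[of _ ?d ?d] smult_carrier_mat)
  finally have "pair_observable n (2 * k, 2 * k + 1) = (- \<i>) \<cdot>\<^sub>m on_qubit n k (\<i> \<cdot>\<^sub>m pauli_Z)"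
    by (simp add: pair_observable_def)
  also have "\<dots> = on_qubit n k pauli_Z"
  proof (rule eq_matI)
    fix i j assume "i < dim_row (on_qubit n k pauli_Z)" "j < dim_col (on_qubit n k pauli_Z)"
    moreover have "x div 2 ^ (n - k - 1) < 2 ^ k * 2" if "x < 2 ^ k * 2 * 2 ^ (n - k - 1)" for x :: nat
      using that by (rule less_mult_imp_div_less)
    ultimately show "((- \<i>) \<cdot>\<^sub>m on_qubit n k (\<i> \<cdot>\<^sub>m pauli_Z)) $$ (i, j) = on_qubit n k pauli_Z $$ (i, j)"
      by (simp add: on_qubit_def kron_mat_def less_mult_imp_div_less)
  qed (simp_all add: on_qubit_def)
  finally show ?thesis ..
qed

subsection \<open>Sampling\<close>

text \<open>Only the coordinates in \<open>J\<close> are averaged; they remain independent within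
  the larger product. Values in an interval of length 2 turn the exponent 2 (K \<epsilon>)^2 / (4 K)
  into K \<epsilon>^2 / 2 for K = \<open>card J\<close>.\<close>

lemma hoeffding_Pi_pmf:
  fixes p :: "'i \<Rightarrow> 'a pmf" and f :: "'a \<Rightarrow> real"
  assumes I: "finite I" "J \<subseteq> I" "J \<noteq> {}" and f: "\<And>x. \<bar>f x\<bar> \<le> 1"
    and m: "\<And>j. j \<in> J \<Longrightarrow> measure_pmf.expectation (p j) f = m" and "\<epsilon> \<ge> 0"
  shows "measure_pmf.prob (Pi_pmf I d p) {\<omega>. \<epsilon> \<le> \<bar>(\<Sum>j\<in>J. f (\<omega> j)) / real (card J) - m\<bar>} \<le>
    2 * exp (- (real (card J) * \<epsilon>\<^sup>2 / 2))"
proof -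
  let ?M = "measure_pmf (Pi_pmf I d p)"
  have J: "finite J" using I finite_subset by blast
  then have card: "card J > 0" using I by (simp add: card_gt_0_iff)
  have exp_eq: "measure_pmf.expectation (Pi_pmf I d p) (\<lambda>\<omega>. f (\<omega> j)) = m" if "j \<in> J" for j
  proof -
    have "j \<in> I" using that I by blast
    then have "measure_pmf.expectation (p j) f = measure_pmf.expectation (map_pmf (\<lambda>\<omega>. \<omega> j) (Pi_pmf I d p)) f"
      using I(1) by (simp add: Pi_pmf_component)
    then show ?thesis using m[OF that] by simp
  qed
  have indep: "prob_space.indep_vars ?M (\<lambda>_. borel) (\<lambda>j \<omega>. f (\<omega> j)) J"
  proof -
    have "prob_space.indep_vars ?M (\<lambda>_. count_space UNIV) (\<lambda>x f. f x) J"
      by (rule prob_space.indep_vars_subset[OF measure_pmf.prob_space_axioms indep_vars_Pi_pmf[OF I(1)] I(2)])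
    from prob_space.indep_vars_compose2[OF measure_pmf.prob_space_axioms this, where Y = "\<lambda>_. f" and N = "\<lambda>_. borel"]
    show ?thesis by simp
  qed
  interpret Hoeffding_ineq ?M J "\<lambda>j \<omega>. f (\<omega> j)" "\<lambda>_. - 1" "\<lambda>_. 1"
      "\<Sum>j\<in>J. measure_pmf.expectation (Pi_pmf I d p) (\<lambda>\<omega>. f (\<omega> j))"
  proof unfold_locales
    fix j assume "j \<in> J"
    show "AE x in ?M. f (x j) \<in> {- 1..1}"
      using f by (intro AE_I2) (simp add: abs_le_iff minus_le_iff)
  qed (use J indep in simp_all)
  have "{\<omega>. \<epsilon> \<le> \<bar>(\<Sum>j\<in>J. f (\<omega> j)) / real (card J) - m\<bar>} =
     {\<omega>\<in>space ?M. real (card J) * \<epsilon> \<le> \<bar>(\<Sum>j\<in>J. f (\<omega> j)) - (\<Sum>j\<in>J. measure_pmf.expectation (Pi_pmf I d p) (\<lambda>\<omega>. f (\<omega> j)))\<bar>}"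
  proof -
    have "\<epsilon> \<le> \<bar>s / real (card J) - m\<bar> \<longleftrightarrow> real (card J) * \<epsilon> \<le> \<bar>s - real (card J) * m\<bar>" for s
    proof -
      have "\<bar>s - real (card J) * m\<bar> = real (card J) * \<bar>s / real (card J) - m\<bar>"
        using card by (subst abs_of_nat[symmetric], subst abs_mult[symmetric]) (simp add: right_diff_distrib)
      then show ?thesis using card by simp
    qed
    then show ?thesis by (simp add: exp_eq)
  qed
  also have "measure_pmf.prob (Pi_pmf I d p) \<dots> \<le> 2 * exp (- 2 * (real (card J) * \<epsilon>)\<^sup>2 / (\<Sum>j\<in>J. (1 - - 1)\<^sup>2))"
    by (rule Hoeffding_ineq_abs_ge) (use card \<open>\<epsilon> \<ge> 0\<close> in auto)
  also have "- 2 * (real (card J) * \<epsilon>)\<^sup>2 / (\<Sum>j\<in>J. (1 - - 1)\<^sup>2) = - (real (card J) * \<epsilon>\<^sup>2 / 2)"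
    using card by (simp add: power2_eq_square field_simps)
  finally show ?thesis .
qed

text \<open>Unit norm is what makes the squared moduli a probability mass function, so that
  \<open>embed_pmf\<close> has its intended values.\<close>

lemma measure_basis_expectation:
  assumes v: "v \<in> carrier_vec d" "v \<bullet>c v = 1"
  shows "measure_pmf.expectation (measure_basis v) f = (\<Sum>x<d. f x * (cmod (v $ x))\<^sup>2)"
proof -
  define g where "g x = (if x < dim_vec v then (cmod (v $ x))\<^sup>2 else 0)" for x
  have "complex_of_real (\<Sum>x<d. (cmod (v $ x))\<^sup>2) = (\<Sum>x<d. v $ x * cnj (v $ x))"
    by (simp only: of_real_sum complex_norm_square)
  also have "\<dots> = v \<bullet>c v"
    using v(1) by (auto simp: scalar_prod_def lessThan_atLeast0)
  finally have "complex_of_real (\<Sum>x<d. (cmod (v $ x))\<^sup>2) = complex_of_real 1"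
    using v(2) by simp
  then have sum1: "(\<Sum>x<d. (cmod (v $ x))\<^sup>2) = 1"
    by (simp only: of_real_eq_iff)
  have pmf: "pmf (measure_basis v) x = g x" for x
    unfolding measure_basis_def g_def[symmetric]
  proof (rule pmf_embed_pmf)
    show "(\<integral>\<^sup>+ x. ennreal (g x) \<partial>count_space UNIV) = 1"
    proof -
      have "(\<integral>\<^sup>+ x. ennreal (g x) \<partial>count_space UNIV) = (\<Sum>x<d. ennreal (g x))"
        using v(1) by (intro nn_integral_count_space') (auto simp: g_def)
      also have "\<dots> = ennreal (\<Sum>x<d. g x)"
        by (intro sum_ennreal) (auto simp: g_def)
      also have "(\<Sum>x<d. g x) = 1"
        using sum1 v(1) by (auto simp: g_def)
      finally show ?thesis by simp
    qed
  qed (simp add: g_def)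
  have "measure_pmf.expectation (measure_basis v) f = (\<Sum>x<d. f x * pmf (measure_basis v) x)"
    using v(1) by (intro integral_measure_pmf_real) (auto simp: set_pmf_iff pmf g_def split: if_splits)
  then show ?thesis using v(1) by (auto simp: pmf g_def)
qed

lemma card_increasing_pairs: "finite {(j, k). j < k \<and> k < m}" "2 * card {(j, k). j < k \<and> k < m} = m * (m - 1)" for m :: nat
proof -
  have eq: "{(j, k). j < k \<and> k < m} = (SIGMA k:{..<m}. {..<k})\<inverse>" by auto
  show "finite {(j, k). j < k \<and> k < m}"
    by (rule finite_subset[of _ "{..<m} \<times> {..<m}"]) auto
  have "card {(j, k). j < k \<and> k < m} = card (SIGMA k:{..<m}. {..<k})"
    unfolding eq by simp
  also have "\<dots> = (\<Sum>k<m. k)" by simp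
  finally have "2 * card {(j, k). j < k \<and> k < m} = 2 * (\<Sum>k<m. k)" by simp
  also have "2 * (\<Sum>k<m. k) = m * (m - 1)"
  proof (induction m)
    case (Suc m)
    then show ?case by (cases m) (simp_all add: algebra_simps)
  qed simp
  finally show "2 * card {(j, k). j < k \<and> k < m} = m * (m - 1)" .
qed

text \<open>Absorbs two losses: rounding when \<open>N\<close> copies are split among
  \<open>2 * n - 1\<close> sets, and the union bound over \<open>n * (2 * n - 1)\<close>
  observables, which the factor 4 n^2 inside the logarithm covers.\<close>

lemma sample_size_bound:
  assumes n: "2 \<le> n" and e: "0 < e" "e \<le> 1" and \<delta>: "0 < \<delta>" "\<delta> \<le> 1"
    and N: "N = nat \<lceil>16 * real n ^ 3 / e\<^sup>2 * ln (4 * (real n)\<^sup>2 / \<delta>)\<rceil>"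
  defines "M \<equiv> N div (2 * n - 1)"
  shows "M > 0" "real (n * (2 * n - 1)) * (2 * exp (- (real M * (e / (2 * real n))\<^sup>2 / 2))) \<le> \<delta>"
proof -
  define L where "L = ln (4 * (real n)\<^sup>2 / \<delta>)"
  define k where "k = real (2 * n - 1)"
  have nr: "2 \<le> real n" using n by simp
  have k: "k = 2 * real n - 1" using n by (simp add: k_def of_nat_diff)
  have n2: "4 \<le> (real n)\<^sup>2" using power_mono[OF nr, of 2] by simp
  have ratio: "4 * (real n)\<^sup>2 \<le> 4 * (real n)\<^sup>2 / \<delta>"
    using \<delta> by (simp add: pos_le_divide_eq mult_left_le)
  \<comment> \<open>Here 4 n^2 is at least 16. The resulting \<open>L \<ge> 1\<close> makes
    \<open>T\<close> large enough to absorb the rounding.\<close>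
  have "exp 1 \<le> 4 * (real n)\<^sup>2 / \<delta>"
    using exp_le ratio n2 by linarith
  then have L1: "1 \<le> L" unfolding L_def
    by (metis exp_gt_zero ln_exp ln_mono order_less_le_trans)
  have e2: "0 < e\<^sup>2" "e\<^sup>2 \<le> 1" using e by (auto simp: power_le_one)
  \<comment> \<open>The number of copies per set at which the Hoeffding exponent for accuracy
    \<open>e / (2 * real n)\<close> is exactly \<open>L\<close>.\<close>
  define T where "T = 8 * (real n)\<^sup>2 * L / e\<^sup>2"
  have T: "8 * (real n)\<^sup>2 \<le> T"
  proof -
    have "8 * (real n)\<^sup>2 * e\<^sup>2 \<le> 8 * (real n)\<^sup>2 * L"
      using L1 e2 by (intro mult_left_mono) auto
    then show ?thesis using e2 by (simp add: T_def pos_le_divide_eq)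
  qed
  have "2 * real n * T = 16 * real n ^ 3 / e\<^sup>2 * L"
    by (simp add: T_def power2_eq_square power3_eq_cube)
  then have N_ge: "2 * real n * T \<le> real N"
    unfolding N L_def[symmetric] by linarith
  have "N < (M + 1) * (2 * n - 1)"
    using dividend_less_div_times[of "2 * n - 1" N] n by (simp add: M_def add_mult_distrib)
  then have "real N < (real M + 1) * k"
    unfolding k_def by (metis of_nat_1 of_nat_add of_nat_less_iff of_nat_mult)
  then have "2 * real n * T < (real M + 1) * k" using N_ge by linarith
  \<comment> \<open>The budget is \<open>2 * n\<close> shares of \<open>T\<close> copies for only
    \<open>2 * n - 1\<close> sets. The spare share is at least \<open>k\<close> and pays for the
    integer division.\<close>
  moreover have "k * T + k \<le> 2 * real n * T"
  proof -
    have "real n * 4 \<le> real n * (8 * real n)" using nr by (intro mult_left_mono) auto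
    then have "k \<le> T" using T k by (simp add: power2_eq_square)
    then show ?thesis unfolding k by (simp add: algebra_simps)
  qed
  ultimately have "k * T + k < (real M + 1) * k" by linarith
  then have "k * (T + 1) < k * (real M + 1)" by (simp add: algebra_simps)
  then have MT: "T < real M" using k nr by (simp add: mult_less_cancel_left)
  moreover have "0 < T" using T n2 by linarith
  ultimately show "M > 0" by simp
  have "L \<le> real M * (e / (2 * real n))\<^sup>2 / 2"
  proof -
    have "L = T * (e / (2 * real n))\<^sup>2 / 2"
      using e2 n2 nr by (auto simp: T_def power_divide power_mult_distrib)
    also have "\<dots> \<le> real M * (e / (2 * real n))\<^sup>2 / 2"
      using MT by (intro divide_right_mono mult_right_mono) auto
    finally show ?thesis .
  qed
  then have "exp (- (real M * (e / (2 * real n))\<^sup>2 / 2)) \<le> exp (- L)" by simp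
  also have "exp (- L) = \<delta> / (4 * (real n)\<^sup>2)"
  proof -
    have "0 < 4 * (real n)\<^sup>2 / \<delta>" using \<delta> nr by (intro divide_pos_pos) auto
    then show ?thesis by (simp add: L_def exp_minus)
  qed
  finally have "real (n * (2 * n - 1)) * (2 * exp (- (real M * (e / (2 * real n))\<^sup>2 / 2))) \<le>
      real (n * (2 * n - 1)) * (2 * (\<delta> / (4 * (real n)\<^sup>2)))"
    by (intro mult_left_mono) auto
  also have "\<dots> = \<delta> * (k / (2 * real n))"
    using nr by (simp add: k_def power2_eq_square)
  also have "\<dots> \<le> \<delta> * 1"
    using k nr \<delta> by (intro mult_left_mono) auto
  finally show "real (n * (2 * n - 1)) * (2 * exp (- (real M * (e / (2 * real n))\<^sup>2 / 2))) \<le> \<delta>" by simp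
qed

text \<open>Observables of one set are read off the same samples and need not be independent, so the
  single Hoeffding bounds are combined by a union bound.\<close>

lemma empirical_means_accurate:
  assumes P: "partition_on {(j, k). j < k \<and> k < 2 * n} P" and "M > 0" "0 \<le> \<epsilon>"
    and mean: "\<And>B p. B \<in> P \<Longrightarrow> p \<in> B \<Longrightarrow> measure_pmf.expectation (D B) (Z_outcome n (q p)) = m p"
  shows "1 - real (n * (2 * n - 1)) * (2 * exp (- (real M * \<epsilon>\<^sup>2 / 2))) \<le>
    measure_pmf.prob (Pi_pmf (P \<times> {..<M}) 0 (\<lambda>(B, i). D B))
      {\<omega>. \<forall>p. fst p < snd p \<and> snd p < 2 * n \<longrightarrow> \<bar>empirical_mean n P q M \<omega> p - m p\<bar> < \<epsilon>}"
proof -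
  let ?A = "{(j, k). j < k \<and> k < 2 * n}"
  let ?\<Omega> = "Pi_pmf (P \<times> {..<M}) 0 (\<lambda>(B, i). D B)"
  let ?bad = "\<lambda>p. {\<omega>. \<epsilon> \<le> \<bar>empirical_mean n P q M \<omega> p - m p\<bar>}"
  have A: "finite ?A" by (rule card_increasing_pairs)
  have finP: "finite P" using P A by (rule finite_elements[rotated])
  have bad: "measure_pmf.prob ?\<Omega> (?bad p) \<le> 2 * exp (- (real M * \<epsilon>\<^sup>2 / 2))" if "p \<in> ?A" for p
  proof -
    have "p \<in> \<Union> P"
      using that by (simp only: partition_onD1[OF P, symmetric])
    then obtain B where B: "B \<in> P" "p \<in> B"
      by (rule UnionE)
    \<comment> \<open>Disjointness of the partition makes the description inside
      \<open>empirical_mean\<close> refer to this \<open>B\<close>.\<close>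
    have the: "(THE B. B \<in> P \<and> p \<in> B) = B"
    proof (rule the_equality)
      fix B' assume "B' \<in> P \<and> p \<in> B'"
      then show "B' = B"
        using disjointD[OF partition_onD2[OF P], of B' B] B by (metis disjoint_iff)
    qed (use B in simp)
    have "(\<Sum>j\<in>{B} \<times> {..<M}. Z_outcome n (q p) (\<omega> j)) = (\<Sum>i<M. Z_outcome n (q p) (\<omega> (B, i)))" for \<omega>
    proof -
      have "{B} \<times> {..<M} = Pair B ` {..<M}" by auto
      then show ?thesis by (simp add: sum.reindex inj_on_def)
    qed
    then have mean_eq: "empirical_mean n P q M \<omega> p = (\<Sum>j\<in>{B} \<times> {..<M}. Z_outcome n (q p) (\<omega> j)) / real (card ({B} \<times> {..<M}))" for \<omega>
      by (simp add: empirical_mean_def the card_cartesian_product)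
    have Z_le: "\<bar>Z_outcome n k x\<bar> \<le> 1" for k x
      by (simp add: Z_outcome_def)
    show ?thesis
      unfolding mean_eq
      by (rule order_trans[OF hoeffding_Pi_pmf])
        (use finP B mean[OF B] \<open>M > 0\<close> \<open>0 \<le> \<epsilon>\<close> in \<open>auto simp: Z_le card_cartesian_product\<close>)
  qed
  have cardA: "card ?A = n * (2 * n - 1)"
    using card_increasing_pairs(2)[of "2 * n"] by simp
  have "measure_pmf.prob ?\<Omega> (\<Union>p\<in>?A. ?bad p) \<le> (\<Sum>p\<in>?A. measure_pmf.prob ?\<Omega> (?bad p))"
    by (rule measure_pmf.finite_measure_subadditive_finite[OF A]) auto
  also have "\<dots> \<le> (\<Sum>p\<in>?A. 2 * exp (- (real M * \<epsilon>\<^sup>2 / 2)))"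
    by (rule sum_mono) (rule bad)
  also have "\<dots> = real (n * (2 * n - 1)) * (2 * exp (- (real M * \<epsilon>\<^sup>2 / 2)))"
    by (simp add: cardA)
  finally have "measure_pmf.prob ?\<Omega> (\<Union>p\<in>?A. ?bad p) \<le> real (n * (2 * n - 1)) * (2 * exp (- (real M * \<epsilon>\<^sup>2 / 2)))" .
  moreover have "{\<omega>. \<forall>p. fst p < snd p \<and> snd p < 2 * n \<longrightarrow> \<bar>empirical_mean n P q M \<omega> p - m p\<bar> < \<epsilon>} =
      space (measure_pmf ?\<Omega>) - (\<Union>p\<in>?A. ?bad p)"
    by (auto simp: not_le split: prod.splits) (metis leD)
  ultimately show ?thesis
    by (simp add: measure_pmf.prob_compl[of "\<Union>p\<in>?A. ?bad p", simplified])
qed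

subsection \<open>Measurement schemes\<close>

text \<open>The circle method for a round-robin tournament. Players below \<open>2 * n - 1\<close>
  meet in the round given by their sum modulo \<open>2 * n - 1\<close>; player
  \<open>2 * n - 1\<close> meets \<open>j\<close> in round \<open>2 * j\<close>, where
  \<open>j\<close> would otherwise meet itself.\<close>

definition pair_colour :: "nat \<Rightarrow> nat \<times> nat \<Rightarrow> nat" where
  "pair_colour n p = (if snd p < 2 * n - 1 then (fst p + snd p) mod (2 * n - 1) else (2 * fst p) mod (2 * n - 1))"

lemma mod_less_twice: "x < 2 * m \<Longrightarrow> x mod m = (if x < m then x else x - m)" for x m :: nat
  by (simp add: le_mod_geq)

text \<open>No player has two games in one round. A shared player cancels from the congruence of the
  two sums; when only one pair contains the last player, this would make the two members of the
  other pair equal.\<close>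

lemma pair_colour_proper:
  assumes p: "j < k" "k < 2 * n" and p': "j' < k'" "k' < 2 * n"
    and colour: "pair_colour n (j, k) = pair_colour n (j', k')"
    and meet: "j = j' \<or> j = k' \<or> k = j' \<or> k = k'"
  shows "j = j' \<and> k = k'"
proof -
  obtain m where n: "n = Suc m" using p by (cases n) auto
  define r where "r = Suc (2 * m)"
  have r: "2 * n - 1 = r" "2 * n = Suc r" by (simp_all add: n r_def)
  have expand: "x mod r = (if x < r then x else x - r)" if "x < 2 * r" for x
    using that by (rule mod_less_twice)
  consider "k < r" "k' < r" | "k < r" "k' = r" | "k = r" "k' < r" | "k = r" "k' = r"
    using p p' r by linarith
  then show ?thesis
  proof cases
    case 1
    then have "(j + k) mod r = (j' + k') mod r" using colour by (simp add: pair_colour_def r)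
    then show ?thesis using 1 p p' meet expand[of "j + k"] expand[of "j' + k'"] by (auto split: if_splits)
  next
    case 2
    then have "(j + k) mod r = (2 * j') mod r" using colour by (simp add: pair_colour_def r)
    then show ?thesis using 2 p p' meet expand[of "j + k"] expand[of "2 * j'"] by (auto split: if_splits)
  next
    case 3
    then have "(2 * j) mod r = (j' + k') mod r" using colour by (simp add: pair_colour_def r)
    then show ?thesis using 3 p p' meet expand[of "2 * j"] expand[of "j' + k'"] by (auto split: if_splits)
  next
    case 4
    then have "(2 * j) mod r = (2 * j') mod r" using colour by (simp add: pair_colour_def r)
    then have "(if 2 * j < r then 2 * j else 2 * j - r) = (if 2 * j' < r then 2 * j' else 2 * j' - r)"
      using 4 p p' expand[of "2 * j"] expand[of "2 * j'"] by simp
    \<comment> \<open>Two games of the last player: \<open>r\<close> is odd, so doubling is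
      injective modulo \<open>r\<close>.\<close>
    then have "j = j'"
      unfolding r_def by (auto split: if_splits; presburger)
    then show ?thesis using 4 by simp
  qed
qed

definition round_robin_class :: "nat \<Rightarrow> nat \<Rightarrow> (nat \<times> nat) set" where
  "round_robin_class n r = {p. fst p < snd p \<and> snd p < 2 * n \<and> pair_colour n p = r}"

lemma round_robin_class_disjoint:
  assumes "p \<in> round_robin_class n r" "p' \<in> round_robin_class n r" "{fst p, snd p} \<inter> {fst p', snd p'} \<noteq> {}"
  shows "p = p'"
proof -
  have "fst p = fst p' \<or> fst p = snd p' \<or> snd p = fst p' \<or> snd p = snd p'"
    using assms(3) by blast
  moreover have "pair_colour n (fst p, snd p) = pair_colour n (fst p', snd p')"
    "fst p < snd p" "snd p < 2 * n" "fst p' < snd p'" "snd p' < 2 * n"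
    using assms(1,2) by (simp_all add: round_robin_class_def)
  ultimately have "fst p = fst p' \<and> snd p = snd p'"
    by (intro pair_colour_proper[of "fst p" "snd p" n "fst p'" "snd p'"])
  then show ?thesis by (simp add: prod_eq_iff)
qed

lemma pair_colour_less: "1 \<le> n \<Longrightarrow> pair_colour n p < 2 * n - 1"
  by (simp add: pair_colour_def)

lemma round_robin_class_finite: "finite (round_robin_class n r)"
  by (rule finite_subset[OF _ card_increasing_pairs(1)[of "2 * n"]]) (auto simp: round_robin_class_def)

lemma card_round_robin_class_le: "card (round_robin_class n r) \<le> n"
proof -
  let ?C = "round_robin_class n r"
  have "card (\<Union>p\<in>?C. {fst p, snd p}) = (\<Sum>p\<in>?C. card {fst p, snd p})"
    using round_robin_class_finite round_robin_class_disjoint by (intro card_UN_disjoint) blast+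
  also have "\<dots> = (\<Sum>p\<in>?C. 2)"
    by (intro sum.cong refl) (auto simp: round_robin_class_def)
  finally have "2 * card ?C = card (\<Union>p\<in>?C. {fst p, snd p})" by simp
  also have "\<dots> \<le> card {..<2 * n}"
    by (intro card_mono) (auto simp: round_robin_class_def)
  finally show ?thesis by simp
qed

text \<open>
  The classes are matchings, so they have at most \<open>n\<close> elements; as \<open>2 * n - 1\<close> of them cover all
  \<open>n * (2 * n - 1)\<close> pairs, each has exactly \<open>n\<close>.
\<close>

lemma card_round_robin_class:
  assumes n: "1 \<le> n" and r: "r < 2 * n - 1"
  shows "card (round_robin_class n r) = n"
proof (rule ccontr)
  assume "card (round_robin_class n r) \<noteq> n"
  then have less: "card (round_robin_class n r) < n"
    using card_round_robin_class_le[of n r] by simp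
  have "{(j, k). j < k \<and> k < 2 * n} = (\<Union>r<2 * n - 1. round_robin_class n r)"
    using pair_colour_less[OF n] by (auto simp: round_robin_class_def)
  then have "card {(j, k). j < k \<and> k < 2 * n} = (\<Sum>r<2 * n - 1. card (round_robin_class n r))"
    using round_robin_class_finite by (simp only:, intro card_UN_disjoint) (auto simp: round_robin_class_def)
  also have "\<dots> < (\<Sum>r<2 * n - 1. n)"
    using r less card_round_robin_class_le by (intro sum_strict_mono_ex1) auto
  also have "\<dots> = n * (2 * n - 1)" by simp
  finally show False
    using card_increasing_pairs(2)[of "2 * n"] by simp
qed

text \<open>A perfect matching relabels the Majorana indices so that the pair \<open>p\<close>
  becomes the two indices of qubit \<open>q p\<close>. The permutation matrix is orthogonal, hence
  implemented by a Gaussian unitary, and Z of that qubit becomes the observable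
  \<open>p\<close>.\<close>

lemma gaussian_for_matching:
  assumes q: "bij_betw q B {..<n}" and B: "\<And>p. p \<in> B \<Longrightarrow> fst p < snd p \<and> snd p < 2 * n"
    and disj: "\<And>p p'. p \<in> B \<Longrightarrow> p' \<in> B \<Longrightarrow> {fst p, snd p} \<inter> {fst p', snd p'} \<noteq> {} \<Longrightarrow> p = p'"
  shows "\<exists>G. gaussian_unitary n G \<and>
    (\<forall>p\<in>B. mat_adjoint G * on_qubit n (q p) pauli_Z * G = pair_observable n p)"
proof -
  \<comment> \<open>The members of \<open>p\<close> sit at positions \<open>2 * q p\<close> and
    \<open>2 * q p + 1\<close>; disjointness of the pairs makes the assignment injective.\<close>
  define s where "s i = (let p = inv_into B q (i div 2) in if even i then fst p else snd p)" for i
  have p: "inv_into B q i \<in> B" "q (inv_into B q i) = i" if "i < n" for i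
    using q that by (metis bij_betwE bij_betw_def inv_into_into lessThan_iff) (metis q that bij_betw_inv_into_right lessThan_iff)
  have s_q: "s (2 * q p) = fst p" "s (2 * q p + 1) = snd p" if "p \<in> B" for p
    using q that by (simp_all add: s_def bij_betw_inv_into_left)
  have s_less: "s i < 2 * n" if "i < 2 * n" for i
    using B[OF p(1)[of "i div 2"]] that by (auto simp: s_def Let_def)
  have s_inj: "i = j" if "i < 2 * n" "j < 2 * n" "s i = s j" for i j
  proof -
    let ?p = "inv_into B q (i div 2)" and ?p' = "inv_into B q (j div 2)"
    have i: "i div 2 < n" "j div 2 < n" using that by auto
    have "s i \<in> {fst ?p, snd ?p}" "s j \<in> {fst ?p', snd ?p'}" by (auto simp: s_def Let_def)
    then have "?p = ?p'" using disj[OF p(1)[OF i(1)] p(1)[OF i(2)]] that(3) by auto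
    then have div: "i div 2 = j div 2" using p(2) i by metis
    have "even i = even j"
      using that(3) B[OF p(1)[OF i(1)]] \<open>?p = ?p'\<close> by (auto simp: s_def Let_def split: if_splits)
    with div show ?thesis by (metis div_mult_mod_eq parity_cases)
  qed
  define Q where "Q = mat (2 * n) (2 * n) (\<lambda>(\<mu>, \<nu>). if \<nu> = s \<mu> then 1 else 0 :: real)"
  have Q: "real_orthogonal_mat (2 * n) Q"
    unfolding real_orthogonal_mat_rows
  proof (intro conjI allI impI)
    fix i j assume ij: "i < 2 * n" "j < 2 * n"
    have "(\<Sum>k<2 * n. Q $$ (i, k) * Q $$ (j, k)) = (\<Sum>k<2 * n. if k = s i then (if s i = s j then 1 else 0) else 0)"
      using ij by (intro sum.cong) (auto simp: Q_def)
    then show "(\<Sum>k<2 * n. Q $$ (i, k) * Q $$ (j, k)) = (if i = j then 1 else 0)"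
      using ij s_less[of i] s_inj[of i j] by auto
  qed (simp add: Q_def)
  obtain G where G: "implements n G Q" using orthogonal_implementable[OF Q] by blast
  have Gc: "G \<in> carrier_mat (2 ^ n) (2 ^ n)" using G by (simp add: implements_def unitary_mat_def)
  have row: "majorana_lin n (\<lambda>\<nu>. Q $$ (i, \<nu>)) = majorana n (s i)" if "i < 2 * n" for i
    unfolding majorana_lin_delta[OF s_less[OF that], symmetric]
    using that by (intro majorana_lin_cong) (simp add: Q_def)
  have "mat_adjoint G * on_qubit n (q p) pauli_Z * G = pair_observable n p" if "p \<in> B" for p
  proof -
    let ?d = "2 ^ n :: nat"
    have k: "q p < n" using q that by (auto simp: bij_betw_def)
    let ?A = "majorana n (2 * q p) * majorana n (2 * q p + 1)"
    have A: "?A \<in> carrier_mat ?d ?d" using k by (intro mult_carrier_mat[of _ _ ?d]) auto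
    have "mat_adjoint G * on_qubit n (q p) pauli_Z * G = - \<i> \<cdot>\<^sub>m (mat_adjoint G * ?A * G)"
      using A Gc k by (simp add: on_qubit_Z_eq_pair_observable pair_observable_def mult_smult_distrib[of _ ?d ?d _ ?d]
          mult_smult_assoc_mat[of _ ?d ?d _ ?d] mult_carrier_mat[of _ ?d ?d])
    also have "mat_adjoint G * ?A * G = majorana n (fst p) * majorana n (snd p)"
      using k s_q[OF that] by (subst implements_conj_mult[OF G]) (simp_all add: row)
    finally show ?thesis by (simp add: pair_observable_def)
  qed
  with G Q show ?thesis by (auto simp: gaussian_unitary_iff)
qed

lemma conjugated_commute:
  assumes U: "unitary_mat d G" and c: "A \<in> carrier_mat d d" "B \<in> carrier_mat d d" and AB: "A * B = B * A"
  shows "(mat_adjoint G * A * G) * (mat_adjoint G * B * G) = (mat_adjoint G * B * G) * (mat_adjoint G * A * G)"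
proof -
  note assoc = assoc_mult_mat[of _ d d _ d _ d]
  have G: "G \<in> carrier_mat d d" "mat_adjoint G \<in> carrier_mat d d" "G * mat_adjoint G = 1\<^sub>m d"
    using U by (auto simp: unitary_mat_def)
  have "(mat_adjoint G * X * G) * (mat_adjoint G * Y * G) = mat_adjoint G * (X * Y) * G"
    if XY: "X \<in> carrier_mat d d" "Y \<in> carrier_mat d d" for X Y
  proof -
    have "(mat_adjoint G * X * G) * (mat_adjoint G * Y * G) = mat_adjoint G * X * ((G * mat_adjoint G) * Y) * G"
      using G(1,2) XY by (simp add: assoc mult_carrier_mat[of _ d d])
    also have "\<dots> = mat_adjoint G * (X * Y) * G"
      unfolding G(3) using G(1,2) XY by (simp add: assoc mult_carrier_mat[of _ d d] left_mult_one_mat[of _ d d])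
    finally show ?thesis .
  qed
  from this[OF c] this[OF c(2,1)] AB show ?thesis by simp
qed

text \<open>The rounds of the tournament serve as the commuting sets. They are nonempty, so
  different rounds are different sets and there are \<open>2 * n - 1\<close> of them.\<close>

lemma measurement_scheme_exists:
  assumes n: "1 \<le> n"
  shows "\<exists>P G q. measurement_scheme n P G q"
proof -
  let ?C = "round_robin_class n"
  let ?A = "{(j, k). j < k \<and> k < 2 * n}"
  define P where "P = ?C ` {..<2 * n - 1}"
  have ne: "?C r \<noteq> {}" if "r < 2 * n - 1" for r
    using card_round_robin_class[OF n that] n by auto
  have colour: "pair_colour n p = r" if "p \<in> ?C r" for p r
    using that by (simp add: round_robin_class_def)
  have inj: "inj_on ?C {..<2 * n - 1}"
  proof (rule inj_onI)
    fix r r' assume "r \<in> {..<2 * n - 1}" and eq: "?C r = ?C r'"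
    then obtain p where "p \<in> ?C r" using ne by blast
    with eq colour show "r = r'" by metis
  qed
  have part: "partition_on ?A P"
  proof (rule partition_onI)
    show "\<Union> P = ?A"
      using pair_colour_less[OF n] by (auto simp: P_def round_robin_class_def)
    show "{} \<notin> P"
      using ne by (auto simp: P_def)
    show "disjnt p p'" if pp: "p \<in> P" "p' \<in> P" "p \<noteq> p'" for p p'
    proof -
      obtain r r' where "p = ?C r" "p' = ?C r'" using pp by (auto simp: P_def)
      with pp(3) colour show ?thesis unfolding disjnt_iff by metis
    qed
  qed
  have cardP: "card P = 2 * n - 1"
    unfolding P_def using inj by (simp add: card_image)
  have "\<exists>h. bij_betw h (?C r) {..<n}" if "r < 2 * n - 1" for r
    using ex_bij_betw_finite_nat[OF round_robin_class_finite[of n r]]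
    unfolding card_round_robin_class[OF n that] lessThan_atLeast0 .
  then obtain h where h: "\<And>r. r < 2 * n - 1 \<Longrightarrow> bij_betw (h r) (?C r) {..<n}"
    by metis
  \<comment> \<open>A pair lies in the class of its own colour only, so the bijections chosen per
    class glue to one function.\<close>
  define q where "q p = h (pair_colour n p) p" for p
  have q: "bij_betw q (?C r) {..<n}" if "r < 2 * n - 1" for r
    using h[OF that] colour by (subst bij_betw_cong[of _ _ "h r"]) (auto simp: q_def)
  have "\<exists>G. gaussian_unitary n G \<and> (\<forall>p\<in>B. mat_adjoint G * on_qubit n (q p) pauli_Z * G = pair_observable n p)"
    if BP: "B \<in> P" for B
  proof -
    obtain r where r: "r < 2 * n - 1" "B = ?C r" using BP by (auto simp: P_def)
    show ?thesis
      unfolding r(2)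
    proof (rule gaussian_for_matching[OF q[OF r(1)]])
      show "fst p < snd p \<and> snd p < 2 * n" if "p \<in> ?C r" for p
        using that by (simp add: round_robin_class_def)
      show "p = p'" if "p \<in> ?C r" "p' \<in> ?C r" "{fst p, snd p} \<inter> {fst p', snd p'} \<noteq> {}" for p p'
        using that by (rule round_robin_class_disjoint)
    qed
  qed
  then obtain G where G: "\<And>B. B \<in> P \<Longrightarrow> gaussian_unitary n (G B)"
    "\<And>B p. B \<in> P \<Longrightarrow> p \<in> B \<Longrightarrow> mat_adjoint (G B) * on_qubit n (q p) pauli_Z * G B = pair_observable n p"
    by metis
  have "measurement_scheme n P G q"
    unfolding measurement_scheme_def
  proof (intro conjI ballI part cardP G)
    fix B assume B: "B \<in> P"
    then obtain r where r: "r < 2 * n - 1" "B = ?C r" by (auto simp: P_def)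
    show "card B = n" using card_round_robin_class[OF n r(1)] r(2) by simp
    show bij: "bij_betw q B {..<n}" using q[OF r(1)] r(2) by simp
    fix p p' assume p: "p \<in> B" "p' \<in> B"
    have lt: "q p < n" "q p' < n" using bij p by (auto simp: bij_betw_def)
    \<comment> \<open>Within a set all observables are conjugates of Z operators by the same
      unitary, so they inherit commutation.\<close>
    have "on_qubit n (q p) pauli_Z * on_qubit n (q p') pauli_Z = on_qubit n (q p') pauli_Z * on_qubit n (q p) pauli_Z"
      using lt by (cases "q p = q p'") (auto intro: on_qubit_commute)
    then show "pair_observable n p * pair_observable n p' = pair_observable n p' * pair_observable n p"
      unfolding G(2)[OF B p(1), symmetric] G(2)[OF B p(2), symmetric]
      using G(1)[OF B] lt by (intro conjugated_commute[of "2 ^ n"]) (auto simp: gaussian_unitary_def)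
  qed
  then show ?thesis by blast
qed

text \<open>Born's rule in the rotated basis gives the expectation of Z; pulling it back through
  \<open>G B\<close> gives that of the observable.\<close>

lemma measurement_scheme_mean:
  assumes scheme: "measurement_scheme n P G q" and B: "B \<in> P" "p \<in> B" and \<psi>: "pure_state n \<psi>"
  shows "measure_pmf.expectation (measure_basis (G B *\<^sub>v \<psi>)) (Z_outcome n (q p)) = corr n \<psi> $$ p"
proof -
  let ?d = "2 ^ n :: nat"
  have part: "partition_on {(j, k). j < k \<and> k < 2 * n} P" and q: "bij_betw q B {..<n}"
    and Z: "mat_adjoint (G B) * on_qubit n (q p) pauli_Z * G B = pair_observable n p"
    and U: "unitary_mat ?d (G B)"
    using scheme B unfolding measurement_scheme_def gaussian_unitary_def by auto
  have "p \<in> {(j, k). j < k \<and> k < 2 * n}"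
    using partition_onD1[OF part] B by blast
  then obtain j k where p: "p = (j, k)" "j < 2 * n" "k < 2 * n" by auto
  have G: "G B \<in> carrier_mat ?d ?d" "mat_adjoint (G B) * G B = 1\<^sub>m ?d"
    using U by (auto simp: unitary_mat_def)
  have \<psi>c: "\<psi> \<in> carrier_vec ?d" "\<psi> \<bullet>c \<psi> = 1" using \<psi> by (auto simp: pure_state_def)
  have v: "G B *\<^sub>v \<psi> \<in> carrier_vec ?d" using G \<psi>c by (simp add: mult_mat_vec_carrier[of _ ?d ?d])
  have "expect (G B *\<^sub>v \<psi>) (1\<^sub>m ?d) = expect \<psi> (mat_adjoint (G B) * 1\<^sub>m ?d * G B)"
    using \<psi>c G by (intro expect_conj[of _ ?d]) auto
  then have unit: "(G B *\<^sub>v \<psi>) \<bullet>c (G B *\<^sub>v \<psi>) = 1"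
    using G \<psi>c v by (simp add: expect_def right_mult_one_mat[of _ ?d ?d])
  have k: "q p < n" using q B by (auto simp: bij_betw_def)
  have "measure_pmf.expectation (measure_basis (G B *\<^sub>v \<psi>)) (Z_outcome n (q p)) =
      Re (expect (G B *\<^sub>v \<psi>) (on_qubit n (q p) pauli_Z))"
    by (simp add: measure_basis_expectation[OF v unit] expect_on_qubit_Z[OF v k])
  also have "\<dots> = Re (expect \<psi> (pair_observable n p))"
    using \<psi>c G k by (simp add: expect_conj[of _ ?d] Z)
  also have "\<dots> = corr n \<psi> $$ p"
    using p by (simp add: corr_def)
  finally show ?thesis .
qed

subsection \<open>Distance to the compressible states\<close>

lemma nrm_ip: "nrm d x = sqrt (ip d x x)"
  by (simp add: nrm_def L2_set_def ip_def power2_eq_square)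

lemma ip_mv: "ip d y (mv d A x) = bilin d A y x"
  by (simp add: ip_def mv_def bilin_def sum_distrib_left mult.assoc)

text \<open>Testing the form bound on y = (A - B) x gives |y|^2 \<le> c |y| |x|; one factor |y| is
  divided out.\<close>

lemma nrm_mv_diff_bilin:
  assumes "\<And>y x. bilin d A y x - bilin d B y x \<le> c * (nrm d y * nrm d x)" "0 \<le> c"
  shows "nrm d (mv d A x) \<le> nrm d (mv d B x) + c * nrm d x"
proof -
  define y where "y i = mv d A x i - mv d B x i" for i
  have "nrm d (mv d A x) = nrm d (\<lambda>i. mv d B x i + y i)"
    by (rule nrm_cong) (simp add: y_def)
  also have "\<dots> \<le> nrm d (mv d B x) + nrm d y"
    unfolding nrm_def by (rule L2_set_triangle_ineq)
  also have "nrm d y \<le> c * nrm d x"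
  proof (cases "nrm d y = 0")
    case True
    then show ?thesis using assms(2) nrm_nonneg[of d x] by simp
  next
    case False
    then have pos: "0 < nrm d y" using nrm_nonneg[of d y] by simp
    have "nrm d y * nrm d y = ip d y y"
      using ip_self_nonneg[of d y] by (simp add: nrm_ip)
    also have "\<dots> = ip d y (\<lambda>i. 1 * mv d A x i + (- 1) * mv d B x i)"
      by (rule ip_cong) (simp_all add: y_def)
    also have "\<dots> = bilin d A y x - bilin d B y x"
      unfolding ip_lincomb_right ip_mv by simp
    also have "\<dots> \<le> nrm d y * (c * nrm d x)"
      using assms(1)[of y x] by (simp add: ac_simps)
    finally show ?thesis using pos by simp
  qed
  finally show ?thesis by simp
qed

lemma trace_distance_pure:
  assumes "pure_state n \<psi>" "pure_state n \<phi>"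
  shows "trace_distance (density \<psi>) (density \<phi>) = sqrt (1 - (cmod (\<psi> \<bullet>c \<phi>))\<^sup>2)"
    and "0 \<le> trace_distance (density \<psi>) (density \<phi>)"
proof -
  have *: "trace_distance (density \<psi>) (density \<phi>) = sqrt (1 - (cmod (\<psi> \<bullet>c \<phi>))\<^sup>2)" "cmod (\<psi> \<bullet>c \<phi>) \<le> 1"
    using trace_distance_density[of \<psi> "2 ^ n" \<phi>] assms by (auto simp: pure_state_def)
  then show "trace_distance (density \<psi>) (density \<phi>) = sqrt (1 - (cmod (\<psi> \<bullet>c \<phi>))\<^sup>2)"
    "0 \<le> trace_distance (density \<psi>) (density \<phi>)" by (simp_all add: abs_square_le_1)
qed

lemma nrm_mv_corr_diff:
  assumes "pure_state n \<psi>" "pure_state n \<phi>"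
  shows "nrm (2 * n) (mv (2 * n) (corr n \<phi>) x) \<le>
    nrm (2 * n) (mv (2 * n) (corr n \<psi>) x) + 2 * trace_distance (density \<psi>) (density \<phi>) * nrm (2 * n) x"
proof (rule nrm_mv_diff_bilin)
  fix y x
  show "bilin (2 * n) (corr n \<phi>) y x - bilin (2 * n) (corr n \<psi>) y x \<le>
      2 * trace_distance (density \<psi>) (density \<phi>) * (nrm (2 * n) y * nrm (2 * n) x)"
    using corr_diff_le[OF assms, of y x] by (simp add: nrm_ip)
qed (use trace_distance_pure(2)[OF assms] in simp)

section \<open>Padded states and their correlation matrices\<close>

lemma cscalar_prod_sum:
  fixes v w :: "complex vec"
  assumes "v \<in> carrier_vec d" "w \<in> carrier_vec d"
  shows "v \<bullet>c w = (\<Sum>i<d. v $ i * cnj (w $ i))"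
  using assms by (auto simp: scalar_prod_def lessThan_atLeast0)

lemma unitary_cscalar_prod:
  assumes U: "unitary_mat d U" and v: "v \<in> carrier_vec d" "w \<in> carrier_vec d"
  shows "(U *\<^sub>v v) \<bullet>c w = v \<bullet>c (mat_adjoint U *\<^sub>v w)" "(U *\<^sub>v v) \<bullet>c (U *\<^sub>v w) = v \<bullet>c w"
proof -
  have Uc: "U \<in> carrier_mat d d" "mat_adjoint U \<in> carrier_mat d d" "mat_adjoint U * U = 1\<^sub>m d"
    using U by (auto simp: unitary_mat_def)
  have adj: "(U *\<^sub>v v) \<bullet>c w' = v \<bullet>c (mat_adjoint U *\<^sub>v w')" if "w' \<in> carrier_vec d" for w'
    using Uc v that by (intro cscalar_prod_mult_mat_vec[of _ d d]) auto
  show "(U *\<^sub>v v) \<bullet>c w = v \<bullet>c (mat_adjoint U *\<^sub>v w)"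
    using v(2) by (rule adj)
  have "mat_adjoint U *\<^sub>v (U *\<^sub>v w) = w"
    using Uc v by (simp flip: assoc_mult_mat_vec[of _ d d _ d])
  then show "(U *\<^sub>v v) \<bullet>c (U *\<^sub>v w) = v \<bullet>c w"
    using adj[of "U *\<^sub>v w"] Uc v by (simp add: mult_mat_vec_carrier[of _ d d])
qed

lemma pure_state_unitary: "unitary_mat (2 ^ n) U \<Longrightarrow> pure_state n \<psi> \<Longrightarrow> pure_state n (U *\<^sub>v \<psi>)"
  using unitary_cscalar_prod(2)[of "2 ^ n" U \<psi> \<psi>]
  by (auto simp: pure_state_def unitary_mat_def intro: mult_mat_vec_carrier[of _ "2 ^ n" "2 ^ n"])

abbreviation pad_zeros :: "nat \<Rightarrow> nat \<Rightarrow> complex vec \<Rightarrow> complex vec" where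
  "pad_zeros n t \<phi> \<equiv> kron_vec \<phi> (unit_vec (2 ^ (n - t)) 0)"

lemma pad_zeros_carrier:
  assumes "t \<le> n" "\<phi> \<in> carrier_vec (2 ^ t)"
  shows "pad_zeros n t \<phi> \<in> carrier_vec (2 ^ n)"
proof -
  have "(2::nat) ^ t * 2 ^ (n - t) = 2 ^ n" using assms by (simp flip: power_add)
  then show ?thesis using assms by (simp add: kron_vec_def)
qed

lemma pad_zeros_index:
  assumes "t \<le> n" "\<phi> \<in> carrier_vec (2 ^ t)" "x < 2 ^ n"
  shows "pad_zeros n t \<phi> $ x = (if x mod 2 ^ (n - t) = 0 then \<phi> $ (x div 2 ^ (n - t)) else 0)"
proof -
  have "(2::nat) ^ t * 2 ^ (n - t) = 2 ^ n" using assms by (simp flip: power_add)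
  then show ?thesis using assms by (auto simp: kron_vec_def)
qed

lemma sum_pad_zeros:
  fixes f :: "nat \<Rightarrow> 'a::comm_monoid_add"
  assumes "t \<le> n"
  shows "(\<Sum>x<2 ^ n. if x mod 2 ^ (n - t) = 0 then f (x div 2 ^ (n - t)) else 0) = (\<Sum>a<2 ^ t. f a)"
proof -
  have "(2::nat) ^ t * 2 ^ (n - t) = 2 ^ n" using assms by (simp flip: power_add)
  then show ?thesis
    using sum_div_mod[where f = "\<lambda>a b. if b = 0 then f a else 0" and a = "2 ^ t" and b = "2 ^ (n - t)"] by simp
qed

lemma pure_state_pad_zeros:
  assumes "t \<le> n" "pure_state t \<phi>"
  shows "pure_state n (pad_zeros n t \<phi>)"
proof -
  let ?\<chi> = "pad_zeros n t \<phi>"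
  have \<phi>: "\<phi> \<in> carrier_vec (2 ^ t)" "\<phi> \<bullet>c \<phi> = 1" using assms by (auto simp: pure_state_def)
  have \<chi>: "?\<chi> \<in> carrier_vec (2 ^ n)" using assms(1) \<phi>(1) by (rule pad_zeros_carrier)
  have "?\<chi> \<bullet>c ?\<chi> = (\<Sum>x<2 ^ n. if x mod 2 ^ (n - t) = 0 then \<phi> $ (x div 2 ^ (n - t)) * cnj (\<phi> $ (x div 2 ^ (n - t))) else 0)"
    unfolding cscalar_prod_sum[OF \<chi> \<chi>] by (intro sum.cong refl) (simp add: pad_zeros_index[OF assms(1) \<phi>(1)])
  also have "\<dots> = \<phi> \<bullet>c \<phi>"
    unfolding cscalar_prod_sum[OF \<phi>(1) \<phi>(1)] by (rule sum_pad_zeros[OF assms(1)])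
  finally show ?thesis using \<chi> \<phi> by (simp add: pure_state_def)
qed

lemma pure_state_unit_vec: "pure_state t (unit_vec (2 ^ t) 0)"
proof -
  have "(\<Sum>i<2 ^ t. unit_vec (2 ^ t) 0 $ i * cnj (unit_vec (2 ^ t) 0 $ i)) = (\<Sum>i::nat<2 ^ t. if i = 0 then 1 else 0 :: complex)"
    by (intro sum.cong) (auto simp: unit_vec_def)
  then show ?thesis by (simp add: pure_state_def cscalar_prod_sum[of _ "2 ^ t"])
qed

lemma compressible_gaussian_pure:
  assumes "t \<le> n" "\<phi> \<in> compressible_gaussian n t"
  shows "pure_state n \<phi>"
  using assms by (auto simp: compressible_gaussian_def gaussian_unitary_def intro: pure_state_unitary pure_state_pad_zeros)

lemma corr_diag_eq_expect_Z:
  assumes "\<psi> \<in> carrier_vec (2 ^ n)" "k < n"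
  shows "corr n \<psi> $$ (2 * k, 2 * k + 1) = (\<Sum>x<2 ^ n. Z_outcome n k x * (cmod (\<psi> $ x))\<^sup>2)"
proof -
  have "corr n \<psi> $$ (2 * k, 2 * k + 1) = Re (expect \<psi> (on_qubit n k pauli_Z))"
    using assms(2) by (simp add: corr_def on_qubit_Z_eq_pair_observable)
  then show ?thesis using expect_on_qubit_Z[OF assms] by simp
qed

lemma sum_cmod_pure_state:
  assumes "pure_state n \<psi>"
  shows "(\<Sum>x<2 ^ n. (cmod (\<psi> $ x))\<^sup>2) = 1"
proof -
  have "\<psi> \<in> carrier_vec (2 ^ n)" "\<psi> \<bullet>c \<psi> = 1" using assms by (auto simp: pure_state_def)
  then have "complex_of_real (\<Sum>x<2 ^ n. (cmod (\<psi> $ x))\<^sup>2) = complex_of_real 1"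
    by (simp only: of_real_sum complex_norm_square cscalar_prod_sum of_real_1)
  then show ?thesis by (simp only: of_real_eq_iff)
qed

text \<open>For the column y, the form on y and the basis vector \<open>e\<close> is |y|^2, while
  the operator bound gives at most |y|.\<close>

lemma corr_column_le:
  assumes \<psi>: "pure_state n \<psi>" and k: "k < 2 * n"
  shows "(\<Sum>i<2 * n. (corr n \<psi> $$ (i, k))\<^sup>2) \<le> 1"
proof -
  have c: "\<psi> \<in> carrier_vec (2 ^ n)" "\<psi> \<bullet>c \<psi> = 1" using \<psi> by (auto simp: pure_state_def)
  define y where "y i = corr n \<psi> $$ (i, k)" for i
  define e where "e i = (if i = k then 1 else 0 :: real)" for i
  have e: "ip (2 * n) e e = 1" using k by (simp add: ip_def e_def if_distrib[of "\<lambda>a. a * _"] cong: if_cong)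
  have "bilin (2 * n) (corr n \<psi>) y e = ip (2 * n) y y"
    unfolding ip_mv[symmetric] using k
    by (intro ip_cong) (simp_all add: mv_def e_def y_def if_distrib[of "\<lambda>a. _ * a"] cong: if_cong)
  then have "ip (2 * n) y y \<le> cmod (expect \<psi> (majorana_lin n y * majorana_lin n e))"
    using bilin_corr[OF c(1), of y e] abs_Re_le_cmod[of "- \<i> * expect \<psi> (majorana_lin n y * majorana_lin n e)"]
    by (simp add: norm_mult)
  also have "\<dots> \<le> sqrt (ip (2 * n) y y)"
    using bilinear_form_majorana_le[OF c(1) c(1), of y e] c(2) e by (simp add: expect_def)
  finally have "(sqrt (ip (2 * n) y y))\<^sup>2 \<le> sqrt (ip (2 * n) y y)"
    using ip_self_nonneg[of "2 * n" y] by simp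
  then have "sqrt (ip (2 * n) y y) \<le> 1"
    using mult_strict_left_mono[of 1 "sqrt (ip (2 * n) y y)" "sqrt (ip (2 * n) y y)"]
    unfolding power2_eq_square by linarith
  then show ?thesis by (simp add: ip_def y_def power2_eq_square)
qed

text \<open>Each padded qubit has Z expectation 1, which puts an entry of modulus 1 into each of its
  two columns. Columns have length at most 1, so every other entry there is 0.\<close>

lemma corr_pad_zeros:
  assumes t: "t \<le> n" and \<phi>: "pure_state t \<phi>" and ij: "i < 2 * n" "2 * t \<le> j" "j < 2 * n"
  shows "corr n (pad_zeros n t \<phi>) $$ (i, j) = normal_form n (\<lambda>_. 1) $$ (i, j)"
proof -
  let ?\<chi> = "pad_zeros n t \<phi>"
  have \<chi>: "pure_state n ?\<chi>" using t \<phi> by (rule pure_state_pad_zeros)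
  have \<phi>c: "\<phi> \<in> carrier_vec (2 ^ t)" and \<chi>c: "?\<chi> \<in> carrier_vec (2 ^ n)" using \<phi> \<chi> by (auto simp: pure_state_def)
  define k where "k = j div 2"
  have k: "t \<le> k" "k < n" using ij by (auto simp: k_def)
  have "corr n ?\<chi> $$ (2 * k, 2 * k + 1) = (\<Sum>x<2 ^ n. (cmod (?\<chi> $ x))\<^sup>2)"
    unfolding corr_diag_eq_expect_Z[OF \<chi>c k(2)]
  proof (rule sum.cong[OF refl])
    fix x :: nat assume x: "x \<in> {..<2 ^ n}"
    show "Z_outcome n k x * (cmod (?\<chi> $ x))\<^sup>2 = (cmod (?\<chi> $ x))\<^sup>2"
    proof (cases "x mod 2 ^ (n - t) = 0")
      case True
      \<comment> \<open>Qubit \<open>k \<ge> t\<close> is one of the lowest \<open>n - t\<close>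
        bits, all zero in the support of the padded state.\<close>
      have "n - t = (n - k - 1) + Suc (k - t)" using k by simp
      then have "(2::nat) ^ (n - t) = 2 ^ (n - k - 1) * (2 * 2 ^ (k - t))"
        by (simp only: power_add power_Suc)
      with True obtain a where "x = 2 ^ (n - k - 1) * (2 * 2 ^ (k - t)) * a"
        by (metis mod_eq_0_iff_dvd dvdE)
      then have "x div 2 ^ (n - k - 1) = 2 * (2 ^ (k - t) * a)" by (simp add: mult.assoc)
      then show ?thesis by (simp add: Z_outcome_def)
    next
      case False
      then show ?thesis using x by (simp add: pad_zeros_index[OF t \<phi>c])
    qed
  qed
  then have one: "corr n ?\<chi> $$ (2 * k, 2 * k + 1) = 1"
    using sum_cmod_pure_state[OF \<chi>] by simp
  have anti: "corr n ?\<chi> $$ (a, b) = - corr n ?\<chi> $$ (b, a)" if "a < 2 * n" "b < 2 * n" for a b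
    using corr_antisymmetric[OF \<chi>c] that unfolding antisymmetric_mat_def by blast
  have pj: "partner j < 2 * n" using ij(3) by (rule partner_less)
  have partner_entry: "corr n ?\<chi> $$ (partner j, j) = (if even j then - 1 else 1)"
  proof (rule nat_parity_cases[of j])
    fix m assume "j = 2 * m"
    then show ?thesis using one anti[of "2 * k + 1" "2 * k"] k by (simp add: k_def)
  next
    fix m assume "j = Suc (2 * m)"
    then show ?thesis using one by (simp add: k_def)
  qed
  show ?thesis
  proof (cases "i = partner j")
    case True
    then have "j = partner i" by (metis eq_partner_iff)
    moreover have "even i \<longleftrightarrow> odd j" using True by (simp add: partner_even)
    ultimately show ?thesis using partner_entry True ij by (simp add: normal_form_index)
  next
    case False
    then have "j \<noteq> partner i" by (metis eq_partner_iff)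
    moreover have "corr n ?\<chi> $$ (i, j) = 0"
    proof -
      have "(corr n ?\<chi> $$ (i, j))\<^sup>2 + (corr n ?\<chi> $$ (partner j, j))\<^sup>2 = (\<Sum>a\<in>{i, partner j}. (corr n ?\<chi> $$ (a, j))\<^sup>2)"
        using False by simp
      also have "\<dots> \<le> (\<Sum>a<2 * n. (corr n ?\<chi> $$ (a, j))\<^sup>2)"
        using ij pj by (intro sum_mono2) auto
      also have "\<dots> \<le> 1" using corr_column_le[OF \<chi> ij(3)] .
      finally show ?thesis using partner_entry by (auto split: if_splits)
    qed
    ultimately show ?thesis using ij by (simp add: normal_form_index)
  qed
qed

text \<open>The comparison matrix is that of \<open>\<phi>\<close>. Passing from it to
  \<open>\<psi>\<close> costs twice the trace distance, passing on to the estimate costs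
  \<open>2 * real n * \<epsilon>\<close>.\<close>

lemma normal_eigenvalues_near_compressible:
  assumes t: "t < n" and \<psi>: "pure_state n \<psi>" and \<phi>: "\<phi> \<in> compressible_gaussian n t"
    and A: "antisymmetric_mat (2 * n) A"
    and err: "\<And>i j. i < 2 * n \<Longrightarrow> j < 2 * n \<Longrightarrow> \<bar>A $$ (i, j) - corr n \<psi> $$ (i, j)\<bar> \<le> \<epsilon>" and "0 \<le> \<epsilon>"
  shows "1 - (2 * trace_distance (density \<psi>) (density \<phi>) + 2 * real n * \<epsilon>) \<le> normal_eigenvalues A ! t"
proof -
  let ?d = "2 * n"
  have tn: "t \<le> n" using t by simp
  obtain G \<phi>\<^sub>t Q where G: "implements n G Q" and Q: "real_orthogonal_mat ?d Q" and \<phi>\<^sub>t: "pure_state t \<phi>\<^sub>t"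
    and \<phi>_eq: "\<phi> = G *\<^sub>v pad_zeros n t \<phi>\<^sub>t"
    using \<phi> unfolding compressible_gaussian_def gaussian_unitary_iff by blast
  have pure: "pure_state n \<phi>" using tn \<phi> by (rule compressible_gaussian_pure)
  have \<phi>c: "\<phi> \<in> carrier_vec (2 ^ n)" using pure by (simp add: pure_state_def)
  have U: "G \<in> carrier_mat (2 ^ n) (2 ^ n)" "mat_adjoint G \<in> carrier_mat (2 ^ n) (2 ^ n)" "mat_adjoint G * G = 1\<^sub>m (2 ^ n)"
    using G by (auto simp: implements_def unitary_mat_def)
  have \<chi>c: "pad_zeros n t \<phi>\<^sub>t \<in> carrier_vec (2 ^ n)"
    using pure_state_pad_zeros[OF tn \<phi>\<^sub>t] by (simp add: pure_state_def)
  have undo: "mat_adjoint G *\<^sub>v \<phi> = pad_zeros n t \<phi>\<^sub>t"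
    using U \<chi>c by (simp add: \<phi>_eq flip: assoc_mult_mat_vec[of _ "2 ^ n" "2 ^ n" _ "2 ^ n"])
  have QT: "real_orthogonal_mat ?d (transpose_mat Q)" using Q by (rule real_orthogonal_mat_transpose)
  have QTc: "transpose_mat Q \<in> carrier_mat ?d ?d" using QT by (simp add: real_orthogonal_mat_def)
  have conj: "transpose_mat Q * corr n \<phi> * transpose_mat (transpose_mat Q) = corr n (pad_zeros n t \<phi>\<^sub>t)"
    using corr_covariance[OF implements_adjoint[OF G Q] QTc \<phi>c] by (simp add: undo)
  show ?thesis
  proof (rule normal_eigenvalues_ge[OF A corr_carrier QTc t])
    fix x assume x: "\<And>i. i < 2 * t \<Longrightarrow> mv ?d (transpose_mat Q) x i = 0"
    let ?y = "mv ?d (transpose_mat Q) x"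
    \<comment> \<open>The first \<open>2 * t\<close> coordinates of \<open>?y\<close> vanish, so
      only the columns of the padded qubits contribute; the unknown block of
      \<open>\<phi>\<^sub>t\<close> is never seen.\<close>
    have "mv ?d (corr n (pad_zeros n t \<phi>\<^sub>t)) ?y i = mv ?d (normal_form n (\<lambda>_. 1)) ?y i" if "i < ?d" for i
      unfolding mv_def[of _ _ ?y] using x that corr_pad_zeros[OF tn \<phi>\<^sub>t that]
      by (intro sum.cong refl) (metis lessThan_iff linorder_not_le mult_zero_right)
    then have "nrm ?d (mv ?d (corr n \<phi>) x) = nrm ?d (mv ?d (normal_form n (\<lambda>_. 1)) ?y)"
      using nrm_mv_conj[OF QT corr_carrier conj, of x] by (simp cong: nrm_cong)
    moreover have "1 * nrm ?d ?y \<le> nrm ?d (mv ?d (normal_form n (\<lambda>_. 1)) ?y)"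
      using nrm_normal_form_ge[of n "\<lambda>_. 1" t ?y] t x by simp
    ultimately show "1 * nrm ?d x \<le> nrm ?d (mv ?d (corr n \<phi>) x)"
      by (simp add: nrm_mv_orthogonal[OF QT])
  next
    fix x
    have "nrm ?d (mv ?d (corr n \<psi>) x) \<le> nrm ?d (mv ?d A x) + real ?d * \<epsilon> * nrm ?d x"
      using err \<open>0 \<le> \<epsilon>\<close> by (intro nrm_mv_diff_entries) (simp_all add: abs_minus_commute)
    then show "nrm ?d (mv ?d (corr n \<phi>) x) \<le> nrm ?d (mv ?d A x) +
        (2 * trace_distance (density \<psi>) (density \<phi>) + 2 * real n * \<epsilon>) * nrm ?d x"
      using nrm_mv_corr_diff[OF \<psi> pure, of x] by (simp add: distrib_right)
  qed
qed

lemma mod_power2_eq_0_iff: "(\<forall>i<m. even (x div 2 ^ i)) \<Longrightarrow> x mod 2 ^ m = 0" for x m :: nat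
proof (induction m)
  case (Suc m)
  then have "2 ^ m dvd x" "even (x div 2 ^ m)" by auto
  then show ?case by (metis dvd_div_iff_mult mod_eq_0_iff_dvd mult.commute power_Suc power_not_zero zero_neq_numeral)
qed simp

text \<open>
  Projecting the last \<open>n - t\<close> qubits onto zero: by the union bound the discarded weight is at most the sum
  of the weights on which a single qubit is one.
\<close>

lemma exists_compressed_overlap:
  assumes t: "t \<le> n" and \<psi>: "pure_state n \<psi>"
  shows "\<exists>\<phi>. pure_state t \<phi> \<and>
    1 - (cmod (\<psi> \<bullet>c pad_zeros n t \<phi>))\<^sup>2 \<le> (\<Sum>k = t..<n. (1 - corr n \<psi> $$ (2 * k, 2 * k + 1)) / 2)"
proof -
  let ?s = "2 ^ (n - t) :: nat"
  have \<psi>c: "\<psi> \<in> carrier_vec (2 ^ n)" using \<psi> by (simp add: pure_state_def)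
  define p where "p x = (cmod (\<psi> $ x))\<^sup>2" for x
  have p: "p x \<ge> 0" for x by (simp add: p_def)
  define w where "w = (\<Sum>x<2 ^ n. if x mod ?s = 0 then p x else 0)"
  have w0: "w \<ge> 0" unfolding w_def by (intro sum_nonneg) (simp add: p)
  have sum_p: "(\<Sum>x<2 ^ n. p x) = 1" using sum_cmod_pure_state[OF \<psi>] by (simp add: p_def)
  have bound: "1 - w \<le> (\<Sum>k = t..<n. (1 - corr n \<psi> $$ (2 * k, 2 * k + 1)) / 2)"
  proof -
    have summand: "(1 - corr n \<psi> $$ (2 * k, 2 * k + 1)) / 2 = (\<Sum>x<2 ^ n. (1 - Z_outcome n k x) / 2 * p x)" if "k < n" for k
    proof -
      have "(\<Sum>x<2 ^ n. (1 - Z_outcome n k x) / 2 * p x) = ((\<Sum>x<2 ^ n. p x) - (\<Sum>x<2 ^ n. Z_outcome n k x * p x)) / 2"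
        by (simp add: sum_subtractf[symmetric] sum_divide_distrib left_diff_distrib)
      then show ?thesis
        using sum_p corr_diag_eq_expect_Z[OF \<psi>c that] by (simp add: p_def)
    qed
    have "1 - w = (\<Sum>x<2 ^ n. if x mod ?s = 0 then 0 else p x)"
      unfolding sum_p[symmetric] w_def sum_subtractf[symmetric] by (intro sum.cong) auto
    also have "\<dots> \<le> (\<Sum>x<2 ^ n. \<Sum>k = t..<n. (1 - Z_outcome n k x) / 2 * p x)"
    proof (rule sum_mono)
      fix x :: nat
      have nn: "0 \<le> (1 - Z_outcome n k x) / 2 * p x" for k
        using p by (simp add: Z_outcome_def)
      show "(if x mod ?s = 0 then 0 else p x) \<le> (\<Sum>k = t..<n. (1 - Z_outcome n k x) / 2 * p x)"
      proof (cases "x mod ?s = 0")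
        case True
        then show ?thesis using nn by (simp add: sum_nonneg)
      next
        case False
        \<comment> \<open>Some low bit of \<open>x\<close> is set. Bit \<open>i\<close> is qubit
          \<open>n - 1 - i\<close>, whose summand alone already accounts for the full weight of
          \<open>x\<close>.\<close>
        then obtain i where i: "i < n - t" "odd (x div 2 ^ i)"
          using mod_power2_eq_0_iff[of "n - t" x] by metis
        define k where "k = n - 1 - i"
        have k: "k \<in> {t..<n}" "n - k - 1 = i" using i by (auto simp: k_def)
        have "p x = (1 - Z_outcome n k x) / 2 * p x"
          using i k by (simp add: Z_outcome_def)
        also have "\<dots> \<le> (\<Sum>k = t..<n. (1 - Z_outcome n k x) / 2 * p x)"
          using k nn by (intro member_le_sum) auto
        finally show ?thesis using False by simp
      qed
    qed
    also have "\<dots> = (\<Sum>k = t..<n. (1 - corr n \<psi> $$ (2 * k, 2 * k + 1)) / 2)"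
      by (subst sum.swap) (rule sum.cong[OF refl], simp only: atLeastLessThan_iff summand)
    finally show ?thesis .
  qed
  have overlap: "\<psi> \<bullet>c pad_zeros n t \<phi> = (\<Sum>a<2 ^ t. \<psi> $ (a * ?s) * cnj (\<phi> $ a))" if "\<phi> \<in> carrier_vec (2 ^ t)" for \<phi>
  proof -
    have "\<psi> \<bullet>c pad_zeros n t \<phi> = (\<Sum>x<2 ^ n. if x mod ?s = 0 then \<psi> $ (x div ?s * ?s) * cnj (\<phi> $ (x div ?s)) else 0)"
      unfolding cscalar_prod_sum[OF \<psi>c pad_zeros_carrier[OF t that]]
    proof (rule sum.cong[OF refl])
      fix x :: nat assume "x \<in> {..<2 ^ n}"
      moreover have "x div ?s * ?s = x" if "x mod ?s = 0" using that by auto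
      ultimately show "\<psi> $ x * cnj (pad_zeros n t \<phi> $ x) =
          (if x mod ?s = 0 then \<psi> $ (x div ?s * ?s) * cnj (\<phi> $ (x div ?s)) else 0)"
        by (simp add: pad_zeros_index[OF t that])
    qed
    then show ?thesis
      by (simp only: sum_pad_zeros[OF t, where f = "\<lambda>a. \<psi> $ (a * ?s) * cnj (\<phi> $ a)"])
  qed
  have w_eq: "w = (\<Sum>a<2 ^ t. p (a * ?s))"
  proof -
    have "w = (\<Sum>x<2 ^ n. if x mod ?s = 0 then p (x div ?s * ?s) else 0)"
      unfolding w_def by (intro sum.cong refl) auto
    then show ?thesis
      by (simp only: sum_pad_zeros[OF t, where f = "\<lambda>a. p (a * ?s)"])
  qed
  show ?thesis
  proof (cases "w = 0")
    case True
    \<comment> \<open>Nothing survives the projection, so there is no vector to normalize. Any state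
      works, as the allowed weight \<open>1 - w\<close> is already 1.\<close>
    let ?\<phi> = "unit_vec (2 ^ t) 0 :: complex vec"
    have "pure_state t ?\<phi>" by (rule pure_state_unit_vec)
    moreover have "1 - (cmod (\<psi> \<bullet>c pad_zeros n t ?\<phi>))\<^sup>2 \<le> 1 - w" using True by simp
    ultimately show ?thesis using bound by (meson order_trans)
  next
    case False
    then have wp: "0 < w" using w0 by simp
    \<comment> \<open>The normalized projection; its overlap with \<open>\<psi>\<close> is the
      length sqrt w of the projected vector.\<close>
    define \<phi> where "\<phi> = vec (2 ^ t) (\<lambda>a. \<psi> $ (a * ?s) / complex_of_real (sqrt w))"
    have \<phi>c: "\<phi> \<in> carrier_vec (2 ^ t)" by (simp add: \<phi>_def)
    have sq: "complex_of_real (sqrt w) * complex_of_real (sqrt w) = complex_of_real w"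
      using wp by (simp flip: of_real_mult)
    have sum_w: "(\<Sum>a<2 ^ t. \<psi> $ (a * ?s) * cnj (\<psi> $ (a * ?s))) = complex_of_real w"
      by (simp only: w_eq p_def of_real_sum complex_norm_square)
    have "\<phi> \<bullet>c \<phi> = (\<Sum>a<2 ^ t. \<psi> $ (a * ?s) * cnj (\<psi> $ (a * ?s))) / complex_of_real w"
      unfolding cscalar_prod_sum[OF \<phi>c \<phi>c] sum_divide_distrib by (intro sum.cong refl) (simp add: \<phi>_def sq)
    then have "pure_state t \<phi>" using \<phi>c wp by (simp add: pure_state_def sum_w)
    moreover have "(cmod (\<psi> \<bullet>c pad_zeros n t \<phi>))\<^sup>2 = w"
    proof -
      have "\<psi> \<bullet>c pad_zeros n t \<phi> = (\<Sum>a<2 ^ t. \<psi> $ (a * ?s) * cnj (\<psi> $ (a * ?s))) / complex_of_real (sqrt w)"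
        unfolding overlap[OF \<phi>c] sum_divide_distrib by (intro sum.cong refl) (simp add: \<phi>_def)
      also have "\<dots> = complex_of_real (w / sqrt w)" by (simp add: sum_w)
      finally have "\<psi> \<bullet>c pad_zeros n t \<phi> = complex_of_real (sqrt w)" using wp by (simp add: real_div_sqrt)
      then show ?thesis using wp by simp
    qed
    ultimately show ?thesis using bound by auto
  qed
qed

text \<open>The projected state of the rotated \<open>\<psi>\<close> is rotated back by the adjoint,
  which is again Gaussian, and unitaries preserve the overlap that determines the distance.\<close>

lemma exists_compressible_near:
  assumes t: "t \<le> n" and \<psi>: "pure_state n \<psi>" and Q: "real_orthogonal_mat (2 * n) Q"
    and N: "Q * corr n \<psi> * transpose_mat Q = normal_form n l"
  shows "\<exists>\<phi>\<in>compressible_gaussian n t. (trace_distance (density \<psi>) (density \<phi>))\<^sup>2 \<le> (\<Sum>k = t..<n. (1 - l k) / 2)"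
proof -
  let ?d = "2 ^ n :: nat"
  obtain G where G: "implements n G Q" using orthogonal_implementable[OF Q] by blast
  have U: "unitary_mat ?d G" using G by (simp add: implements_def)
  have Gc: "mat_adjoint G \<in> carrier_mat ?d ?d" using U by (simp add: unitary_mat_def)
  have \<psi>c: "\<psi> \<in> carrier_vec ?d" using \<psi> by (simp add: pure_state_def)
  have Qc: "Q \<in> carrier_mat (2 * n) (2 * n)" using Q by (simp add: real_orthogonal_mat_def)
  have corr: "corr n (G *\<^sub>v \<psi>) = normal_form n l"
    using corr_covariance[OF G Qc \<psi>c] N by simp
  obtain \<phi> where \<phi>: "pure_state t \<phi>"
    and ov: "1 - (cmod ((G *\<^sub>v \<psi>) \<bullet>c pad_zeros n t \<phi>))\<^sup>2 \<le> (\<Sum>k = t..<n. (1 - corr n (G *\<^sub>v \<psi>) $$ (2 * k, 2 * k + 1)) / 2)"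
    using exists_compressed_overlap[OF t pure_state_unitary[OF U \<psi>]] by blast
  let ?\<phi> = "mat_adjoint G *\<^sub>v pad_zeros n t \<phi>"
  have "gaussian_unitary n (mat_adjoint G)"
    unfolding gaussian_unitary_iff using implements_adjoint[OF G Q] real_orthogonal_mat_transpose[OF Q] by blast
  then have mem: "?\<phi> \<in> compressible_gaussian n t"
    using \<phi> by (auto simp: compressible_gaussian_def)
  have \<chi>c: "pad_zeros n t \<phi> \<in> carrier_vec ?d"
    using pure_state_pad_zeros[OF t \<phi>] by (simp add: pure_state_def)
  have "(trace_distance (density \<psi>) (density ?\<phi>))\<^sup>2 = 1 - (cmod (\<psi> \<bullet>c ?\<phi>))\<^sup>2"
    using trace_distance_pure[OF \<psi> compressible_gaussian_pure[OF t mem]]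
    by (metis real_sqrt_ge_0_iff real_sqrt_pow2)
  also have "\<psi> \<bullet>c ?\<phi> = (G *\<^sub>v \<psi>) \<bullet>c pad_zeros n t \<phi>"
    using unitary_cscalar_prod(1)[OF U \<psi>c \<chi>c] by simp
  also have "1 - (cmod ((G *\<^sub>v \<psi>) \<bullet>c pad_zeros n t \<phi>))\<^sup>2 \<le> (\<Sum>k = t..<n. (1 - l k) / 2)"
    using ov unfolding corr by (simp add: normal_form_index partner_def)
  finally show ?thesis using mem by blast
qed

lemma compressible_gaussian_nonempty:
  assumes "t \<le> n" shows "compressible_gaussian n t \<noteq> {}"
proof -
  have "implements n (1\<^sub>m (2 ^ n)) (1\<^sub>m (2 * n))" by (rule one_implements)
  moreover have "real_orthogonal_mat (2 * n) (1\<^sub>m (2 * n))" by (simp add: real_orthogonal_mat_def)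
  ultimately have "gaussian_unitary n (1\<^sub>m (2 ^ n))" unfolding gaussian_unitary_iff by blast
  moreover have "pure_state t (unit_vec (2 ^ t) 0)" by (rule pure_state_unit_vec)
  ultimately show ?thesis by (auto simp: compressible_gaussian_def)
qed

lemma distance_to_compressible_le:
  assumes "t \<le> n" "pure_state n \<psi>" "\<phi> \<in> compressible_gaussian n t"
  shows "distance_to_compressible n t \<psi> \<le> trace_distance (density \<psi>) (density \<phi>)"
  unfolding distance_to_compressible_def using assms trace_distance_pure(2) compressible_gaussian_pure
  by (intro cINF_lower bdd_belowI2[of _ 0]) blast+

lemma normal_eigenvalues_close:
  assumes t: "t < n" and \<psi>: "pure_state n \<psi>" and dist: "distance_to_compressible n t \<psi> \<le> \<epsilon>\<^sub>A"
    and A: "antisymmetric_mat (2 * n) A"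
    and err: "\<And>i j. i < 2 * n \<Longrightarrow> j < 2 * n \<Longrightarrow> \<bar>A $$ (i, j) - corr n \<psi> $$ (i, j)\<bar> \<le> \<epsilon>" and "0 \<le> \<epsilon>"
  shows "1 - (2 * \<epsilon>\<^sub>A + 2 * real n * \<epsilon>) \<le> normal_eigenvalues A ! t"
proof (rule field_le_epsilon)
  fix \<eta> :: real assume \<eta>: "0 < \<eta>"
  \<comment> \<open>A near-minimizer replaces the minimizer. Its excess below
    \<open>\<eta> / 2\<close> is doubled by the bound and stays below \<open>\<eta>\<close>.\<close>
  have "Inf ((\<lambda>\<phi>. trace_distance (density \<psi>) (density \<phi>)) ` compressible_gaussian n t) < \<epsilon>\<^sub>A + \<eta> / 2"
    using dist \<eta> by (simp add: distance_to_compressible_def)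
  then obtain \<phi> where "\<phi> \<in> compressible_gaussian n t" "trace_distance (density \<psi>) (density \<phi>) < \<epsilon>\<^sub>A + \<eta> / 2"
    using compressible_gaussian_nonempty[of t n] t cInf_lessD by (metis (no_types, lifting) image_iff image_is_empty less_imp_le)
  with normal_eigenvalues_near_compressible[OF t \<psi> _ A err \<open>0 \<le> \<epsilon>\<close>, of \<phi>]
  show "1 - (2 * \<epsilon>\<^sub>A + 2 * real n * \<epsilon>) \<le> normal_eigenvalues A ! t + \<eta>" by simp
qed

text \<open>Even the compressible state built from the normal form is farther than
  \<open>\<epsilon>\<^sub>B\<close>, so the deficits \<open>(1 - l k) / 2\<close> for
  \<open>k \<ge> t\<close> sum to more than \<open>\<epsilon>\<^sub>B\<^sup>2\<close>. The deficit
  at \<open>t\<close> is the largest of the \<open>n - t\<close>, hence exceeds their share of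
  it.\<close>

lemma normal_eigenvalues_far:
  assumes t: "t < n" and \<psi>: "pure_state n \<psi>" and dist: "distance_to_compressible n t \<psi> > \<epsilon>\<^sub>B" and "0 \<le> \<epsilon>\<^sub>B"
    and A: "antisymmetric_mat (2 * n) A"
    and err: "\<And>i j. i < 2 * n \<Longrightarrow> j < 2 * n \<Longrightarrow> \<bar>A $$ (i, j) - corr n \<psi> $$ (i, j)\<bar> \<le> \<epsilon>" and "0 \<le> \<epsilon>"
  shows "normal_eigenvalues A ! t < 1 - 2 * \<epsilon>\<^sub>B\<^sup>2 / real (n - t) + 2 * real n * \<epsilon>"
proof -
  let ?d = "2 * n"
  have tn: "t \<le> n" using t by simp
  have \<psi>c: "\<psi> \<in> carrier_vec (2 ^ n)" using \<psi> by (simp add: pure_state_def)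
  obtain Q l where Q: "real_orthogonal_mat ?d Q" and N: "Q * corr n \<psi> * transpose_mat Q = normal_form n l"
    and l: "\<forall>p<n. 0 \<le> l p" "\<forall>p q. p \<le> q \<longrightarrow> q < n \<longrightarrow> l p \<le> l q"
    using antisymmetric_normal_form[OF corr_antisymmetric[OF \<psi>c]] by (elim exE conjE) (rule that)
  have Qc: "Q \<in> carrier_mat ?d ?d" using Q by (simp add: real_orthogonal_mat_def)
  obtain \<phi> where \<phi>: "\<phi> \<in> compressible_gaussian n t"
    and td: "(trace_distance (density \<psi>) (density \<phi>))\<^sup>2 \<le> (\<Sum>k = t..<n. (1 - l k) / 2)"
    using exists_compressible_near[OF tn \<psi> Q N] by blast
  have "\<epsilon>\<^sub>B < trace_distance (density \<psi>) (density \<phi>)"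
    using dist distance_to_compressible_le[OF tn \<psi> \<phi>] by simp
  then have "\<epsilon>\<^sub>B\<^sup>2 < (trace_distance (density \<psi>) (density \<phi>))\<^sup>2"
    using \<open>0 \<le> \<epsilon>\<^sub>B\<close> by (intro power_strict_mono) auto
  also have "\<dots> \<le> (\<Sum>k = t..<n. (1 - l k) / 2)" by (rule td)
  also have "\<dots> \<le> (\<Sum>k = t..<n. (1 - l t) / 2)"
    using l(2) by (intro sum_mono) auto
  also have "\<dots> = real (n - t) * ((1 - l t) / 2)" by simp
  finally have "2 * \<epsilon>\<^sub>B\<^sup>2 < (1 - l t) * real (n - t)" by (simp add: mult.commute)
  then have lt: "l t < 1 - 2 * \<epsilon>\<^sub>B\<^sup>2 / real (n - t)"
  proof -
    have "0 < real (n - t)" using t by simp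
    then have "2 * \<epsilon>\<^sub>B\<^sup>2 / real (n - t) < 1 - l t"
      using \<open>2 * \<epsilon>\<^sub>B\<^sup>2 < (1 - l t) * real (n - t)\<close> by (simp only: pos_divide_less_eq)
    then show ?thesis by (simp only: less_diff_eq add.commute)
  qed
  have "normal_eigenvalues A ! t \<le> l t + 2 * real n * \<epsilon>"
  proof (rule normal_eigenvalues_le[OF A corr_carrier Qc t])
    fix x assume "\<And>i. 2 * t + 2 \<le> i \<Longrightarrow> i < ?d \<Longrightarrow> mv ?d Q x i = 0"
    from nrm_normal_form_le[OF l t, of "mv ?d Q x", OF this]
    show "nrm ?d (mv ?d (corr n \<psi>) x) \<le> l t * nrm ?d x"
      by (simp add: nrm_mv_conj[OF Q corr_carrier N] nrm_mv_orthogonal[OF Q])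
  next
    fix x
    show "nrm ?d (mv ?d A x) \<le> nrm ?d (mv ?d (corr n \<psi>) x) + 2 * real n * \<epsilon> * nrm ?d x"
      using nrm_mv_diff_entries[of ?d A "corr n \<psi>" \<epsilon> x] err \<open>0 \<le> \<epsilon>\<close> by simp
  qed
  with lt show ?thesis by simp
qed

subsection \<open>The tester\<close>

lemma estimated_correlation_antisymmetric:
  "antisymmetric_mat (2 * n) (estimated_correlation n P q M \<omega>)"
proof -
  have anti: "estimated_correlation n P q M \<omega> $$ (j, k) = - estimated_correlation n P q M \<omega> $$ (k, j)"
    if "j < 2 * n" "k < 2 * n" for j k
    using that by (cases j k rule: linorder_cases) (simp_all add: estimated_correlation_def)
  show ?thesis
    unfolding antisymmetric_mat_def
    by (intro conjI allI impI anti) (simp_all add: estimated_correlation_def)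
qed

lemma estimated_correlation_error:
  assumes "antisymmetric_mat (2 * n) C"
    and "\<And>p. fst p < snd p \<Longrightarrow> snd p < 2 * n \<Longrightarrow> \<bar>empirical_mean n P q M \<omega> p - C $$ p\<bar> \<le> \<epsilon>"
    and "0 \<le> \<epsilon>" and jk: "j < 2 * n" "k < 2 * n"
  shows "\<bar>estimated_correlation n P q M \<omega> $$ (j, k) - C $$ (j, k)\<bar> \<le> \<epsilon>"
proof -
  have anti: "C $$ (j, k) = - C $$ (k, j)"
    using assms(1) jk unfolding antisymmetric_mat_def by blast
  consider "j < k" | "j = k" | "k < j" by linarith
  then show ?thesis
  proof cases
    case 1
    then show ?thesis using assms(2)[of "(j, k)"] jk by (simp add: estimated_correlation_def)
  next
    case 2
    then show ?thesis using anti jk assms(3) by (simp add: estimated_correlation_def)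
  next
    case 3
    then have "\<bar>empirical_mean n P q M \<omega> (k, j) - C $$ (k, j)\<bar> \<le> \<epsilon>"
      using assms(2)[of "(k, j)"] jk by simp
    then show ?thesis using 3 jk anti by (simp add: estimated_correlation_def abs_minus_commute)
  qed
qed

theorem theorem48:
  fixes n t N :: nat and \<psi> :: "complex vec" and \<epsilon>\<^sub>A \<epsilon>\<^sub>B \<epsilon>_corr \<delta> :: real
  assumes "1 \<le> t" and "t < n"
    and "pure_state n \<psi>"
    and "\<epsilon>\<^sub>A \<in> {0..1}" and "\<epsilon>\<^sub>B \<in> {0..1}"
    and "\<epsilon>\<^sub>B > sqrt (real (n - t) * \<epsilon>\<^sub>A)"
    and "\<delta> \<in> {0<..1}"
    and "\<epsilon>_corr = \<epsilon>\<^sub>B\<^sup>2 / real (n - t) - \<epsilon>\<^sub>A"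
    and "N = nat \<lceil>16 * real n ^ 3 / \<epsilon>_corr\<^sup>2 * ln (4 * (real n)\<^sup>2 / \<delta>)\<rceil>"
    and "distance_to_compressible n t \<psi> \<le> \<epsilon>\<^sub>A \<or> distance_to_compressible n t \<psi> > \<epsilon>\<^sub>B"
  shows "(\<exists>P G q. measurement_scheme n P G q) \<and>
    (\<forall>P G q. measurement_scheme n P G q \<longrightarrow>
       (distance_to_compressible n t \<psi> \<le> \<epsilon>\<^sub>A \<longrightarrow>
          pmf (compressibility_test n t P G q \<epsilon>\<^sub>A \<epsilon>\<^sub>B N \<psi>) Close \<ge> 1 - \<delta>) \<and>
       (distance_to_compressible n t \<psi> > \<epsilon>\<^sub>B \<longrightarrow>
          pmf (compressibility_test n t P G q \<epsilon>\<^sub>A \<epsilon>\<^sub>B N \<psi>) Far \<ge> 1 - \<delta>))"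
proof -
  note \<psi> = \<open>pure_state n \<psi>\<close>
  have n: "2 \<le> n" and t: "t < n" using assms(1,2) by auto
  have nt: "1 \<le> real (n - t)" using t by simp
  have \<epsilon>A: "0 \<le> \<epsilon>\<^sub>A" and \<epsilon>B: "0 \<le> \<epsilon>\<^sub>B" "\<epsilon>\<^sub>B \<le> 1" and \<delta>: "0 < \<delta>" "\<delta> \<le> 1"
    using assms(4,5,7) by auto
  have "real (n - t) * \<epsilon>\<^sub>A < \<epsilon>\<^sub>B\<^sup>2"
  proof (rule ccontr)
    assume "\<not> real (n - t) * \<epsilon>\<^sub>A < \<epsilon>\<^sub>B\<^sup>2"
    then have "\<epsilon>\<^sub>B \<le> sqrt (real (n - t) * \<epsilon>\<^sub>A)" by (intro real_le_rsqrt) simp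
    with assms(6) show False by simp
  qed
  then have "\<epsilon>\<^sub>A * real (n - t) < \<epsilon>\<^sub>B\<^sup>2" by (simp only: mult.commute)
  then have e0: "0 < \<epsilon>_corr"
    using nt unfolding assms(8) by (subst diff_gt_0_iff_gt) (simp add: pos_less_divide_eq)
  have e1: "\<epsilon>_corr \<le> 1"
  proof -
    have "\<epsilon>\<^sub>B\<^sup>2 \<le> real (n - t)" using \<epsilon>B nt power_le_one[of \<epsilon>\<^sub>B 2] by linarith
    then have "\<epsilon>\<^sub>B\<^sup>2 / real (n - t) \<le> 1" using nt by (simp only: divide_le_eq_1) auto
    then show ?thesis using \<epsilon>A assms(8) by simp
  qed
  define r where "r = \<epsilon>\<^sub>B\<^sup>2 / real (n - t)"
  define M where "M = N div (2 * n - 1)"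
  define \<epsilon> where "\<epsilon> = \<epsilon>_corr / (2 * real n)"
  have \<epsilon>: "0 \<le> \<epsilon>" using e0 by (simp add: \<epsilon>_def)
  have n\<epsilon>: "2 * real n * \<epsilon> = \<epsilon>_corr" using n by (simp add: \<epsilon>_def)
  have M: "M > 0" and failure: "real (n * (2 * n - 1)) * (2 * exp (- (real M * \<epsilon>\<^sup>2 / 2))) \<le> \<delta>"
    unfolding M_def \<epsilon>_def using sample_size_bound[OF n e0 e1 \<delta> assms(9)] by auto
  have C: "antisymmetric_mat (2 * n) (corr n \<psi>)"
    using \<psi> by (intro corr_antisymmetric) (simp add: pure_state_def)
  \<comment> \<open>Both verdicts reduce to a deterministic claim: any antisymmetric matrix within
    \<open>\<epsilon>\<close> of the true one in each entry yields \<open>v\<close>. The probability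
    bound is then the same in both cases.\<close>
  have success: "1 - \<delta> \<le> pmf (compressibility_test n t P G q \<epsilon>\<^sub>A \<epsilon>\<^sub>B N \<psi>) v"
    if scheme: "measurement_scheme n P G q"
      and good: "\<And>A. antisymmetric_mat (2 * n) A \<Longrightarrow>
        (\<And>i j. i < 2 * n \<Longrightarrow> j < 2 * n \<Longrightarrow> \<bar>A $$ (i, j) - corr n \<psi> $$ (i, j)\<bar> \<le> \<epsilon>) \<Longrightarrow>
        (if normal_eigenvalues A ! t \<ge> 1 - (\<epsilon>\<^sub>B\<^sup>2 / real (n - t) + \<epsilon>\<^sub>A) then Close else Far) = v"
    for P G q v
  proof -
    let ?\<Omega> = "Pi_pmf (P \<times> {..<M}) 0 (\<lambda>(B, i). measure_basis (G B *\<^sub>v \<psi>))"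
    let ?E = "{\<omega>. \<forall>p. fst p < snd p \<and> snd p < 2 * n \<longrightarrow> \<bar>empirical_mean n P q M \<omega> p - corr n \<psi> $$ p\<bar> < \<epsilon>}"
    let ?f = "\<lambda>\<omega>. if normal_eigenvalues (estimated_correlation n P q M \<omega>) ! t \<ge> 1 - (\<epsilon>\<^sub>B\<^sup>2 / real (n - t) + \<epsilon>\<^sub>A) then Close else Far"
    have part: "partition_on {(j, k). j < k \<and> k < 2 * n} P"
      using scheme by (simp add: measurement_scheme_def)
    have "1 - \<delta> \<le> 1 - real (n * (2 * n - 1)) * (2 * exp (- (real M * \<epsilon>\<^sup>2 / 2)))"
      using failure by simp
    also have "\<dots> \<le> measure_pmf.prob ?\<Omega> ?E"
      using measurement_scheme_mean[OF scheme _ _ \<psi>] by (intro empirical_means_accurate part M \<epsilon>)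
    also have "\<dots> \<le> measure_pmf.prob ?\<Omega> (?f -` {v})"
    proof (rule measure_pmf.finite_measure_mono)
      show "?E \<subseteq> ?f -` {v}"
      proof
        fix \<omega> assume "\<omega> \<in> ?E"
        then have acc: "\<bar>empirical_mean n P q M \<omega> p - corr n \<psi> $$ p\<bar> \<le> \<epsilon>" if "fst p < snd p" "snd p < 2 * n" for p
          using that by (cases p) (simp add: less_imp_le)
        have "?f \<omega> = v"
          by (intro good estimated_correlation_antisymmetric estimated_correlation_error C acc \<epsilon>)
        then show "\<omega> \<in> ?f -` {v}" by simp
      qed
    qed simp
    also have "\<dots> = pmf (compressibility_test n t P G q \<epsilon>\<^sub>A \<epsilon>\<^sub>B N \<psi>) v"
      by (simp add: compressibility_test_def Let_def pmf_map M_def)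
    finally show ?thesis .
  qed
  show ?thesis
  proof (intro conjI allI impI)
    show "\<exists>P G q. measurement_scheme n P G q"
      using n by (intro measurement_scheme_exists) simp
  next
    fix P G q assume scheme: "measurement_scheme n P G q" and close: "distance_to_compressible n t \<psi> \<le> \<epsilon>\<^sub>A"
    show "pmf (compressibility_test n t P G q \<epsilon>\<^sub>A \<epsilon>\<^sub>B N \<psi>) Close \<ge> 1 - \<delta>"
    proof (rule success[OF scheme])
      fix A :: "real mat"
      assume A: "antisymmetric_mat (2 * n) A"
        and err: "\<And>i j. i < 2 * n \<Longrightarrow> j < 2 * n \<Longrightarrow> \<bar>A $$ (i, j) - corr n \<psi> $$ (i, j)\<bar> \<le> \<epsilon>"
      have "1 - (2 * \<epsilon>\<^sub>A + 2 * real n * \<epsilon>) \<le> normal_eigenvalues A ! t"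
        using t \<psi> close A err \<epsilon> by (rule normal_eigenvalues_close)
      \<comment> \<open>Here 2 \<open>\<epsilon>\<^sub>A\<close> + \<open>\<epsilon>_corr\<close> is
        exactly the threshold gap r + \<open>\<epsilon>\<^sub>A\<close>.\<close>
      then have "1 - (\<epsilon>\<^sub>B\<^sup>2 / real (n - t) + \<epsilon>\<^sub>A) \<le> normal_eigenvalues A ! t"
        unfolding n\<epsilon> assms(8) r_def[symmetric] by linarith
      then show "(if normal_eigenvalues A ! t \<ge> 1 - (\<epsilon>\<^sub>B\<^sup>2 / real (n - t) + \<epsilon>\<^sub>A) then Close else Far) = Close"
        by simp
    qed
  next
    fix P G q assume scheme: "measurement_scheme n P G q" and far: "distance_to_compressible n t \<psi> > \<epsilon>\<^sub>B"
    show "pmf (compressibility_test n t P G q \<epsilon>\<^sub>A \<epsilon>\<^sub>B N \<psi>) Far \<ge> 1 - \<delta>"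
    proof (rule success[OF scheme])
      fix A :: "real mat"
      assume A: "antisymmetric_mat (2 * n) A"
        and err: "\<And>i j. i < 2 * n \<Longrightarrow> j < 2 * n \<Longrightarrow> \<bar>A $$ (i, j) - corr n \<psi> $$ (i, j)\<bar> \<le> \<epsilon>"
      have "normal_eigenvalues A ! t < 1 - 2 * \<epsilon>\<^sub>B\<^sup>2 / real (n - t) + 2 * real n * \<epsilon>"
        using t \<psi> far \<epsilon>B(1) A err \<epsilon> by (rule normal_eigenvalues_far)
      \<comment> \<open>Here 2 r - \<open>\<epsilon>_corr\<close> is again r +
        \<open>\<epsilon>\<^sub>A\<close>; strictness comes from the distance being strictly above
        \<open>\<epsilon>\<^sub>B\<close>.\<close>
      then have "normal_eigenvalues A ! t < 1 - (\<epsilon>\<^sub>B\<^sup>2 / real (n - t) + \<epsilon>\<^sub>A)"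
        unfolding n\<epsilon> assms(8) times_divide_eq_right[symmetric] r_def[symmetric] by linarith
      then show "(if normal_eigenvalues A ! t \<ge> 1 - (\<epsilon>\<^sub>B\<^sup>2 / real (n - t) + \<epsilon>\<^sub>A) then Close else Far) = Far"
        by simp
    qed
  qed
qed

end
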